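(* Let $\mathcal{L}'$ be a first-order language and $\mathcal{N}$ an $\mathcal{L}'$-structure. Then the following are equivalent: (1) $\mathcal{N}$ has the finitary embedding Ramsey property. (2) $\mathcal{N}$ has the modelling property.
   Context: Structures need not be relational or locally finite. $\mathrm{Age}(\mathcal{N})$ is the class of (isomorphism types of) finitely generated substructures of $\mathcal{N}$, treated as an isomorphism-closed class. All types are over $\emptyset$ and quantifier-free types $\mathrm{qftp}$ are complete and computed in the ambient structure. Finitary ERP. For structures $M,N$, a finite subset $A\subseteq M$ and a subset $C\subseteq N$, $\binom{C}{A}$ is the set of copies of $A$ in $C$ with the same quantifier-free type, i.e. the set of maps $f:A\to C$ with $\mathrm{qftp}_N(f(\bar a))=\mathrm{qftp}_M(\bar a)$ for an enumeration $\bar a$ of $A$. Write $C\to(B)^A_2$ if for every $\chi:\binom{C}{A}\to\{0,1\}$ there is $e\in\binom{C}{B}$ such that $\chi$ is constant on the set of those $f\in\binom{C}{A}$ with image contained in $e(B)$. $\mathcal{N}$ has the finitary embedding Ramsey property if for every $M\in\mathrm{Age}(\mathcal{N})$ and all finite subsets $A,B\subseteq M$ there are $N\in\mathrm{Age}(\mathcal{N})$ and a finite $C\subseteq N$ with $C\to(B)^A_2$. Modelling property. For a set $\Delta$ of formulas, $\mathrm{tp}^\Delta(\bar a)$ is the restriction of $\mathrm{tp}(\bar a)$ to formulas and negations of formulas in $\Delta$. Let $T$ be a complete theory with infinite models in a language $\mathcal{L}$ and let $\mathbb{M}\models T$ be $\kappa$-saturated and $\kappa$-homogeneous for a large cardinal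 $\kappa$ (in particular larger than $|\mathcal{L}|$, $|\mathcal{N}|$ and the length of the tuples considered). All sequences consist of tuples of the same length. $(\bar a_i:i\in\mathcal{N})$ from $\mathbb{M}$ is $\mathcal{N}$-indiscernible if for all $n$ and $i_1,\dots,i_n,j_1,\dots,j_n\in\mathcal{N}$, $\mathrm{qftp}_{\mathcal{N}}(i_1,\dots,i_n)=\mathrm{qftp}_{\mathcal{N}}(j_1,\dots,j_n)$ implies $\mathrm{tp}_{\mathbb{M}}(\bar a_{i_1},\dots,\bar a_{i_n})=\mathrm{tp}_{\mathbb{M}}(\bar a_{j_1},\dots,\bar a_{j_n})$. $(\bar b_i:i\in\mathcal{N})$ is (locally) based on $(\bar a_i:i\in\mathcal{N})$ if for every finite set $\Delta$ of $\mathcal{L}$-formulas, every $n$ and all $i_1,\dots,i_n\in\mathcal{N}$ there are $j_1,\dots,j_n\in\mathcal{N}$ with $\mathrm{qftp}_{\mathcal{N}}(\bar i)=\mathrm{qftp}_{\mathcal{N}}(\bar j)$ and $\mathrm{tp}^\Delta_{\mathbb{M}}(\bar b_{i_1},\dots,\bar b_{i_n})=\mathrm{tp}^\Delta_{\mathbb{M}}(\bar a_{j_1},\dots,\bar a_{j_n})$. $\mathcal{N}$ has the modelling property if for every such $T$ (in any language) and every $\mathcal{N}$-indexed sequence of tuples from $\mathbb{M}\models T$ there is an $\mathcal{N}$-indiscernible sequence in $\mathbb{M}$ based on it. *)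

theory Defs
  imports Main "HOL-Library.FuncSet"
begin

unbundle cardinal_syntax

section \<open>Languages, structures, formulas\<close>

text \<open>Constants are function symbols of arity 0. Only the arities of symbols in
  \<open>fsyms\<close> and \<open>rsyms\<close> matter.\<close>

record ('f, 'r) language =
  fsyms :: "'f set"
  rsyms :: "'r set"
  farity :: "'f \<Rightarrow> nat"
  rarity :: "'r \<Rightarrow> nat"

text \<open>Interpretations are only meaningful on symbols of the language and on argument lists
  over \<open>univ\<close> of the right length; everything below ignores the other values.\<close>

record ('f, 'r, 'a) struct =
  univ :: "'a set"
  fint :: "'f \<Rightarrow> 'a list \<Rightarrow> 'a"
  rint :: "'r \<Rightarrow> 'a list \<Rightarrow> bool"

definition is_structure :: "('f, 'r) language \<Rightarrow> ('f, 'r, 'a) struct \<Rightarrow> bool" where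
  "is_structure L M \<longleftrightarrow> univ M \<noteq> {} \<and>
     (\<forall>f\<in>fsyms L. \<forall>xs\<in>lists (univ M). length xs = farity L f \<longrightarrow> fint M f xs \<in> univ M)"

datatype ('f, 'v) tm = Var 'v | Fun 'f "('f, 'v) tm list"

text \<open>The type \<open>'v\<close> of variables is a parameter: tuples indexed by arbitrary sets need
  variables indexed by these sets. All instances used below are infinite types.\<close>

datatype ('f, 'r, 'v) fm =
    Eq "('f, 'v) tm" "('f, 'v) tm"
  | Rel 'r "('f, 'v) tm list"
  | Neg "('f, 'r, 'v) fm"
  | Conj "('f, 'r, 'v) fm" "('f, 'r, 'v) fm"
  | Ex 'v "('f, 'r, 'v) fm"

primrec wf_tm :: "('f, 'r) language \<Rightarrow> ('f, 'v) tm \<Rightarrow> bool" where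
  "wf_tm L (Var v) \<longleftrightarrow> True"
| "wf_tm L (Fun f ts) \<longleftrightarrow> f \<in> fsyms L \<and> length ts = farity L f \<and> list_all (wf_tm L) ts"

primrec wf_fm :: "('f, 'r) language \<Rightarrow> ('f, 'r, 'v) fm \<Rightarrow> bool" where
  "wf_fm L (Eq s t) \<longleftrightarrow> wf_tm L s \<and> wf_tm L t"
| "wf_fm L (Rel r ts) \<longleftrightarrow> r \<in> rsyms L \<and> length ts = rarity L r \<and> list_all (wf_tm L) ts"
| "wf_fm L (Neg \<phi>) \<longleftrightarrow> wf_fm L \<phi>"
| "wf_fm L (Conj \<phi> \<psi>) \<longleftrightarrow> wf_fm L \<phi> \<and> wf_fm L \<psi>"
| "wf_fm L (Ex v \<phi>) \<longleftrightarrow> wf_fm L \<phi>"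

primrec fv_tm :: "('f, 'v) tm \<Rightarrow> 'v set" where
  "fv_tm (Var v) = {v}"
| "fv_tm (Fun f ts) = \<Union> (set (map fv_tm ts))"

primrec fv :: "('f, 'r, 'v) fm \<Rightarrow> 'v set" where
  "fv (Eq s t) = fv_tm s \<union> fv_tm t"
| "fv (Rel r ts) = \<Union> (set (map fv_tm ts))"
| "fv (Neg \<phi>) = fv \<phi>"
| "fv (Conj \<phi> \<psi>) = fv \<phi> \<union> fv \<psi>"
| "fv (Ex v \<phi>) = fv \<phi> - {v}"

primrec qfree :: "('f, 'r, 'v) fm \<Rightarrow> bool" where
  "qfree (Eq s t) \<longleftrightarrow> True"
| "qfree (Rel r ts) \<longleftrightarrow> True"
| "qfree (Neg \<phi>) \<longleftrightarrow> qfree \<phi>"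
| "qfree (Conj \<phi> \<psi>) \<longleftrightarrow> qfree \<phi> \<and> qfree \<psi>"
| "qfree (Ex v \<phi>) \<longleftrightarrow> False"

primrec eval :: "('f, 'r, 'a) struct \<Rightarrow> ('v \<Rightarrow> 'a) \<Rightarrow> ('f, 'v) tm \<Rightarrow> 'a" where
  "eval M \<alpha> (Var v) = \<alpha> v"
| "eval M \<alpha> (Fun f ts) = fint M f (map (eval M \<alpha>) ts)"

primrec sat :: "('f, 'r, 'a) struct \<Rightarrow> ('v \<Rightarrow> 'a) \<Rightarrow> ('f, 'r, 'v) fm \<Rightarrow> bool" where
  "sat M \<alpha> (Eq s t) \<longleftrightarrow> eval M \<alpha> s = eval M \<alpha> t"
| "sat M \<alpha> (Rel r ts) \<longleftrightarrow> rint M r (map (eval M \<alpha>) ts)"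
| "sat M \<alpha> (Neg \<phi>) \<longleftrightarrow> \<not> sat M \<alpha> \<phi>"
| "sat M \<alpha> (Conj \<phi> \<psi>) \<longleftrightarrow> sat M \<alpha> \<phi> \<and> sat M \<alpha> \<psi>"
| "sat M \<alpha> (Ex v \<phi>) \<longleftrightarrow> (\<exists>a\<in>univ M. sat M (\<alpha>(v := a)) \<phi>)"


section \<open>Types\<close>

text \<open>Complete type over the empty set of the tuple \<open>(\<alpha> v : v \<in> V)\<close>, the entry \<open>\<alpha> v\<close> being
  substituted for the variable \<open>v\<close>.\<close>

definition tp ::
  "('f, 'r) language \<Rightarrow> ('f, 'r, 'a) struct \<Rightarrow> 'v set \<Rightarrow> ('v \<Rightarrow> 'a) \<Rightarrow> ('f, 'r, 'v) fm set" where
  "tp L M V \<alpha> = {\<phi>. wf_fm L \<phi> \<and> fv \<phi> \<subseteq> V \<and> sat M \<alpha> \<phi>}"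

definition tp_restr ::
  "('f, 'r, 'v) fm set \<Rightarrow> ('f, 'r) language \<Rightarrow> ('f, 'r, 'a) struct \<Rightarrow> 'v set \<Rightarrow> ('v \<Rightarrow> 'a)
    \<Rightarrow> ('f, 'r, 'v) fm set" where
  "tp_restr \<Delta> L M V \<alpha> = tp L M V \<alpha> \<inter> (\<Delta> \<union> Neg ` \<Delta>)"

text \<open>Quantifier-free type of a finite tuple, in the variables \<open>0, \<dots>, n - 1\<close>.\<close>

definition qftp ::
  "('f, 'r) language \<Rightarrow> ('f, 'r, 'a) struct \<Rightarrow> 'a list \<Rightarrow> ('f, 'r, nat) fm set" where
  "qftp L M as = {\<phi> \<in> tp L M {..<length as} (\<lambda>k. as ! k). qfree \<phi>}"


section \<open>The age and the finitary embedding Ramsey property\<close>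

inductive_set generated ::
  "('f, 'r) language \<Rightarrow> ('f, 'r, 'a) struct \<Rightarrow> 'a set \<Rightarrow> 'a set"
  for L :: "('f, 'r) language" and N :: "('f, 'r, 'a) struct" and S :: "'a set" where
  base: "s \<in> S \<Longrightarrow> s \<in> generated L N S"
| step: "f \<in> fsyms L \<Longrightarrow> length xs = farity L f \<Longrightarrow> \<forall>x\<in>set xs. x \<in> generated L N S
    \<Longrightarrow> fint N f xs \<in> generated L N S"

definition isomorphic ::
  "('f, 'r) language \<Rightarrow> ('f, 'r, 'a) struct \<Rightarrow> ('f, 'r, 'b) struct \<Rightarrow> bool" where
  "isomorphic L M M' \<longleftrightarrow> (\<exists>h. bij_betw h (univ M) (univ M') \<and>
     (\<forall>f\<in>fsyms L. \<forall>xs\<in>lists (univ M). length xs = farity L f \<longrightarrow>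
        h (fint M f xs) = fint M' f (map h xs)) \<and>
     (\<forall>r\<in>rsyms L. \<forall>xs\<in>lists (univ M). length xs = rarity L r \<longrightarrow>
        rint M r xs = rint M' r (map h xs)))"

definition in_age ::
  "('f, 'r) language \<Rightarrow> ('f, 'r, 'a) struct \<Rightarrow> ('f, 'r, 'b) struct \<Rightarrow> bool" where
  "in_age L N M \<longleftrightarrow> is_structure L M \<and>
     (\<exists>S. finite S \<and> S \<subseteq> univ N \<and> isomorphic L M (N\<lparr>univ := generated L N S\<rparr>))"

text \<open>\<open>copies L M A N C\<close> is the set of copies in \<open>C \<subseteq> N\<close> of the finite set \<open>A \<subseteq> M\<close>; maps
  \<open>A \<rightarrow> C\<close> are functions that are \<open>undefined\<close> outside \<open>A\<close>.\<close>

definition copies ::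
  "('f, 'r) language \<Rightarrow> ('f, 'r, 'a) struct \<Rightarrow> 'a set \<Rightarrow> ('f, 'r, 'b) struct \<Rightarrow> 'b set
    \<Rightarrow> ('a \<Rightarrow> 'b) set" where
  "copies L M A N C = {f \<in> A \<rightarrow>\<^sub>E C.
     \<exists>as. distinct as \<and> set as = A \<and> qftp L N (map f as) = qftp L M as}"

definition ramsey_arrow ::
  "('f, 'r) language \<Rightarrow> ('f, 'r, 'b) struct \<Rightarrow> 'b set \<Rightarrow> ('f, 'r, 'a) struct \<Rightarrow> 'a set \<Rightarrow> 'a set
    \<Rightarrow> bool" where
  "ramsey_arrow L N C M B A \<longleftrightarrow>
     (\<forall>\<chi> \<in> copies L M A N C \<rightarrow> {0, 1 :: nat}. \<exists>e \<in> copies L M B N C. \<exists>c.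
        \<forall>f \<in> copies L M A N C. f ` A \<subseteq> e ` B \<longrightarrow> \<chi> f = c)"

text \<open>Every member of the age has an isomorphic copy whose elements have the type of
  those of \<open>N\<close>, so that quantifying over structures of this type is no restriction.\<close>

definition finitary_ERP :: "('f, 'r) language \<Rightarrow> ('f, 'r, 'a) struct \<Rightarrow> bool" where
  "finitary_ERP L N \<longleftrightarrow>
     (\<forall>M :: ('f, 'r, 'a) struct. in_age L N M \<longrightarrow>
       (\<forall>A B. finite A \<and> A \<subseteq> univ M \<and> finite B \<and> B \<subseteq> univ M \<longrightarrow>
         (\<exists>(N' :: ('f, 'r, 'a) struct) C. in_age L N N' \<and> finite C \<and> C \<subseteq> univ N' \<and>
            ramsey_arrow L N' C M B A)))"


section \<open>Theories, saturation, homogeneity\<close>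

definition sentences :: "('f, 'r) language \<Rightarrow> ('f, 'r, nat) fm set" where
  "sentences L = {\<phi>. wf_fm L \<phi> \<and> fv \<phi> = {}}"

definition is_model ::
  "('f, 'r) language \<Rightarrow> ('f, 'r, nat) fm set \<Rightarrow> ('f, 'r, 'a) struct \<Rightarrow> bool" where
  "is_model L T M \<longleftrightarrow> is_structure L M \<and>
     (\<forall>\<phi>\<in>T. \<forall>\<alpha>. range \<alpha> \<subseteq> univ M \<longrightarrow> sat M \<alpha> \<phi>)"

text \<open>Theories are taken to be deductively closed. Consistency is not part of this
  definition: it is only used for theories that have models.\<close>

definition complete_theory :: "('f, 'r) language \<Rightarrow> ('f, 'r, nat) fm set \<Rightarrow> bool" where
  "complete_theory L T \<longleftrightarrow> T \<subseteq> sentences L \<and> (\<forall>\<phi>\<in>sentences L. \<phi> \<in> T \<or> Neg \<phi> \<in> T)"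

text \<open>A formula \<open>\<phi>(x)\<close> with parameters in \<open>A\<close> is given as a pair of a formula, in which
  variable 0 plays the role of \<open>x\<close>, and an assignment of elements of \<open>A\<close> to its other free
  variables.\<close>

definition fms_over ::
  "('f, 'r) language \<Rightarrow> 'a set \<Rightarrow> (('f, 'r, nat) fm \<times> (nat \<Rightarrow> 'a)) set" where
  "fms_over L A = {(\<phi>, \<rho>). wf_fm L \<phi> \<and> \<rho> ` (fv \<phi> - {0}) \<subseteq> A}"

definition realises ::
  "('f, 'r, 'a) struct \<Rightarrow> 'a \<Rightarrow> (('f, 'r, nat) fm \<times> (nat \<Rightarrow> 'a)) set \<Rightarrow> bool" where
  "realises M c p \<longleftrightarrow> (\<forall>(\<phi>, \<rho>)\<in>p. sat M (\<rho>(0 := c)) \<phi>)"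

definition saturated ::
  "('f, 'r) language \<Rightarrow> 'k rel \<Rightarrow> ('f, 'r, 'a) struct \<Rightarrow> bool" where
  "saturated L \<kappa> M \<longleftrightarrow> (\<forall>A p. A \<subseteq> univ M \<and> |A| <o \<kappa> \<and> p \<subseteq> fms_over L A \<and>
     (\<forall>q. finite q \<and> q \<subseteq> p \<longrightarrow> (\<exists>c\<in>univ M. realises M c q)) \<longrightarrow>
     (\<exists>c\<in>univ M. realises M c p))"

definition partial_elementary ::
  "('f, 'r) language \<Rightarrow> ('f, 'r, 'a) struct \<Rightarrow> 'a set \<Rightarrow> ('a \<Rightarrow> 'a) \<Rightarrow> bool" where
  "partial_elementary L M A g \<longleftrightarrow> A \<subseteq> univ M \<and> g ` A \<subseteq> univ M \<and>
     (\<forall>(\<phi> :: ('f, 'r, nat) fm) \<rho>. wf_fm L \<phi> \<and> \<rho> ` fv \<phi> \<subseteq> A \<longrightarrow>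
        (sat M \<rho> \<phi> \<longleftrightarrow> sat M (g \<circ> \<rho>) \<phi>))"

definition homogeneous ::
  "('f, 'r) language \<Rightarrow> 'k rel \<Rightarrow> ('f, 'r, 'a) struct \<Rightarrow> bool" where
  "homogeneous L \<kappa> M \<longleftrightarrow> (\<forall>A g. |A| <o \<kappa> \<and> partial_elementary L M A g \<longrightarrow>
     (\<forall>a\<in>univ M. \<exists>h. partial_elementary L M (insert a A) h \<and> (\<forall>x\<in>A. h x = g x)))"


section \<open>Generalised indiscernibles and the modelling property\<close>

text \<open>A sequence of tuples of length \<open>I\<close>, indexed by \<open>N\<close>, is a function \<open>a\<close> such that
  \<open>a i \<xi>\<close> is the entry with index \<open>\<xi> \<in> I\<close> of the tuple \<open>a\<^sub>i\<close>. In the concatenation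
  \<open>a\<^sub>i\<^sub>1 \<dots> a\<^sub>i\<^sub>n\<close> this entry of the \<open>k\<close>-th tuple is substituted for the variable \<open>(k, \<xi>)\<close>.\<close>

definition concat_tuple :: "('n \<Rightarrow> 'x \<Rightarrow> 'm) \<Rightarrow> 'n list \<Rightarrow> nat \<times> 'x \<Rightarrow> 'm" where
  "concat_tuple a is = (\<lambda>(k, \<xi>). a (is ! k) \<xi>)"

definition tuple_sequence ::
  "('f, 'r, 'n) struct \<Rightarrow> ('g, 's, 'm) struct \<Rightarrow> 'x set \<Rightarrow> ('n \<Rightarrow> 'x \<Rightarrow> 'm) \<Rightarrow> bool" where
  "tuple_sequence N M I a \<longleftrightarrow> (\<forall>i\<in>univ N. \<forall>\<xi>\<in>I. a i \<xi> \<in> univ M)"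

definition indiscernible ::
  "('f, 'r) language \<Rightarrow> ('f, 'r, 'n) struct \<Rightarrow> ('g, 's) language \<Rightarrow> ('g, 's, 'm) struct
    \<Rightarrow> 'x set \<Rightarrow> ('n \<Rightarrow> 'x \<Rightarrow> 'm) \<Rightarrow> bool" where
  "indiscernible L' N L M I a \<longleftrightarrow>
     (\<forall>n. \<forall>is\<in>lists (univ N). \<forall>js\<in>lists (univ N). length is = n \<and> length js = n \<and>
        qftp L' N is = qftp L' N js \<longrightarrow>
        tp L M ({..<n} \<times> I) (concat_tuple a is) = tp L M ({..<n} \<times> I) (concat_tuple a js))"

definition based_on ::
  "('f, 'r) language \<Rightarrow> ('f, 'r, 'n) struct \<Rightarrow> ('g, 's) language \<Rightarrow> ('g, 's, 'm) struct
    \<Rightarrow> 'x set \<Rightarrow> ('n \<Rightarrow> 'x \<Rightarrow> 'm) \<Rightarrow> ('n \<Rightarrow> 'x \<Rightarrow> 'm) \<Rightarrow> bool" where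
  "based_on L' N L M I b a \<longleftrightarrow>
     (\<forall>\<Delta> n. finite \<Delta> \<and> (\<forall>\<phi>\<in>\<Delta>. wf_fm L \<phi>) \<longrightarrow>
       (\<forall>is\<in>lists (univ N). length is = n \<longrightarrow>
         (\<exists>js\<in>lists (univ N). length js = n \<and> qftp L' N is = qftp L' N js \<and>
            tp_restr \<Delta> L M ({..<n} \<times> I) (concat_tuple b is) =
            tp_restr \<Delta> L M ({..<n} \<times> I) (concat_tuple a js))))"

text \<open>HOL cannot quantify over all languages and all models inside a formula. The elements
  of the models, the symbols of the languages and the indices of the tuples are therefore
  taken from one type \<open>'u\<close>, an explicit parameter. Only the size of \<open>univ M\<close> is thereby
  bounded: a \<open>\<kappa>\<close>-saturated infinite model has at least \<open>\<kappa>\<close> elements, so \<open>'u\<close> has room for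
  every cardinal \<open>\<kappa>\<close> that can occur, and for every language and every length of tuples of
  cardinality less than \<open>\<kappa>\<close>.\<close>

definition modelling_property ::
  "'u itself \<Rightarrow> ('f, 'r) language \<Rightarrow> ('f, 'r, 'n) struct \<Rightarrow> bool" where
  "modelling_property (_ :: 'u itself) L' N \<longleftrightarrow>
     (\<forall>(L :: ('u, 'u) language) T (M :: ('u, 'u, 'u) struct) (\<kappa> :: 'u rel) (I :: 'u set) a.
        complete_theory L T \<and>
        (\<exists>M\<^sub>0 :: ('u, 'u, 'u) struct. is_model L T M\<^sub>0 \<and> infinite (univ M\<^sub>0)) \<and>
        is_model L T M \<and>
        Card_order \<kappa> \<and> natLeq <o \<kappa> \<and> |fsyms L <+> rsyms L| <o \<kappa> \<and> |univ N| <o \<kappa> \<and> |I| <o \<kappa> \<and>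
        saturated L \<kappa> M \<and> homogeneous L \<kappa> M \<and>
        tuple_sequence N M I a \<longrightarrow>
        (\<exists>b. tuple_sequence N M I b \<and> indiscernible L' N L M I b \<and> based_on L' N L M I b a))"

text \<open>The type \<open>'u\<close> is large enough to contain models that are \<open>\<kappa>\<close>-saturated for some
  \<open>\<kappa> > |N| + \<aleph>\<^sub>0\<close>; over smaller types the modelling property could hold vacuously.\<close>

definition large_universe :: "'u itself \<Rightarrow> ('f, 'r, 'n) struct \<Rightarrow> bool" where
  "large_universe (_ :: 'u itself) N \<longleftrightarrow>
     |Pow (univ N <+> (UNIV :: nat set))| \<le>o |UNIV :: 'u set|"

end

theory Submission imports Defs begin

text \<open>If \<open>N\<close> has the Ramsey property then every finite set of colourings of copies can be made
  constant on a copy of a given finite subset of \<open>N\<close>. Colouring the copies of finite tuples \<open>i\<close> by the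
  truth values of formulas at \<open>a\<^sub>i\<close> shows that the type expressing "indiscernible and based on \<open>a\<close>"
  is finitely satisfied by reindexing \<open>a\<close>, hence it is realised by saturation.

  Conversely, if the Ramsey property fails for \<open>A\<close> and \<open>B\<close>, compactness gives one bad colouring of
  all copies of \<open>A\<close> in \<open>N\<close>. It is coded by a relation of arity \<open>|A|\<close> on \<open>N\<close>, which embeds into a
  saturated structure with one generic relation. An indiscernible sequence based on this embedding
  yields a copy of \<open>B\<close> on which the colouring is constant.\<close>

text \<open>Two questions of size shape the proof. Saturation speaks of one variable, while an
  indiscernible sequence realises a type in |\<open>univ N \<times> I\<close>| variables; the values
  are found one variable at a time, preserving finite satisfiability, by Zorn's lemma for conditions
  of finite character. In the converse the ambient model must live in \<open>'u\<close>, which is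
  only known to have at least 2^(|N| + aleph_0) elements. So the model is built by hand, with
  \<kappa> the successor of |N| + aleph_0, such that every behaviour of one relation over fewer than
  \<kappa> parameters is attained by a new element. This gives quantifier elimination by
  back-and-forth, hence saturation and homogeneity, and it lets small relations of the same positive
  arity embed. Arbitrary function symbols cause no trouble, because copies only depend on
  quantifier-free types of finite tuples and every member of the age embeds into \<open>N\<close>
  with these types preserved; so all arrows can be moved between finite subsets of \<open>N\<close>.
  Compactness always enters as an accumulation point of \<open>bool\<close>-valued functions along
  finite sets, once for colourings and once for types.\<close>

section \<open>Partial maps of finite character\<close>

text \<open>Zorn's lemma on graphs ordered by inclusion: finite character carries \<open>P\<close>
  to the union of a chain, and a maximal map has full domain because \<open>extend\<close> would
  enlarge it. This replaces transfinite recursion in finding limits, realising types and embedding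
  relations.\<close>

lemma finite_character_total:
  fixes P :: "('a \<rightharpoonup> 'b) \<Rightarrow> bool"
  assumes finchar: "\<And>g. (\<And>Y. finite Y \<Longrightarrow> P (g |` Y)) \<Longrightarrow> P g"
    and restr: "\<And>g Y. P g \<Longrightarrow> P (g |` Y)"
    and empty: "P Map.empty"
    and extend: "\<And>g x. P g \<Longrightarrow> dom g \<subseteq> X \<Longrightarrow> x \<in> X \<Longrightarrow> x \<notin> dom g \<Longrightarrow> \<exists>y. P (g(x \<mapsto> y))"
  shows "\<exists>g. dom g = X \<and> P g"
proof -
  let ?A = "Map.graph ` {g. P g \<and> dom g \<subseteq> X}"
  have "\<exists>M\<in>?A. \<forall>Z\<in>?A. M \<subseteq> Z \<longrightarrow> Z = M"
  proof (rule subset_Zorn_nonempty)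
    show "?A \<noteq> {}" using empty by auto
    fix C assume ne: "C \<noteq> {}" and ch: "subset.chain ?A C"
    define g where "g x = (if \<exists>y. (x, y) \<in> \<Union>C then Some (SOME y. (x, y) \<in> \<Union>C) else None)" for x
    have mem: "\<exists>h. P h \<and> dom h \<subseteq> X \<and> Z = Map.graph h" if "Z \<in> C" for Z
      using ch that unfolding subset.chain_def by auto
    have sv: "y = z" if yz: "(x, y) \<in> \<Union>C" "(x, z) \<in> \<Union>C" for x y z
    proof -
      have "\<exists>Z\<in>C. {(x, y), (x, z)} \<subseteq> Z"
        using finite_subset_Union_chain[OF _ _ ne ch, of "{(x, y), (x, z)}"] yz by auto
      then obtain Z where "Z \<in> C" "(x, y) \<in> Z" "(x, z) \<in> Z" by auto
      then show ?thesis using mem[of Z] by (auto simp: Map.graph_def)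
    qed
    have gr: "Map.graph g = \<Union>C"
    proof (rule set_eqI)
      fix p :: "'a \<times> 'b"
      obtain x y where p: "p = (x, y)" by fastforce
      have "g x = Some y \<longleftrightarrow> (x, y) \<in> \<Union>C"
      proof (cases "\<exists>y. (x, y) \<in> \<Union>C")
        case True
        then have "(x, SOME y. (x, y) \<in> \<Union>C) \<in> \<Union>C" by (rule someI_ex)
        moreover have "g x = Some (SOME y. (x, y) \<in> \<Union>C)" using True unfolding g_def by (rule if_P)
        ultimately show ?thesis using sv by (metis option.inject)
      next
        case False
        moreover have "g x = None" using False unfolding g_def by (rule if_not_P)
        ultimately show ?thesis by simp
      qed
      then show "p \<in> Map.graph g \<longleftrightarrow> p \<in> \<Union>C" by (simp add: p Map.graph_def)
    qed
    have "P g"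
    \<comment> \<open>A finite part of the union already lies in one member of the chain, so each
      finite restriction of \<open>g\<close> is a restriction of a map with
      \<open>P\<close>.\<close>
    proof (rule finchar)
      fix Y :: "'a set" assume "finite Y"
      then have "finite (Map.graph (g |` Y))" by (intro finite_graph_iff_finite_dom[THEN iffD2]) simp
      moreover have "Map.graph (g |` Y) \<subseteq> \<Union>C"
        unfolding gr[symmetric] by (auto simp: Map.graph_def restrict_map_def split: if_splits)
      ultimately obtain Z where Z: "Z \<in> C" "Map.graph (g |` Y) \<subseteq> Z"
        using finite_subset_Union_chain[OF _ _ ne ch] by metis
      from mem[OF Z(1)] obtain h where h: "P h" "Z = Map.graph h" by blast
      have "h x = g x" if "x \<in> dom (g |` Y)" for x
        using Z(2) that unfolding h(2) by (force simp: Map.graph_def restrict_map_def split: if_splits)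
      then have "g |` Y = h |` (dom (g |` Y))"
        by (intro ext) (auto simp: restrict_map_def domIff)
      then show "P (g |` Y)" using restr[OF h(1)] by metis
    qed
    moreover have "dom g \<subseteq> X"
    proof
      fix x assume "x \<in> dom g"
      then obtain y where "(x, y) \<in> Map.graph g" by (auto simp: Map.graph_def)
      then obtain Z where "(x, y) \<in> Z" "Z \<in> C" unfolding gr by blast
      then show "x \<in> X" using mem[of Z] by (auto simp: Map.graph_def)
    qed
    ultimately show "\<Union>C \<in> ?A" unfolding gr[symmetric] by blast
  qed
  then obtain g where g: "P g" "dom g \<subseteq> X"
    and max: "\<And>h. P h \<Longrightarrow> dom h \<subseteq> X \<Longrightarrow> Map.graph g \<subseteq> Map.graph h \<Longrightarrow> Map.graph h = Map.graph g"
    by auto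
  have "x \<in> dom g" if xX: "x \<in> X" for x
  proof (rule ccontr)
    assume x: "x \<notin> dom g"
    obtain y where y: "P (g(x \<mapsto> y))" using extend[OF g xX x] by blast
    have sub: "Map.graph g \<subseteq> Map.graph (g(x \<mapsto> y))"
      using x by (auto simp: Map.graph_def domIff)
    have "Map.graph (g(x \<mapsto> y)) = Map.graph g"
      using max[OF y _ sub] g(2) xX by auto
    then have "(x, y) \<in> Map.graph g" by (auto simp: Map.graph_def)
    then show False using x by (auto simp: Map.graph_def)
  qed
  then show ?thesis using g by blast
qed

text \<open>Compactness of the product space of maps into \<open>bool\<close>: \<open>g\<close> is
  an accumulation point of \<open>h\<close> along \<open>F\<close>, the finite sets \<open>Y\<close>
  giving the basic neighbourhoods. A partial accumulation point extends to a further
  \<open>x\<close> because only two values have to be tried.\<close>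

lemma frequently_finite_limit:
  fixes h :: "'i \<Rightarrow> 'a \<Rightarrow> bool"
  assumes "F \<noteq> bot"
  shows "\<exists>g. \<forall>Y. finite Y \<longrightarrow> frequently (\<lambda>i. \<forall>y\<in>Y. h i y = g y) F"
proof -
  define P where "P g \<longleftrightarrow> (\<forall>Y. finite Y \<longrightarrow> frequently (\<lambda>i. \<forall>y\<in>Y \<inter> dom g. Some (h i y) = g y) F)"
    for g :: "'a \<rightharpoonup> bool"
  have "\<exists>g. dom g = UNIV \<and> P g"
  proof (rule finite_character_total)
    fix g assume *: "\<And>Y. finite Y \<Longrightarrow> P (g |` Y)"
    show "P g" unfolding P_def
    proof (intro allI impI)
      fix Y :: "'a set" assume "finite Y"
      then have "frequently (\<lambda>i. \<forall>y\<in>Y \<inter> dom (g |` Y). Some (h i y) = (g |` Y) y) F"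
        using * unfolding P_def by blast
      then show "frequently (\<lambda>i. \<forall>y\<in>Y \<inter> dom g. Some (h i y) = g y) F"
        by (rule frequently_elim1) auto
    qed
  next
    fix g Y assume *: "P g"
    show "P (g |` Y)" unfolding P_def
    proof (intro allI impI)
      fix Z :: "'a set" assume "finite Z"
      then have "frequently (\<lambda>i. \<forall>y\<in>Z \<inter> dom g. Some (h i y) = g y) F"
        using * unfolding P_def by blast
      then show "frequently (\<lambda>i. \<forall>y\<in>Z \<inter> dom (g |` Y). Some (h i y) = (g |` Y) y) F"
        by (rule frequently_elim1) auto
    qed
  next
    show "P Map.empty" using assms by (simp add: P_def frequently_def eventually_False)
  next
    fix g x assume g: "P g" and x: "x \<notin> dom g"
    show "\<exists>b. P (g(x \<mapsto> b))"
    proof (rule ccontr)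
      assume no: "\<nexists>b. P (g(x \<mapsto> b))"
      let ?bad = "\<lambda>b Y. eventually (\<lambda>i. \<not> (\<forall>y\<in>Y \<inter> dom (g(x \<mapsto> b)). Some (h i y) = (g(x \<mapsto> b)) y)) F"
      have "\<forall>b. \<exists>Y. finite Y \<and> ?bad b Y"
        using no by (simp add: P_def not_frequently)
      then have "\<exists>Y. \<forall>b. finite (Y b) \<and> ?bad b (Y b)" by (rule choice)
      then obtain Y where Y: "\<And>b. finite (Y b)" "\<And>b. ?bad b (Y b)" by blast
      \<comment> \<open>For the value that \<open>h i x\<close> actually has, the extension agrees
        at \<open>x\<close>; its failure must therefore occur in \<open>dom g\<close>, against
        \<open>g\<close> itself.\<close>
      have "eventually (\<lambda>i. \<not> (\<forall>y\<in>(Y True \<union> Y False) \<inter> dom g. Some (h i y) = g y)) F"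
        using Y(2)[of True] Y(2)[of False]
      proof eventually_elim
        case (elim i)
        then show ?case using x by (cases "h i x") (auto split: if_splits)
      qed
      moreover have "finite (Y True \<union> Y False)" using Y(1) by simp
      ultimately show False using g unfolding P_def not_frequently[symmetric] by blast
    qed
  qed
  then obtain g where g: "dom g = UNIV" "P g" by blast
  show ?thesis
  proof (intro exI allI impI)
    fix Y :: "'a set" assume "finite Y"
    then have "frequently (\<lambda>i. \<forall>y\<in>Y. Some (h i y) = g y) F" using g by (auto simp: P_def)
    then show "frequently (\<lambda>i. \<forall>y\<in>Y. h i y = (the \<circ> g) y) F"
      by (rule frequently_elim1) (metis comp_apply option.sel)
  qed
qed

text \<open>Taken along the filter of finite subsets of \<open>p\<close>, so agreement on a finite
  \<open>Y\<close> recurs above every finite \<open>q\<close>. It will be applied to colourings of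
  finite sets and to realisations of finite parts of a type.\<close>

lemma finite_subsets_limit:
  fixes h :: "'i set \<Rightarrow> 'a \<Rightarrow> bool"
  obtains g where "\<And>Y q. finite Y \<Longrightarrow> finite q \<Longrightarrow> q \<subseteq> p \<Longrightarrow>
    \<exists>q'. finite q' \<and> q \<subseteq> q' \<and> q' \<subseteq> p \<and> (\<forall>y\<in>Y. h q' y = g y)"
proof -
  obtain g where g: "\<And>Y. finite Y \<Longrightarrow> frequently (\<lambda>i. \<forall>y\<in>Y. h i y = g y) (finite_subsets_at_top p)"
    using frequently_finite_limit[of "finite_subsets_at_top p" h] by auto
  show thesis
  proof (rule that)
    fix Y :: "'a set" and q assume Y: "finite Y" and q: "finite q" "q \<subseteq> p"
    have "frequently (\<lambda>i. (\<forall>y\<in>Y. h i y = g y) \<and> finite i \<and> q \<subseteq> i \<and> i \<subseteq> p) (finite_subsets_at_top p)"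
      by (rule frequently_eventually_frequently[OF g[OF Y]])
        (use q in \<open>auto simp: eventually_finite_subsets_at_top\<close>)
    then show "\<exists>q'. finite q' \<and> q \<subseteq> q' \<and> q' \<subseteq> p \<and> (\<forall>y\<in>Y. h q' y = g y)"
      using frequently_ex by fastforce
  qed
qed

section \<open>Formulas\<close>

lemma finite_fv_tm [simp]: "finite (fv_tm t)"
  by (induction t) auto

lemma finite_fv [simp]: "finite (fv \<phi>)"
  by (induction \<phi>) auto

lemma eval_cong: "(\<And>v. v \<in> fv_tm t \<Longrightarrow> \<alpha> v = \<beta> v) \<Longrightarrow> eval M \<alpha> t = eval M \<beta> t"
proof (induction t)
  case (Fun f ts)
  then have "map (eval M \<alpha>) ts = map (eval M \<beta>) ts" by auto
  then show ?case by (metis eval.simps(2))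
qed simp

lemma map_eval_cong:
  "(\<And>v. v \<in> \<Union> (set (map fv_tm ts)) \<Longrightarrow> \<alpha> v = \<beta> v) \<Longrightarrow> map (eval M \<alpha>) ts = map (eval M \<beta>) ts"
  by (auto intro!: eval_cong)

lemma sat_cong: "(\<And>v. v \<in> fv \<phi> \<Longrightarrow> \<alpha> v = \<beta> v) \<Longrightarrow> sat M \<alpha> \<phi> = sat M \<beta> \<phi>"
proof (induction \<phi> arbitrary: \<alpha> \<beta>)
  case (Eq s t)
  then have "eval M \<alpha> s = eval M \<beta> s" "eval M \<alpha> t = eval M \<beta> t" by (auto intro!: eval_cong)
  then show ?case by simp
next
  case (Rel r ts)
  then have "map (eval M \<alpha>) ts = map (eval M \<beta>) ts" by (intro map_eval_cong) auto
  then show ?case by (metis sat.simps(2))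
next
  case (Neg \<phi>)
  have "sat M \<alpha> \<phi> = sat M \<beta> \<phi>" by (rule Neg.IH) (use Neg.prems in auto)
  then show ?case by simp
next
  case (Conj \<phi> \<psi>)
  have "sat M \<alpha> \<phi> = sat M \<beta> \<phi>" by (rule Conj.IH(1)) (use Conj.prems in auto)
  moreover have "sat M \<alpha> \<psi> = sat M \<beta> \<psi>" by (rule Conj.IH(2)) (use Conj.prems in auto)
  ultimately show ?case by simp
next
  case (Ex v \<phi>)
  have "sat M (\<alpha>(v := a)) \<phi> = sat M (\<beta>(v := a)) \<phi>" for a
    by (rule Ex.IH) (use Ex.prems in auto)
  then show ?case by simp
qed

section \<open>Renaming of variables, finite conjunctions, blocks of quantifiers\<close>

lemma wf_map_tm [simp]: "wf_tm L (map_tm (\<lambda>x. x) s t) = wf_tm L t"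
  by (induction t) (auto simp: list_all_iff)

lemma fv_map_tm [simp]: "fv_tm (map_tm (\<lambda>x. x) s t) = s ` fv_tm t"
  by (induction t) auto

lemma eval_map_tm [simp]: "eval M \<alpha> (map_tm (\<lambda>x. x) s t) = eval M (\<lambda>v. \<alpha> (s v)) t"
proof (induction t)
  case (Fun f ts)
  then have "map (eval M \<alpha>) (map (map_tm (\<lambda>x. x) s) ts) = map (eval M (\<lambda>v. \<alpha> (s v))) ts" by simp
  then have "fint M f (map (eval M \<alpha>) (map (map_tm (\<lambda>x. x) s) ts)) = fint M f (map (eval M (\<lambda>v. \<alpha> (s v))) ts)"
    by (rule arg_cong)
  then show ?case by simp
qed simp

text \<open>Without quantifiers nothing can be captured, so \<open>s\<close> may be any map,
  injective or not.\<close>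

lemma sat_qf_map:
  assumes "qfree \<phi>"
  shows "sat M \<alpha> (map_fm (\<lambda>x. x) (\<lambda>x. x) s \<phi>) = sat M (\<lambda>v. \<alpha> (s v)) \<phi>"
  using assms
proof (induction \<phi>)
  case (Rel r ts)
  have "map (eval M \<alpha>) (map (map_tm (\<lambda>x. x) s) ts) = map (eval M (\<lambda>v. \<alpha> (s v))) ts" by simp
  then have "rint M r (map (eval M \<alpha>) (map (map_tm (\<lambda>x. x) s) ts)) = rint M r (map (eval M (\<lambda>v. \<alpha> (s v))) ts)"
    by (rule arg_cong)
  then show ?case by simp
qed auto

lemma qf_map_fm [simp]:
  assumes "qfree \<phi>"
  shows "qfree (map_fm (\<lambda>x. x) (\<lambda>x. x) s \<phi>)" and "wf_fm L (map_fm (\<lambda>x. x) (\<lambda>x. x) s \<phi>) = wf_fm L \<phi>"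
    and "fv (map_fm (\<lambda>x. x) (\<lambda>x. x) s \<phi>) = s ` fv \<phi>"
  using assms by (induction \<phi>) (auto simp: list_all_iff)

text \<open>Bound variables may have to be renamed apart, hence the existential form.
  \<open>s\<close> is allowed to identify variables, as happens when an index tuple has repeated
  entries.\<close>

lemma ex_subst:
  fixes \<phi> :: "('f, 'r, 'v) fm" and s :: "'v \<Rightarrow> 'w"
  assumes "infinite (UNIV :: 'w set)"
  shows "\<exists>\<phi>'. (\<forall>L. wf_fm L \<phi>' = wf_fm L \<phi>) \<and> fv \<phi>' = s ` fv \<phi> \<and>
    (\<forall>(M :: ('f, 'r, 'a) struct) \<alpha>. sat M \<alpha> \<phi>' = sat M (\<lambda>v. \<alpha> (s v)) \<phi>)"
proof (induction \<phi> arbitrary: s)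
  case (Eq t u)
  show ?case by (rule exI[of _ "Eq (map_tm (\<lambda>x. x) s t) (map_tm (\<lambda>x. x) s u)"]) auto
next
  case (Rel r ts)
  have "map (eval M \<alpha>) (map (map_tm (\<lambda>x. x) s) ts) = map (eval M (\<lambda>v. \<alpha> (s v))) ts"
    for M :: "('f, 'r, 'a) struct" and \<alpha> by simp
  then have "sat M \<alpha> (Rel r (map (map_tm (\<lambda>x. x) s) ts)) = sat M (\<lambda>v. \<alpha> (s v)) (Rel r ts)"
    for M :: "('f, 'r, 'a) struct" and \<alpha> by (metis sat.simps(2))
  moreover have "fv (Rel r (map (map_tm (\<lambda>x. x) s) ts)) = s ` fv (Rel r ts)" by auto
  moreover have "wf_fm L (Rel r (map (map_tm (\<lambda>x. x) s) ts)) = wf_fm L (Rel r ts)" for L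
    by (auto simp: list_all_iff)
  ultimately show ?case by metis
next
  case (Neg \<phi>)
  obtain \<phi>' where "\<forall>L. wf_fm L \<phi>' = wf_fm L \<phi>" "fv \<phi>' = s ` fv \<phi>"
    "\<forall>(M :: ('f, 'r, 'a) struct) \<alpha>. sat M \<alpha> \<phi>' = sat M (\<lambda>v. \<alpha> (s v)) \<phi>" using Neg.IH[of s] by auto
  then show ?case by (intro exI[of _ "Neg \<phi>'"]) auto
next
  case (Conj \<phi> \<psi>)
  obtain \<phi>' where "\<forall>L. wf_fm L \<phi>' = wf_fm L \<phi>" "fv \<phi>' = s ` fv \<phi>"
    "\<forall>(M :: ('f, 'r, 'a) struct) \<alpha>. sat M \<alpha> \<phi>' = sat M (\<lambda>v. \<alpha> (s v)) \<phi>" using Conj.IH(1)[of s] by auto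
  moreover obtain \<psi>' where "\<forall>L. wf_fm L \<psi>' = wf_fm L \<psi>" "fv \<psi>' = s ` fv \<psi>"
    "\<forall>(M :: ('f, 'r, 'a) struct) \<alpha>. sat M \<alpha> \<psi>' = sat M (\<lambda>v. \<alpha> (s v)) \<psi>" using Conj.IH(2)[of s] by auto
  ultimately show ?case by (intro exI[of _ "Conj \<phi>' \<psi>'"]) auto
next
  case (Ex v \<phi>)
  \<comment> \<open>The new bound variable only has to avoid the images of those variables that stay
    free.\<close>
  obtain w where w: "w \<notin> s ` (fv \<phi> - {v})"
    using ex_new_if_finite[OF assms, of "s ` (fv \<phi> - {v})"] by auto
  obtain \<phi>' where \<phi>': "\<forall>L. wf_fm L \<phi>' = wf_fm L \<phi>"
    "fv \<phi>' = (s(v := w)) ` fv \<phi>"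
    "\<forall>(M :: ('f, 'r, 'a) struct) \<alpha>. sat M \<alpha> \<phi>' = sat M (\<lambda>u. \<alpha> ((s(v := w)) u)) \<phi>"
    using Ex.IH[of "s(v := w)"] by auto
  have "sat M (\<lambda>u. (\<alpha>(w := a)) ((s(v := w)) u)) \<phi> = sat M ((\<lambda>u. \<alpha> (s u))(v := a)) \<phi>"
    for M :: "('f, 'r, 'a) struct" and \<alpha> a by (rule sat_cong) (use w in auto)
  moreover have "(s(v := w)) ` fv \<phi> - {w} = s ` (fv \<phi> - {v})" using w by auto
  ultimately show ?case using \<phi>' by (intro exI[of _ "Ex w \<phi>'"]) auto
qed

lemma ex_conj:
  fixes \<Gamma> :: "('f, 'r, 'v) fm set" and M :: "('f, 'r, 'a) struct"
  assumes "finite \<Gamma>" and "\<forall>\<phi>\<in>\<Gamma>. wf_fm L \<phi>" and "univ M \<noteq> {}"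
  shows "\<exists>\<psi>. wf_fm L \<psi> \<and> fv \<psi> = \<Union> (fv ` \<Gamma>) \<and> (\<forall>\<alpha>. sat M \<alpha> \<psi> \<longleftrightarrow> (\<forall>\<phi>\<in>\<Gamma>. sat M \<alpha> \<phi>))"
  using assms(1,2)
proof (induction \<Gamma> rule: finite_induct)
  case empty
  \<comment> \<open>The empty conjunction has to be a formula without free variables;
    \<open>Ex v (v = v)\<close> is one, and it is true because the universe is nonempty.\<close>
  show ?case using assms(3) by (intro exI[of _ "Ex undefined (Eq (Var undefined) (Var undefined))"]) auto
next
  case (insert \<phi> \<Gamma>)
  then obtain \<psi> where "wf_fm L \<psi>" "fv \<psi> = \<Union> (fv ` \<Gamma>)" "\<forall>\<alpha>. sat M \<alpha> \<psi> \<longleftrightarrow> (\<forall>\<phi>\<in>\<Gamma>. sat M \<alpha> \<phi>)"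
    by auto
  then show ?case using insert.prems by (intro exI[of _ "Conj \<phi> \<psi>"]) auto
qed

lemma ex_exists:
  fixes \<phi> :: "('f, 'r, 'v) fm" and M :: "('f, 'r, 'a) struct"
  assumes "finite X" and "wf_fm L \<phi>"
  shows "\<exists>\<psi>. wf_fm L \<psi> \<and> fv \<psi> = fv \<phi> - X \<and>
    (\<forall>\<alpha>. sat M \<alpha> \<psi> \<longleftrightarrow> (\<exists>\<beta>. (\<forall>v. v \<notin> X \<longrightarrow> \<beta> v = \<alpha> v) \<and> \<beta> ` X \<subseteq> univ M \<and> sat M \<beta> \<phi>))"
  using assms(1)
proof (induction X rule: finite_induct)
  case empty
  have "(\<forall>v. \<beta> v = \<alpha> v) \<longleftrightarrow> \<beta> = \<alpha>" for \<alpha> \<beta> :: "'v \<Rightarrow> 'a" by auto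
  then show ?case using assms(2) by (intro exI[of _ \<phi>]) auto
next
  case (insert x X)
  then obtain \<psi> where \<psi>: "wf_fm L \<psi>" "fv \<psi> = fv \<phi> - X"
    "\<And>\<alpha>. sat M \<alpha> \<psi> \<longleftrightarrow> (\<exists>\<beta>. (\<forall>v. v \<notin> X \<longrightarrow> \<beta> v = \<alpha> v) \<and> \<beta> ` X \<subseteq> univ M \<and> sat M \<beta> \<phi>)" by auto
  have "sat M \<alpha> (Ex x \<psi>) \<longleftrightarrow>
      (\<exists>\<beta>. (\<forall>v. v \<notin> insert x X \<longrightarrow> \<beta> v = \<alpha> v) \<and> \<beta> ` insert x X \<subseteq> univ M \<and> sat M \<beta> \<phi>)"
    (is "?l \<longleftrightarrow> ?r") for \<alpha>
  proof
    assume ?l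
    then obtain a \<beta> where "a \<in> univ M" "\<forall>v. v \<notin> X \<longrightarrow> \<beta> v = (\<alpha>(x := a)) v" "\<beta> ` X \<subseteq> univ M" "sat M \<beta> \<phi>"
      using \<psi>(3) by auto
    then show ?r using insert.hyps by (intro exI[of _ \<beta>]) auto
  next
    assume ?r
    then obtain \<beta> where \<beta>: "\<forall>v. v \<notin> insert x X \<longrightarrow> \<beta> v = \<alpha> v" "\<beta> ` insert x X \<subseteq> univ M" "sat M \<beta> \<phi>"
      by auto
    then have "sat M (\<alpha>(x := \<beta> x)) \<psi>" unfolding \<psi>(3) by (intro exI[of _ \<beta>]) auto
    then show ?l using \<beta> by auto
  qed
  then show ?case using \<psi>(1,2) by (intro exI[of _ "Ex x \<psi>"]) auto
qed

section \<open>Quantifier-free types and copies\<close>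

lemma qftp_eq_iff:
  assumes "length xs = length ys"
  shows "qftp L M xs = qftp L N ys \<longleftrightarrow>
    (\<forall>\<phi>. wf_fm L \<phi> \<and> qfree \<phi> \<and> fv \<phi> \<subseteq> {..<length xs} \<longrightarrow> sat M (\<lambda>k. xs ! k) \<phi> = sat N (\<lambda>k. ys ! k) \<phi>)"
  using assms unfolding qftp_def tp_def by auto

lemma qftp_eqD:
  assumes "length xs = length ys" and "qftp L M xs = qftp L N ys"
    and "wf_fm L \<phi>" and "qfree \<phi>" and "s ` fv \<phi> \<subseteq> {..<length xs}"
  shows "sat M (\<lambda>v. xs ! s v) \<phi> = sat N (\<lambda>v. ys ! s v) \<phi>"
proof -
  let ?\<phi> = "map_fm (\<lambda>x. x) (\<lambda>x. x) s \<phi>"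
  have "sat M (\<lambda>k. xs ! k) ?\<phi> = sat N (\<lambda>k. ys ! k) ?\<phi>"
    using assms unfolding qftp_eq_iff[OF assms(1)] by simp
  then show ?thesis using assms(4) by (simp add: sat_qf_map)
qed

text \<open>Entries may be permuted, repeated or dropped, since a formula about the new tuple is a
  renamed formula about the old one.\<close>

lemma qftp_map_nth:
  assumes "length xs = length ys" and "qftp L M xs = qftp L N ys" and "set ks \<subseteq> {..<length xs}"
  shows "qftp L M (map ((!) xs) ks) = qftp L N (map ((!) ys) ks)"
proof (subst qftp_eq_iff, simp, intro allI impI)
  fix \<phi>
  assume *: "wf_fm L \<phi> \<and> qfree \<phi> \<and> fv \<phi> \<subseteq> {..<length (map ((!) xs) ks)}"
  have "(!) ks ` fv \<phi> \<subseteq> {..<length xs}" using assms(3) * by (auto simp: subset_iff)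
  then have "sat M (\<lambda>v. xs ! (ks ! v)) \<phi> = sat N (\<lambda>v. ys ! (ks ! v)) \<phi>"
    using qftp_eqD[OF assms(1,2)] * by blast
  moreover have "sat M (\<lambda>k. map ((!) xs) ks ! k) \<phi> = sat M (\<lambda>v. xs ! (ks ! v)) \<phi>"
    by (rule sat_cong) (use * in auto)
  moreover have "sat N (\<lambda>k. map ((!) ys) ks ! k) \<phi> = sat N (\<lambda>v. ys ! (ks ! v)) \<phi>"
    by (rule sat_cong) (use * in auto)
  ultimately show "sat M (\<lambda>k. map ((!) xs) ks ! k) \<phi> = sat N (\<lambda>k. map ((!) ys) ks ! k) \<phi>"
    by simp
qed

lemma qftp_eq_nth:
  assumes "length xs = length ys" and "qftp L M xs = qftp L N ys" and "i < length xs" "j < length xs"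
  shows "xs ! i = xs ! j \<longleftrightarrow> ys ! i = ys ! j"
  using qftp_eqD[OF assms(1,2), of "Eq (Var i) (Var j)" "\<lambda>x. x"] assms(3,4) by simp

text \<open>Ranging over all lists instead of one enumeration of \<open>A\<close> makes restriction,
  composition and inversion independent of any choice of enumeration, and gives a meaning also for
  infinite \<open>A\<close>.\<close>

definition qf_embedding ::
  "('f, 'r) language \<Rightarrow> ('f, 'r, 'a) struct \<Rightarrow> 'a set \<Rightarrow> ('f, 'r, 'b) struct \<Rightarrow> ('a \<Rightarrow> 'b) \<Rightarrow> bool" where
  "qf_embedding L M A N f \<longleftrightarrow> (\<forall>xs\<in>lists A. qftp L N (map f xs) = qftp L M xs)"

text \<open>Every list over \<open>A\<close> is a list of entries of \<open>as\<close>, so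
  \<open>qftp_map_nth\<close> applies. Repetitions in \<open>as\<close> are harmless, which matters
  for index tuples that are not injective.\<close>

lemma qf_embeddingI_enum:
  assumes "qftp L N (map f as) = qftp L M as" and "set as = A"
  shows "qf_embedding L M A N f"
  unfolding qf_embedding_def
proof
  fix xs assume "xs \<in> lists A"
  then have "\<forall>x\<in>set xs. \<exists>k. k < length as \<and> as ! k = x"
    using assms(2) by (auto simp: in_set_conv_nth)
  then obtain k where k: "\<forall>x\<in>set xs. k x < length as \<and> as ! k x = x" by metis
  have "qftp L N (map ((!) (map f as)) (map k xs)) = qftp L M (map ((!) as) (map k xs))"
    by (rule qftp_map_nth) (use assms k in auto)
  moreover have "map ((!) (map f as)) (map k xs) = map f xs" using k by auto
  moreover have "map ((!) as) (map k xs) = xs" using k by (auto intro: map_idI)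
  ultimately show "qftp L N (map f xs) = qftp L M xs" by metis
qed

lemma qf_embedding_cong:
  assumes "\<And>x. x \<in> A \<Longrightarrow> f x = g x"
  shows "qf_embedding L M A N f = qf_embedding L M A N g"
proof -
  have "map f xs = map g xs" if "xs \<in> lists A" for xs using that assms by auto
  then have "qftp L N (map f xs) = qftp L N (map g xs)" if "xs \<in> lists A" for xs
    using that by metis
  then show ?thesis unfolding qf_embedding_def by auto
qed

lemma qf_embedding_subset: "qf_embedding L M A N f \<Longrightarrow> B \<subseteq> A \<Longrightarrow> qf_embedding L M B N f"
  unfolding qf_embedding_def by (metis lists_mono subsetD)

lemma qf_embedding_comp:
  assumes "qf_embedding L M A N f" and "qf_embedding L N (f ` A) P g"
  shows "qf_embedding L M A P (\<lambda>x. g (f x))"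
  unfolding qf_embedding_def
proof
  fix xs assume xs: "xs \<in> lists A"
  have "qftp L P (map g (map f xs)) = qftp L N (map f xs)"
    using assms(2) xs unfolding qf_embedding_def by (metis lists_image image_eqI)
  then show "qftp L P (map (\<lambda>x. g (f x)) xs) = qftp L M xs"
    using assms(1) xs unfolding qf_embedding_def by (simp add: comp_def)
qed

lemma qf_embedding_inj:
  assumes "qf_embedding L M A N f"
  shows "inj_on f A"
proof (rule inj_onI)
  fix x y assume "x \<in> A" "y \<in> A" "f x = f y"
  moreover from this have "qftp L N (map f [x, y]) = qftp L M [x, y]"
    using assms unfolding qf_embedding_def by (meson lists.intros)
  ultimately show "x = y"
    using qftp_eq_nth[of "map f [x, y]" "[x, y]" L N M 0 1] by simp
qed

lemma qf_embedding_inv: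
  assumes "qf_embedding L M A N f"
  shows "qf_embedding L N (f ` A) M (inv_into A f)"
  unfolding qf_embedding_def
proof
  fix ys assume "ys \<in> lists (f ` A)"
  then obtain xs where xs: "xs \<in> lists A" "ys = map f xs" by (auto simp: lists_image)
  have "map (inv_into A f) (map f xs) = xs"
    using xs(1) qf_embedding_inj[OF assms] by (auto intro!: map_idI)
  then show "qftp L M (map (inv_into A f) ys) = qftp L N ys"
    using assms xs unfolding qf_embedding_def by simp
qed

lemma copies_iff:
  assumes "finite A"
  shows "f \<in> copies L M A N C \<longleftrightarrow> f \<in> A \<rightarrow>\<^sub>E C \<and> qf_embedding L M A N f"
proof -
  obtain as where as: "distinct as" "set as = A" using finite_distinct_list[OF assms] by blast
  show ?thesis
  proof
    assume "f \<in> copies L M A N C"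
    then show "f \<in> A \<rightarrow>\<^sub>E C \<and> qf_embedding L M A N f"
      unfolding copies_def by (auto intro: qf_embeddingI_enum)
  next
    assume *: "f \<in> A \<rightarrow>\<^sub>E C \<and> qf_embedding L M A N f"
    moreover have "as \<in> lists A" using as(2) by auto
    ultimately show "f \<in> copies L M A N C"
      unfolding copies_def qf_embedding_def using as by blast
  qed
qed

section \<open>Transport of copies and of Ramsey arrows along embeddings\<close>

lemma copies_comp_left:
  assumes "finite A" and "f \<in> copies L M A N C" and "qf_embedding L N C P k" and "k ` C \<subseteq> D"
  shows "restrict (\<lambda>x. k (f x)) A \<in> copies L M A P D"
proof -
  have f: "f \<in> A \<rightarrow>\<^sub>E C" "qf_embedding L M A N f" using assms(2) by (auto simp: copies_iff[OF assms(1)])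
  have "qf_embedding L N (f ` A) P k"
    by (rule qf_embedding_subset[OF assms(3)]) (use f in auto)
  then have "qf_embedding L M A P (restrict (\<lambda>x. k (f x)) A)"
    using qf_embedding_comp[OF f(2)] by (subst qf_embedding_cong[of A _ "\<lambda>x. k (f x)"]) auto
  then show ?thesis using f assms(4) by (auto simp: copies_iff[OF assms(1)])
qed

lemma copies_comp_right:
  assumes "finite A" and "g \<in> copies L N (h ` A) P C" and "qf_embedding L M A N h"
  shows "restrict (\<lambda>x. g (h x)) A \<in> copies L M A P C"
proof -
  have g: "g \<in> h ` A \<rightarrow>\<^sub>E C" "qf_embedding L N (h ` A) P g"
    using assms(2) assms(1) by (auto simp: copies_iff)
  have "qf_embedding L M A P (restrict (\<lambda>x. g (h x)) A)"
    using qf_embedding_comp[OF assms(3) g(2)] by (subst qf_embedding_cong[of A _ "\<lambda>x. g (h x)"]) auto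
  then show ?thesis using g by (auto simp: copies_iff[OF assms(1)])
qed

lemma ramsey_arrowE:
  assumes "ramsey_arrow L N C M B A" and "\<chi> \<in> copies L M A N C \<rightarrow> {0, 1 :: nat}"
  obtains e c where "e \<in> copies L M B N C"
    and "\<And>f. f \<in> copies L M A N C \<Longrightarrow> f ` A \<subseteq> e ` B \<Longrightarrow> \<chi> f = c"
  using assms unfolding ramsey_arrow_def by (metis (full_types))

text \<open>A colouring is pulled back to \<open>C\<close> along \<open>k\<close>. The inverse of
  \<open>k\<close> also preserves quantifier-free types, so every copy of \<open>A\<close> in the
  image of \<open>C\<close> comes from one in \<open>C\<close>, and monochromaticity is
  transferred.\<close>

lemma ramsey_arrow_target:
  assumes "finite A" "finite B" and arr: "ramsey_arrow L N C M B A" and k: "qf_embedding L N C P k"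
  shows "ramsey_arrow L P (k ` C) M B A"
  unfolding ramsey_arrow_def
proof
  fix \<chi> assume \<chi>: "\<chi> \<in> copies L M A P (k ` C) \<rightarrow> {0, 1 :: nat}"
  have "(\<lambda>f. \<chi> (restrict (\<lambda>x. k (f x)) A)) \<in> copies L M A N C \<rightarrow> {0, 1}"
    using \<chi> copies_comp_left[OF assms(1) _ k subset_refl] by blast
  then obtain e c where e: "e \<in> copies L M B N C"
    and c: "\<And>f. f \<in> copies L M A N C \<Longrightarrow> f ` A \<subseteq> e ` B \<Longrightarrow> \<chi> (restrict (\<lambda>x. k (f x)) A) = c"
    by (rule ramsey_arrowE[OF arr]) blast
  let ?e = "restrict (\<lambda>x. k (e x)) B"
  have eC: "e ` B \<subseteq> C" using e by (auto simp: copies_iff[OF assms(2)])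
  have inj: "inj_on k C" by (rule qf_embedding_inj[OF k])
  have hom: "\<chi> f = c" if f: "f \<in> copies L M A P (k ` C)" and sub: "f ` A \<subseteq> ?e ` B" for f
  proof -
    let ?g = "restrict (\<lambda>x. inv_into C k (f x)) A"
    have g: "?g \<in> copies L M A N C"
      by (rule copies_comp_left[OF assms(1) f qf_embedding_inv[OF k]]) (auto intro: inv_into_into)
    have "?g x \<in> e ` B" if "x \<in> A" for x
    proof -
      have "f x \<in> ?e ` B" using sub that by blast
      then obtain b where "b \<in> B" "f x = k (e b)" by auto
      then show ?thesis using that inj eC by auto
    qed
    then have "?g ` A \<subseteq> e ` B" by blast
    from c[OF g this] have "\<chi> (restrict (\<lambda>x. k (?g x)) A) = c" .
    moreover have "restrict (\<lambda>x. k (?g x)) A = f"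
    proof -
      have fE: "f \<in> A \<rightarrow>\<^sub>E k ` C" using f by (auto simp: copies_iff[OF assms(1)])
      then have "k (inv_into C k (f x)) = f x" if "x \<in> A" for x
        using that by (meson PiE_mem f_inv_into_f)
      then have "restrict (\<lambda>x. k (?g x)) A x = f x" for x
        by (cases "x \<in> A") (simp_all add: PiE_arb[OF fE])
      then show ?thesis by blast
    qed
    ultimately show ?thesis by simp
  qed
  have mem: "?e \<in> copies L M B P (k ` C)"
    by (rule copies_comp_left[OF assms(2) e k]) auto
  show "\<exists>e\<in>copies L M B P (k ` C). \<exists>c. \<forall>f\<in>copies L M A P (k ` C). f ` A \<subseteq> e ` B \<longrightarrow> \<chi> f = c"
    by (rule bexI[OF exI[of _ c] mem]) (use hom in blast)
qed

text \<open>Copies of the image of \<open>A\<close> under \<open>h\<close> and copies of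
  \<open>A\<close> correspond by composition with \<open>h\<close> and its inverse; colourings and
  the monochromatic copy travel along this bijection.\<close>

lemma ramsey_arrow_source:
  assumes "finite A" "finite B" and arr: "ramsey_arrow L N C P (h ` B) (h ` A)"
    and hA: "qf_embedding L M A P h" and hB: "qf_embedding L M B P h"
  shows "ramsey_arrow L N C M B A"
  unfolding ramsey_arrow_def
proof
  fix \<chi> assume \<chi>: "\<chi> \<in> copies L M A N C \<rightarrow> {0, 1 :: nat}"
  have "(\<lambda>f. \<chi> (restrict (\<lambda>x. f (h x)) A)) \<in> copies L P (h ` A) N C \<rightarrow> {0, 1}"
    using \<chi> copies_comp_right[OF assms(1) _ hA] by blast
  then obtain e c where e: "e \<in> copies L P (h ` B) N C"
    and c: "\<And>f. f \<in> copies L P (h ` A) N C \<Longrightarrow> f ` h ` A \<subseteq> e ` h ` B \<Longrightarrow> \<chi> (restrict (\<lambda>x. f (h x)) A) = c"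
    by (rule ramsey_arrowE[OF arr]) blast
  let ?e = "restrict (\<lambda>x. e (h x)) B"
  have inj: "inj_on h A" by (rule qf_embedding_inj[OF hA])
  have im: "inv_into A h ` h ` A = A" using inj by (simp add: inv_into_image_cancel)
  have hom: "\<chi> f = c" if f: "f \<in> copies L M A N C" and sub: "f ` A \<subseteq> ?e ` B" for f
  proof -
    let ?g = "restrict (\<lambda>x. f (inv_into A h x)) (h ` A)"
    have g: "?g \<in> copies L P (h ` A) N C"
      by (rule copies_comp_right[OF _ _ qf_embedding_inv[OF hA]]) (use assms(1) f im in auto)
    have eq: "?g (h x) = f x" if "x \<in> A" for x using that inj by simp
    have "?g ` h ` A \<subseteq> e ` h ` B"
    proof
      fix y assume "y \<in> ?g ` h ` A"
      then obtain x where "x \<in> A" "y = f x" using eq by auto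
      then have "y \<in> ?e ` B" using sub by blast
      then show "y \<in> e ` h ` B" by auto
    qed
    from c[OF g this] have "\<chi> (restrict (\<lambda>x. ?g (h x)) A) = c" .
    moreover have "restrict (\<lambda>x. ?g (h x)) A = f"
    proof
      fix x
      have fE: "f \<in> A \<rightarrow>\<^sub>E C" using f by (simp add: copies_iff[OF assms(1)])
      show "restrict (\<lambda>x. ?g (h x)) A x = f x"
      proof (cases "x \<in> A")
        case True
        then show ?thesis using eq by (simp only: restrict_apply')
      qed (simp add: PiE_arb[OF fE])
    qed
    ultimately show ?thesis by simp
  qed
  have mem: "?e \<in> copies L M B N C"
    by (rule copies_comp_right[OF assms(2) e hB])
  show "\<exists>e\<in>copies L M B N C. \<exists>c. \<forall>f\<in>copies L M A N C. f ` A \<subseteq> e ` B \<longrightarrow> \<chi> f = c"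
    by (rule bexI[OF exI[of _ c] mem]) (use hom in blast)
qed

section \<open>The age inside the structure\<close>

text \<open>Terms and quantifier-free formulas never consult \<open>univ\<close>; hence types,
  copies and arrows computed in a generated substructure are those of \<open>N\<close>.\<close>

lemma eval_univ [simp]: "eval (N\<lparr>univ := X\<rparr>) \<alpha> t = eval N \<alpha> t"
proof (induction t)
  case (Fun f ts)
  then have "map (eval (N\<lparr>univ := X\<rparr>) \<alpha>) ts = map (eval N \<alpha>) ts" by simp
  then show ?case by (metis eval.simps(2) struct.select_convs(2) struct.surjective struct.update_convs(1))
qed simp

lemma sat_univ: "qfree \<phi> \<Longrightarrow> sat (N\<lparr>univ := X\<rparr>) \<alpha> \<phi> = sat N \<alpha> \<phi>"
proof (induction \<phi>)
  case (Rel r ts)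
  have "map (eval (N\<lparr>univ := X\<rparr>) \<alpha>) ts = map (eval N \<alpha>) ts" by simp
  then have "rint N r (map (eval (N\<lparr>univ := X\<rparr>) \<alpha>) ts) = rint N r (map (eval N \<alpha>) ts)" by (rule arg_cong)
  then show ?case by simp
qed auto

lemma qftp_univ [simp]: "qftp L (N\<lparr>univ := X\<rparr>) xs = qftp L N xs"
  unfolding qftp_def tp_def by (auto simp: sat_univ)

lemma copies_univ [simp]: "copies L (M\<lparr>univ := X\<rparr>) A N C = copies L M A N C"
  unfolding copies_def by simp

lemma ramsey_arrow_univ [simp]: "ramsey_arrow L N C (M\<lparr>univ := X\<rparr>) B A = ramsey_arrow L N C M B A"
  unfolding ramsey_arrow_def by simp

lemma isomorphic_qf_embedding:
  fixes M :: "('f, 'r, 'a) struct" and M' :: "('f, 'r, 'b) struct"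
  assumes "isomorphic L M M'" and "is_structure L M"
  shows "\<exists>h. bij_betw h (univ M) (univ M') \<and> qf_embedding L M (univ M) M' h"
proof -
  obtain h where bij: "bij_betw h (univ M) (univ M')"
    and F: "\<And>f xs. f \<in> fsyms L \<Longrightarrow> xs \<in> lists (univ M) \<Longrightarrow> length xs = farity L f \<Longrightarrow>
        h (fint M f xs) = fint M' f (map h xs)"
    and R: "\<And>r xs. r \<in> rsyms L \<Longrightarrow> xs \<in> lists (univ M) \<Longrightarrow> length xs = rarity L r \<Longrightarrow>
        rint M r xs = rint M' r (map h xs)"
    using assms(1) unfolding isomorphic_def by blast
  \<comment> \<open>Membership in \<open>univ M\<close> is carried along in the induction because
    the isomorphism respects function symbols only on arguments from the universe.\<close>
  have ev: "eval M \<alpha> t \<in> univ M \<and> h (eval M \<alpha> t) = eval M' (\<lambda>v. h (\<alpha> v)) t"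
    if "wf_tm L t" "\<alpha> ` fv_tm t \<subseteq> univ M" for t and \<alpha> :: "nat \<Rightarrow> 'a"
    using that
  proof (induction t)
    case (Fun f ts)
    have IH: "eval M \<alpha> t \<in> univ M \<and> h (eval M \<alpha> t) = eval M' (\<lambda>v. h (\<alpha> v)) t" if "t \<in> set ts" for t
      using Fun that by (auto simp: list_all_iff)
    have l: "map (eval M \<alpha>) ts \<in> lists (univ M)" using IH by auto
    have "map h (map (eval M \<alpha>) ts) = map (eval M' (\<lambda>v. h (\<alpha> v))) ts" using IH by auto
    then have "h (fint M f (map (eval M \<alpha>) ts)) = fint M' f (map (eval M' (\<lambda>v. h (\<alpha> v))) ts)"
      using F[of f, OF _ l] Fun.prems by (simp del: map_map)
    moreover have "fint M f (map (eval M \<alpha>) ts) \<in> univ M"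
      using assms(2) Fun.prems l unfolding is_structure_def by simp
    ultimately show ?case by simp
  qed auto
  have sat: "sat M \<alpha> \<phi> = sat M' (\<lambda>v. h (\<alpha> v)) \<phi>"
    if "wf_fm L \<phi>" "qfree \<phi>" "\<alpha> ` fv \<phi> \<subseteq> univ M" for \<phi> and \<alpha> :: "nat \<Rightarrow> 'a"
    using that
  proof (induction \<phi>)
    case (Eq s t)
    then have "eval M \<alpha> s \<in> univ M \<and> h (eval M \<alpha> s) = eval M' (\<lambda>v. h (\<alpha> v)) s"
      "eval M \<alpha> t \<in> univ M \<and> h (eval M \<alpha> t) = eval M' (\<lambda>v. h (\<alpha> v)) t" by (auto intro!: ev)
    then show ?case using bij by (metis bij_betw_inv_into_left sat.simps(1))
  next
    case (Rel r ts)
    have IH: "eval M \<alpha> t \<in> univ M \<and> h (eval M \<alpha> t) = eval M' (\<lambda>v. h (\<alpha> v)) t" if "t \<in> set ts" for t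
      by (rule ev) (use Rel that in \<open>auto simp: list_all_iff\<close>)
    have l: "map (eval M \<alpha>) ts \<in> lists (univ M)" using IH by auto
    have "map h (map (eval M \<alpha>) ts) = map (eval M' (\<lambda>v. h (\<alpha> v))) ts" using IH by auto
    then have "rint M r (map (eval M \<alpha>) ts) = rint M' r (map (eval M' (\<lambda>v. h (\<alpha> v))) ts)"
      using R[of r, OF _ l] Rel.prems by (simp del: map_map)
    then show ?case by simp
  qed auto
  have "qftp L M' (map h xs) = qftp L M xs" if "xs \<in> lists (univ M)" for xs
  proof (subst qftp_eq_iff, simp, intro allI impI)
    fix \<phi>
    assume *: "wf_fm L \<phi> \<and> qfree \<phi> \<and> fv \<phi> \<subseteq> {..<length (map h xs)}"
    have "sat M (\<lambda>k. xs ! k) \<phi> = sat M' (\<lambda>k. h (xs ! k)) \<phi>"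
      by (rule sat) (use * that in \<open>auto simp: subset_iff\<close>)
    also have "\<dots> = sat M' (\<lambda>k. map h xs ! k) \<phi>"
      by (rule sat_cong) (use * in auto)
    finally show "sat M' (\<lambda>k. map h xs ! k) \<phi> = sat M (\<lambda>k. xs ! k) \<phi>" by simp
  qed
  then show ?thesis using bij unfolding qf_embedding_def by blast
qed

lemma generated_subset:
  assumes "is_structure L N" and "S \<subseteq> univ N"
  shows "generated L N S \<subseteq> univ N"
proof
  fix x assume "x \<in> generated L N S"
  then show "x \<in> univ N"
  proof induction
    case (step f xs)
    then have "xs \<in> lists (univ N)" by auto
    then show ?case using assms(1) step(1,2) unfolding is_structure_def by blast
  qed (use assms(2) in blast)
qed

text \<open>Nonemptiness of \<open>S\<close> guards against languages without constants, where the
  empty set generates nothing and a structure must be nonempty.\<close>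

lemma in_age_generated:
  fixes N :: "('f, 'r, 'a) struct"
  assumes "is_structure L N" and "finite S" and "S \<subseteq> univ N" and "S \<noteq> {}"
  shows "in_age L N (N\<lparr>univ := generated L N S\<rparr>)"
proof -
  have "is_structure L (N\<lparr>univ := generated L N S\<rparr>)"
    using assms(4) unfolding is_structure_def by (auto intro: generated.intros)
  moreover have "isomorphic L M M" for M :: "('f, 'r, 'a) struct"
    unfolding isomorphic_def by (intro exI[of _ "\<lambda>x. x"]) (auto simp: bij_betw_def)
  ultimately show ?thesis unfolding in_age_def using assms by blast
qed

lemma in_age_qf_embedding:
  assumes "is_structure L N" and "in_age L N M"
  shows "\<exists>h. h ` univ M \<subseteq> univ N \<and> qf_embedding L M (univ M) N h"
proof -
  obtain S where S: "S \<subseteq> univ N" "isomorphic L M (N\<lparr>univ := generated L N S\<rparr>)" "is_structure L M"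
    using assms(2) unfolding in_age_def by blast
  obtain h where h: "bij_betw h (univ M) (generated L N S)"
    "qf_embedding L M (univ M) (N\<lparr>univ := generated L N S\<rparr>) h"
    using isomorphic_qf_embedding[OF S(2,3)] by auto
  show ?thesis
    using h generated_subset[OF assms(1) S(1)] unfolding bij_betw_def qf_embedding_def
    by (intro exI[of _ h]) auto
qed

text \<open>Finite subsets of \<open>N\<close> lie in finitely generated substructures, and members
  of the age embed back into \<open>N\<close>; both passages preserve quantifier-free types, so the
  age can be eliminated from the Ramsey property.\<close>

lemma finitary_ERP_iff:
  fixes N :: "('f, 'r, 'a) struct"
  assumes N: "is_structure L N"
  shows "finitary_ERP L N \<longleftrightarrow>
    (\<forall>A B. finite A \<and> A \<subseteq> univ N \<and> finite B \<and> B \<subseteq> univ N \<longrightarrow>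
      (\<exists>C. finite C \<and> C \<subseteq> univ N \<and> ramsey_arrow L N C N B A))"
proof (intro iffI allI impI)
  fix A B assume erp: "finitary_ERP L N" and AB: "finite A \<and> A \<subseteq> univ N \<and> finite B \<and> B \<subseteq> univ N"
  \<comment> \<open>The point \<open>x\<close> keeps the generating set nonempty when
    \<open>A\<close> and \<open>B\<close> are both empty.\<close>
  obtain x where x: "x \<in> univ N" using N unfolding is_structure_def by blast
  let ?M = "N\<lparr>univ := generated L N (insert x (A \<union> B))\<rparr>"
  have "in_age L N ?M" by (rule in_age_generated[OF N]) (use AB x in auto)
  moreover have "A \<subseteq> univ ?M" "B \<subseteq> univ ?M" by (auto intro: generated.base)
  ultimately have "\<exists>(N' :: ('f, 'r, 'a) struct) C. in_age L N N' \<and> finite C \<and> C \<subseteq> univ N' \<and>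
      ramsey_arrow L N' C ?M B A"
    using erp[unfolded finitary_ERP_def, THEN spec, of ?M] AB by blast
  then obtain N' :: "('f, 'r, 'a) struct" and C where C: "in_age L N N'" "finite C" "C \<subseteq> univ N'"
    "ramsey_arrow L N' C N B A" by auto
  obtain h where h: "h ` univ N' \<subseteq> univ N" "qf_embedding L N' (univ N') N h"
    using in_age_qf_embedding[OF N C(1)] by blast
  have "ramsey_arrow L N (h ` C) N B A"
    by (rule ramsey_arrow_target[OF _ _ C(4) qf_embedding_subset[OF h(2) C(3)]]) (use AB in auto)
  then show "\<exists>C. finite C \<and> C \<subseteq> univ N \<and> ramsey_arrow L N C N B A"
    using C h by (intro exI[of _ "h ` C"]) auto
next
  assume int: "\<forall>A B. finite A \<and> A \<subseteq> univ N \<and> finite B \<and> B \<subseteq> univ N \<longrightarrow>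
      (\<exists>C. finite C \<and> C \<subseteq> univ N \<and> ramsey_arrow L N C N B A)"
  show "finitary_ERP L N" unfolding finitary_ERP_def
  proof (intro allI impI)
    fix M :: "('f, 'r, 'a) struct" and A B
    assume M: "in_age L N M" and AB: "finite A \<and> A \<subseteq> univ M \<and> finite B \<and> B \<subseteq> univ M"
    obtain h where h: "h ` univ M \<subseteq> univ N" "qf_embedding L M (univ M) N h"
      using in_age_qf_embedding[OF N M] by blast
    have "finite (h ` A) \<and> h ` A \<subseteq> univ N \<and> finite (h ` B) \<and> h ` B \<subseteq> univ N"
      using AB h by blast
    then obtain C where C: "finite C" "C \<subseteq> univ N" "ramsey_arrow L N C N (h ` B) (h ` A)"
      using int[THEN spec, THEN spec, THEN mp, of "h ` A" "h ` B"] by auto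
    have arr: "ramsey_arrow L N C M B A"
      using AB by (intro ramsey_arrow_source[OF _ _ C(3)] qf_embedding_subset[OF h(2)]) auto
    obtain x where x: "x \<in> univ N" using N unfolding is_structure_def by blast
    let ?N = "N\<lparr>univ := generated L N (insert x C)\<rparr>"
    have "in_age L N ?N" by (rule in_age_generated[OF N]) (use C x in auto)
    moreover have "C \<subseteq> univ ?N" by (auto intro: generated.base)
    moreover have "ramsey_arrow L ?N C M B A"
      using arr unfolding ramsey_arrow_def copies_def by simp
    ultimately show "\<exists>(N' :: ('f, 'r, 'a) struct) C. in_age L N N' \<and> finite C \<and> C \<subseteq> univ N' \<and>
        ramsey_arrow L N' C M B A"
      using C(1) by blast
  qed
qed

text \<open>Induction on the list of colourings with nested arrows: an arrow for the head provides
  \<open>C\<close>, the remaining colourings are made constant on a copy of the larger set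
  \<open>C\<close>, and inside that copy the arrow finds a copy of \<open>B\<close> that is good for
  the head.\<close>

lemma ramsey_simultaneous:
  fixes cs :: "('a set \<times> (('a \<Rightarrow> 'a) \<Rightarrow> bool)) list"
  assumes erp: "\<And>A B. finite A \<Longrightarrow> A \<subseteq> univ N \<Longrightarrow> finite B \<Longrightarrow> B \<subseteq> univ N \<Longrightarrow>
      \<exists>C. finite C \<and> C \<subseteq> univ N \<and> ramsey_arrow L N C N B A"
    and "finite B" and "B \<subseteq> univ N"
    and "\<And>A \<chi>. (A, \<chi>) \<in> set cs \<Longrightarrow> finite A \<and> A \<subseteq> univ N"
  shows "\<exists>e\<in>copies L N B N (univ N). \<forall>(A, \<chi>)\<in>set cs.
    \<forall>f\<in>copies L N A N (e ` B). \<forall>g\<in>copies L N A N (e ` B). \<chi> f = \<chi> g"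
  using assms(2-4)
proof (induction cs arbitrary: B)
  case Nil
  have "map (restrict (\<lambda>x. x) B) xs = xs" if "xs \<in> lists B" for xs
    using that by (auto intro: map_idI)
  then have "restrict (\<lambda>x. x) B \<in> copies L N B N (univ N)"
    using Nil by (auto simp: copies_iff qf_embedding_def)
  then show ?case by auto
next
  case (Cons c cs)
  obtain A \<chi> where c: "c = (A, \<chi>)" by fastforce
  have A: "finite A" "A \<subseteq> univ N" using Cons.prems(3) c by auto
  obtain C where C: "finite C" "C \<subseteq> univ N" "ramsey_arrow L N C N B A"
    using erp[OF A Cons.prems(1,2)] by blast
  have prem: "finite A \<and> A \<subseteq> univ N" if "(A, \<chi>) \<in> set cs" for A \<chi> using Cons.prems(3) that by auto
  obtain d where d: "d \<in> copies L N C N (univ N)"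
    and hom: "\<And>A \<chi> f g. (A, \<chi>) \<in> set cs \<Longrightarrow> f \<in> copies L N A N (d ` C) \<Longrightarrow> g \<in> copies L N A N (d ` C) \<Longrightarrow> \<chi> f = \<chi> g"
    using Cons.IH[OF C(1,2) prem] by fastforce
  have dC: "d ` C \<subseteq> univ N" "qf_embedding L N C N d" using d by (auto simp: copies_iff[OF C(1)])
  have "(\<lambda>f. if \<chi> f then 1 else 0) \<in> copies L N A N (d ` C) \<rightarrow> {0, 1 :: nat}" by auto
  \<comment> \<open>The arrow is moved along \<open>d\<close> into \<open>d(C)\<close>. As
    \<open>e(B)\<close> lies in \<open>d(C)\<close>, the constancy already achieved for the tail is
    inherited.\<close>
  then obtain e c' where e: "e \<in> copies L N B N (d ` C)"
    and c': "\<And>f. f \<in> copies L N A N (d ` C) \<Longrightarrow> f ` A \<subseteq> e ` B \<Longrightarrow> (if \<chi> f then 1 else 0) = (c' :: nat)"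
    by (rule ramsey_arrowE[OF ramsey_arrow_target[OF A(1) Cons.prems(1) C(3) dC(2)]]) blast
  have eB: "e ` B \<subseteq> d ` C" using e by (auto simp: copies_iff[OF Cons.prems(1)])
  have mono: "copies L N A N (e ` B) \<subseteq> copies L N A N (d ` C)" for A
    unfolding copies_def using eB by (auto simp: PiE_iff)
  have img: "f ` A \<subseteq> e ` B" if "f \<in> copies L N A N (e ` B)" for f A
    using that unfolding copies_def by (auto simp: PiE_iff)
  have hom1: "\<chi> f = \<chi> g" if f: "f \<in> copies L N A N (e ` B)" and g: "g \<in> copies L N A N (e ` B)" for f g
    using c'[OF subsetD[OF mono f] img[OF f]] c'[OF subsetD[OF mono g] img[OF g]]
    by (metis zero_neq_one)
  have mem: "e \<in> copies L N B N (univ N)"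
    using e dC(1) unfolding copies_def by (auto simp: PiE_iff)
  show ?case
  proof (rule bexI[OF _ mem], clarify)
    fix A' \<chi>' f g
    assume cs: "(A', \<chi>') \<in> set (c # cs)"
      and f: "f \<in> copies L N A' N (e ` B)" and g: "g \<in> copies L N A' N (e ` B)"
    show "\<chi>' f = \<chi>' g"
    proof (cases "(A', \<chi>') = c")
      case True
      then have "A' = A" "\<chi>' = \<chi>" using c by auto
      then show ?thesis using hom1 f g by blast
    next
      case False
      then have "(A', \<chi>') \<in> set cs" using cs by simp
      then show ?thesis by (rule hom[OF _ subsetD[OF mono f] subsetD[OF mono g]])
    qed
  qed
qed

section \<open>Realising types in many variables\<close>

text \<open>That \<open>g\<close> together with the value \<open>c\<close> at \<open>v\<close>
  extends to an assignment satisfying \<Gamma> is expressed by one formula: conjoin \<Gamma>,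
  quantify away the variables that are neither \<open>v\<close> nor in \<open>dom g\<close>, and
  treat the values of \<open>g\<close> as parameters.\<close>

lemma ex_one_variable_formula:
  fixes \<Gamma> :: "('f, 'r, 'v) fm set" and M :: "('f, 'r, 'a) struct" and g :: "'v \<rightharpoonup> 'a"
  assumes "finite \<Gamma>" and "\<forall>\<phi>\<in>\<Gamma>. wf_fm L \<phi>" and "univ M \<noteq> {}" and "v \<notin> dom g" and "ran g \<subseteq> univ M"
  shows "\<exists>\<psi> \<rho>. (\<psi>, \<rho>) \<in> fms_over L (ran g) \<and>
    (\<forall>c\<in>univ M. sat M (\<rho>(0 := c)) \<psi> \<longleftrightarrow>
      (\<exists>\<alpha>. range \<alpha> \<subseteq> univ M \<and> \<alpha> v = c \<and> (\<forall>u\<in>dom g. g u = Some (\<alpha> u)) \<and> (\<forall>\<phi>\<in>\<Gamma>. sat M \<alpha> \<phi>)))"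
proof -
  obtain \<chi> where \<chi>: "wf_fm L \<chi>" "fv \<chi> = \<Union> (fv ` \<Gamma>)" "\<And>\<alpha>. sat M \<alpha> \<chi> \<longleftrightarrow> (\<forall>\<phi>\<in>\<Gamma>. sat M \<alpha> \<phi>)"
    using ex_conj[OF assms(1-3)] by blast
  define X where "X = fv \<chi> - dom g - {v}"
  have finX: "finite X" unfolding X_def by simp
  obtain \<theta> where \<theta>: "wf_fm L \<theta>" "fv \<theta> = fv \<chi> - X"
    "\<And>\<alpha>. sat M \<alpha> \<theta> \<longleftrightarrow> (\<exists>\<beta>. (\<forall>v. v \<notin> X \<longrightarrow> \<beta> v = \<alpha> v) \<and> \<beta> ` X \<subseteq> univ M \<and> sat M \<beta> \<chi>)"
    using ex_exists[OF finX \<chi>(1), of M] by blast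
  have fv\<theta>: "fv \<theta> \<subseteq> insert v (dom g)" unfolding \<theta>(2) X_def by blast
  obtain s' :: "'v \<Rightarrow> nat" where s': "inj_on s' (fv \<theta>)"
    using finite_imp_inj_to_nat_seg[OF finite_fv] by metis
  \<comment> \<open>Numbering of the remaining variables: 0 is reserved for \<open>v\<close>, the
    variable of the type, and \<open>Suc\<close> keeps the parameter variables off it.\<close>
  define s where "s u = (if u = v then 0 else Suc (s' u))" for u
  have s: "inj_on s (insert v (fv \<theta>))" using s' unfolding s_def inj_on_def by auto
  obtain \<psi> where \<psi>: "\<forall>L. wf_fm L \<psi> = wf_fm L \<theta>" "fv \<psi> = s ` fv \<theta>"
    "\<forall>(M :: ('f, 'r, 'a) struct) \<alpha>. sat M \<alpha> \<psi> = sat M (\<lambda>v. \<alpha> (s v)) \<theta>"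
    using ex_subst[of \<theta> s, where 'a = 'a] by auto
  obtain a0 where a0: "a0 \<in> univ M" using assms(3) by blast
  define \<rho> where "\<rho> k = (the (g (inv_into (fv \<theta>) s k)))" for k
  have \<rho>s: "g u = Some (\<rho> (s u))" if "u \<in> fv \<theta>" "u \<noteq> v" for u
  proof -
    have "inv_into (fv \<theta>) s (s u) = u" using s that by (intro inv_into_f_f) (auto simp: inj_on_def)
    then show ?thesis using that fv\<theta> unfolding \<rho>_def by auto
  qed
  have "\<rho> ` (fv \<psi> - {0}) \<subseteq> ran g"
  proof
    fix y assume "y \<in> \<rho> ` (fv \<psi> - {0})"
    then obtain u where u: "u \<in> fv \<theta>" "s u \<noteq> 0" "y = \<rho> (s u)" unfolding \<psi>(2) by auto
    then show "y \<in> ran g" using \<rho>s[of u] unfolding s_def by (auto simp: ran_def)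
  qed
  then have "(\<psi>, \<rho>) \<in> fms_over L (ran g)" using \<psi>(1) \<theta>(1) unfolding fms_over_def by simp
  moreover have "sat M (\<rho>(0 := c)) \<psi> \<longleftrightarrow>
      (\<exists>\<alpha>. range \<alpha> \<subseteq> univ M \<and> \<alpha> v = c \<and> (\<forall>u\<in>dom g. g u = Some (\<alpha> u)) \<and> (\<forall>\<phi>\<in>\<Gamma>. sat M \<alpha> \<phi>))"
    (is "_ \<longleftrightarrow> ?r") if c: "c \<in> univ M" for c
  proof -
    \<comment> \<open>The value \<open>a0\<close> is only a filler, since \<theta> has no free
      variables outside \<open>v\<close> and \<open>dom g\<close>.\<close>
    let ?\<gamma> = "\<lambda>u. if u = v then c else if u \<in> dom g then the (g u) else a0"
    have "sat M (\<rho>(0 := c)) \<psi> \<longleftrightarrow> sat M (\<lambda>u. (\<rho>(0 := c)) (s u)) \<theta>" using \<psi>(3) by blast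
    also have "\<dots> \<longleftrightarrow> sat M ?\<gamma> \<theta>"
    proof (rule sat_cong)
      fix u assume u: "u \<in> fv \<theta>"
      show "(\<rho>(0 := c)) (s u) = ?\<gamma> u"
        using \<rho>s[OF u] by (cases "u = v") (auto simp: s_def)
    qed
    also have "\<dots> \<longleftrightarrow> ?r"
    proof
      assume "sat M ?\<gamma> \<theta>"
      then obtain \<beta> where \<beta>: "\<forall>u. u \<notin> X \<longrightarrow> \<beta> u = ?\<gamma> u" "\<beta> ` X \<subseteq> univ M" "sat M \<beta> \<chi>"
        unfolding \<theta>(3) by blast
      have vX: "v \<notin> X" and gX: "\<And>u. u \<in> dom g \<Longrightarrow> u \<notin> X" unfolding X_def by auto
      have "\<beta> u \<in> univ M" for u
        using \<beta>(1,2) c a0 assms(5) by (cases "u \<in> X") (auto simp: ran_def)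
      moreover have "\<beta> v = c" using \<beta>(1) vX by simp
      moreover have "g u = Some (\<beta> u)" if "u \<in> dom g" for u
      proof -
        have "\<beta> u = the (g u)" using \<beta>(1) gX[OF that] that assms(4) by (metis (full_types))
        then show ?thesis using that by auto
      qed
      ultimately show ?r using \<beta>(3) \<chi>(3) by (intro exI[of _ \<beta>]) auto
    next
      assume ?r
      then obtain \<alpha> where \<alpha>: "range \<alpha> \<subseteq> univ M" "\<alpha> v = c" "\<forall>u\<in>dom g. g u = Some (\<alpha> u)"
        "\<forall>\<phi>\<in>\<Gamma>. sat M \<alpha> \<phi>" by blast
      let ?\<beta> = "\<lambda>u. if u \<in> X then \<alpha> u else ?\<gamma> u"
      have "sat M ?\<beta> \<chi> = sat M \<alpha> \<chi>"
      proof (rule sat_cong)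
        fix u assume "u \<in> fv \<chi>"
        moreover have "the (g u) = \<alpha> u" if "u \<in> dom g" using \<alpha>(3) that by (metis option.sel)
        ultimately show "?\<beta> u = \<alpha> u" using \<alpha>(2) unfolding X_def by auto
      qed
      then have "sat M ?\<beta> \<chi>" using \<alpha>(4) \<chi>(3) by simp
      moreover have "?\<beta> ` X \<subseteq> univ M" using \<alpha>(1) by auto
      ultimately show "sat M ?\<gamma> \<theta>" unfolding \<theta>(3) by (intro exI[of _ ?\<beta>]) simp
    qed
    finally show ?thesis .
  qed
  ultimately show ?thesis by blast
qed

text \<open>Zorn's lemma for partial assignments \<open>g\<close> such that each finite part of
  \<Gamma> is satisfied by some total assignment extending \<open>g\<close>. The extension by one
  variable is where saturation is used; the parameter set \<open>ran g\<close> is small because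
  \<open>dom g\<close> lies in \<open>V\<close>.\<close>

lemma realise_many_variables:
  fixes \<Gamma> :: "('f, 'r, 'v) fm set" and M :: "('f, 'r, 'a) struct" and \<kappa> :: "'k rel"
  assumes sat: "saturated L \<kappa> M" and small: "|V| <o \<kappa>" and ne: "univ M \<noteq> {}"
    and \<Gamma>: "\<And>\<phi>. \<phi> \<in> \<Gamma> \<Longrightarrow> wf_fm L \<phi>" "\<And>\<phi>. \<phi> \<in> \<Gamma> \<Longrightarrow> fv \<phi> \<subseteq> V"
    and fin: "\<And>\<Gamma>\<^sub>0. finite \<Gamma>\<^sub>0 \<Longrightarrow> \<Gamma>\<^sub>0 \<subseteq> \<Gamma> \<Longrightarrow> \<exists>\<alpha>. range \<alpha> \<subseteq> univ M \<and> (\<forall>\<phi>\<in>\<Gamma>\<^sub>0. sat M \<alpha> \<phi>)"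
  shows "\<exists>\<alpha>. range \<alpha> \<subseteq> univ M \<and> (\<forall>\<phi>\<in>\<Gamma>. sat M \<alpha> \<phi>)"
proof -
  define ext where "ext g \<Gamma>\<^sub>0 \<alpha> \<longleftrightarrow>
    range \<alpha> \<subseteq> univ M \<and> (\<forall>u\<in>dom g. g u = Some (\<alpha> u)) \<and> (\<forall>\<phi>\<in>\<Gamma>\<^sub>0. sat M \<alpha> \<phi>)"
    for g :: "'v \<rightharpoonup> 'a" and \<Gamma>\<^sub>0 \<alpha>
  define P where "P g \<longleftrightarrow> (\<forall>\<Gamma>\<^sub>0. finite \<Gamma>\<^sub>0 \<and> \<Gamma>\<^sub>0 \<subseteq> \<Gamma> \<longrightarrow> (\<exists>\<alpha>. ext g \<Gamma>\<^sub>0 \<alpha>))" for g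
  obtain a0 where a0: "a0 \<in> univ M" using ne by blast
  have ran: "ran g \<subseteq> univ M" if Pg: "P g" for g
  proof -
    obtain \<alpha> where "ext g {} \<alpha>" using Pg unfolding P_def by blast
    then show ?thesis unfolding ext_def by (force simp: ran_def)
  qed
  have "\<exists>g. dom g = V \<and> P g"
  proof (rule finite_character_total)
    fix g assume *: "\<And>Y. finite Y \<Longrightarrow> P (g |` Y)"
    have "ran g \<subseteq> univ M"
    proof
      fix y assume "y \<in> ran g"
      then obtain x where x: "g x = Some y" by (auto simp: ran_def)
      then have "y \<in> ran (g |` {x})" by (auto simp: ran_def restrict_map_def)
      then show "y \<in> univ M" using ran[OF *[of "{x}"]] by auto
    qed
    show "P g" unfolding P_def
    proof (intro allI impI)
      fix \<Gamma>\<^sub>0 assume \<Gamma>\<^sub>0: "finite \<Gamma>\<^sub>0 \<and> \<Gamma>\<^sub>0 \<subseteq> \<Gamma>"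
      \<comment> \<open>Finite character: a finite part of \<Gamma> mentions only the finitely many
        variables in \<open>?Y\<close>, so a solution extending \<open>g\<close> on
        \<open>?Y\<close> may be overwritten by \<open>g\<close> elsewhere.\<close>
      let ?Y = "\<Union> (fv ` \<Gamma>\<^sub>0)"
      have "finite ?Y" using \<Gamma>\<^sub>0 by auto
      then obtain \<alpha> where \<alpha>: "ext (g |` ?Y) \<Gamma>\<^sub>0 \<alpha>" using * \<Gamma>\<^sub>0 unfolding P_def by blast
      let ?\<beta> = "\<lambda>u. if u \<in> dom g then the (g u) else \<alpha> u"
      have "sat M ?\<beta> \<phi>" if "\<phi> \<in> \<Gamma>\<^sub>0" for \<phi>
      proof -
        have "sat M ?\<beta> \<phi> = sat M \<alpha> \<phi>"
        proof (rule sat_cong)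
          fix v assume "v \<in> fv \<phi>"
          then have "v \<in> ?Y" using that by blast
          then have "g v = Some (\<alpha> v)" if "v \<in> dom g" using \<alpha> that unfolding ext_def by auto
          then show "?\<beta> v = \<alpha> v" by auto
        qed
        then show ?thesis using \<alpha> that unfolding ext_def by blast
      qed
      moreover have "range ?\<beta> \<subseteq> univ M"
      proof -
        have "\<alpha> u \<in> univ M" for u using \<alpha> unfolding ext_def by blast
        then have "?\<beta> u \<in> univ M" for u using \<open>ran g \<subseteq> univ M\<close> by (auto simp: ran_def)
        then show ?thesis by blast
      qed
      ultimately have "ext g \<Gamma>\<^sub>0 ?\<beta>" unfolding ext_def by auto
      then show "\<exists>\<alpha>. ext g \<Gamma>\<^sub>0 \<alpha>" by blast
    qed
  next
    fix g Y assume "P g"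
    moreover have "ext (g |` Y) \<Gamma>\<^sub>0 \<alpha>" if "ext g \<Gamma>\<^sub>0 \<alpha>" for \<Gamma>\<^sub>0 \<alpha>
      using that unfolding ext_def by auto
    ultimately show "P (g |` Y)" unfolding P_def by blast
  next
    show "P Map.empty" unfolding P_def ext_def using fin by auto
  next
    fix g v assume g: "P g" "dom g \<subseteq> V" and v: "v \<in> V" "v \<notin> dom g"
    \<comment> \<open>\<open>Q\<close> says that \<open>p\<close> is a formula whose solutions are
      exactly the possible values at \<open>v\<close> of assignments that extend \<open>g\<close>
      and satisfy \<open>\<Gamma>\<^sub>0\<close>.\<close>
    define Q where "Q \<Gamma>\<^sub>0 p \<longleftrightarrow> p \<in> fms_over L (ran g) \<and>
        (\<forall>c\<in>univ M. sat M ((snd p)(0 := c)) (fst p) \<longleftrightarrow> (\<exists>\<alpha>. ext g \<Gamma>\<^sub>0 \<alpha> \<and> \<alpha> v = c))" for \<Gamma>\<^sub>0 p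
    have "\<exists>p. \<forall>\<Gamma>\<^sub>0. finite \<Gamma>\<^sub>0 \<and> \<Gamma>\<^sub>0 \<subseteq> \<Gamma> \<longrightarrow> Q \<Gamma>\<^sub>0 (p \<Gamma>\<^sub>0)"
    proof (rule choice, rule allI)
      fix \<Gamma>\<^sub>0
      show "\<exists>p. finite \<Gamma>\<^sub>0 \<and> \<Gamma>\<^sub>0 \<subseteq> \<Gamma> \<longrightarrow> Q \<Gamma>\<^sub>0 p"
      proof (cases "finite \<Gamma>\<^sub>0 \<and> \<Gamma>\<^sub>0 \<subseteq> \<Gamma>")
        case True
        then have wf: "\<forall>\<phi>\<in>\<Gamma>\<^sub>0. wf_fm L \<phi>" using \<Gamma>(1) by blast
        from True have "finite \<Gamma>\<^sub>0" by blast
        from ex_one_variable_formula[OF this wf ne v(2) ran[OF g(1)]]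
        obtain \<psi> \<rho> where "(\<psi>, \<rho>) \<in> fms_over L (ran g)"
          "\<forall>c\<in>univ M. sat M (\<rho>(0 := c)) \<psi> \<longleftrightarrow> (\<exists>\<alpha>. range \<alpha> \<subseteq> univ M \<and> \<alpha> v = c \<and>
             (\<forall>u\<in>dom g. g u = Some (\<alpha> u)) \<and> (\<forall>\<phi>\<in>\<Gamma>\<^sub>0. sat M \<alpha> \<phi>))"
          by blast
        then show ?thesis unfolding Q_def ext_def by (intro exI[of _ "(\<psi>, \<rho>)"]) auto
      qed auto
    qed
    then obtain p where Q: "\<forall>\<Gamma>\<^sub>0. finite \<Gamma>\<^sub>0 \<and> \<Gamma>\<^sub>0 \<subseteq> \<Gamma> \<longrightarrow> Q \<Gamma>\<^sub>0 (p \<Gamma>\<^sub>0)" by (rule exE)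
    have p: "p \<Gamma>\<^sub>0 \<in> fms_over L (ran g)" if "finite \<Gamma>\<^sub>0" "\<Gamma>\<^sub>0 \<subseteq> \<Gamma>" for \<Gamma>\<^sub>0
      using Q that unfolding Q_def by simp
    have sat_p: "sat M ((snd (p \<Gamma>\<^sub>0))(0 := c)) (fst (p \<Gamma>\<^sub>0)) \<longleftrightarrow> (\<exists>\<alpha>. ext g \<Gamma>\<^sub>0 \<alpha> \<and> \<alpha> v = c)"
      if "finite \<Gamma>\<^sub>0" "\<Gamma>\<^sub>0 \<subseteq> \<Gamma>" "c \<in> univ M" for \<Gamma>\<^sub>0 c
      using Q that unfolding Q_def by simp
    let ?F = "{\<Gamma>\<^sub>0. finite \<Gamma>\<^sub>0 \<and> \<Gamma>\<^sub>0 \<subseteq> \<Gamma>}"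
    have real: "realises M c (p ` \<F>) \<longleftrightarrow> (\<forall>\<Gamma>\<^sub>0\<in>\<F>. \<exists>\<alpha>. ext g \<Gamma>\<^sub>0 \<alpha> \<and> \<alpha> v = c)"
      if "c \<in> univ M" "\<F> \<subseteq> ?F" for c \<F>
    proof -
      have "realises M c (p ` \<F>) \<longleftrightarrow> (\<forall>\<Gamma>\<^sub>0\<in>\<F>. sat M ((snd (p \<Gamma>\<^sub>0))(0 := c)) (fst (p \<Gamma>\<^sub>0)))"
        unfolding realises_def by (simp add: case_prod_beta)
      also have "\<dots> \<longleftrightarrow> (\<forall>\<Gamma>\<^sub>0\<in>\<F>. \<exists>\<alpha>. ext g \<Gamma>\<^sub>0 \<alpha> \<and> \<alpha> v = c)"
        using sat_p that by (intro ball_cong refl) auto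
      finally show ?thesis .
    qed
    have "|ran g| \<le>o |dom g|"
      using surj_imp_ordLeq[of "ran g" "the \<circ> g" "dom g"] by (force simp: ran_def)
    then have "|ran g| <o \<kappa>"
      using ordLeq_ordLess_trans[OF ordLeq_transitive[OF _ card_of_mono1[OF g(2)]] small] by blast
    moreover have "\<exists>c\<in>univ M. realises M c q" if q: "finite q" "q \<subseteq> p ` ?F" for q
    proof -
      obtain \<F> where \<F>: "\<F> \<subseteq> ?F" "finite \<F>" "q = p ` \<F>" using finite_subset_image[OF q] by blast
      \<comment> \<open>Finite satisfiability of the one-variable type: finitely many finite parts
        have a finite union, and a single assignment for the union serves all of them.\<close>
      have "finite (\<Union>\<F>)" "\<Union>\<F> \<subseteq> \<Gamma>" using \<F> by auto
      then obtain \<alpha> where \<alpha>: "ext g (\<Union>\<F>) \<alpha>" using g(1) unfolding P_def by blast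
      then have "\<forall>\<Gamma>\<^sub>0\<in>\<F>. ext g \<Gamma>\<^sub>0 \<alpha>" unfolding ext_def by blast
      moreover have "\<alpha> v \<in> univ M" using \<alpha> unfolding ext_def by blast
      ultimately show ?thesis using real[OF _ \<F>(1)] \<F>(3) by blast
    qed
    moreover have "p ` ?F \<subseteq> fms_over L (ran g)" using p by blast
    ultimately obtain c where c: "c \<in> univ M" "realises M c (p ` ?F)"
      using sat[unfolded saturated_def, THEN spec, THEN spec, of "ran g" "p ` ?F"] ran[OF g(1)] by blast
    have "P (g(v \<mapsto> c))" unfolding P_def
    proof (intro allI impI)
      fix \<Gamma>\<^sub>0 assume "finite \<Gamma>\<^sub>0 \<and> \<Gamma>\<^sub>0 \<subseteq> \<Gamma>"
      then obtain \<alpha> where "ext g \<Gamma>\<^sub>0 \<alpha>" "\<alpha> v = c" using c real[OF c(1) subset_refl] by blast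
      then have "ext (g(v \<mapsto> c)) \<Gamma>\<^sub>0 \<alpha>" unfolding ext_def by auto
      then show "\<exists>\<alpha>. ext (g(v \<mapsto> c)) \<Gamma>\<^sub>0 \<alpha>" by blast
    qed
    then show "\<exists>c. P (g(v \<mapsto> c))" by blast
  qed
  then obtain g where g: "dom g = V" "P g" by blast
  let ?\<alpha> = "\<lambda>u. if u \<in> V then the (g u) else a0"
  have "sat M ?\<alpha> \<phi>" if "\<phi> \<in> \<Gamma>" for \<phi>
  proof -
    have "finite {\<phi>} \<and> {\<phi>} \<subseteq> \<Gamma>" using that by simp
    then obtain \<beta> where \<beta>: "ext g {\<phi>} \<beta>" using g(2) unfolding P_def by blast
    have "sat M ?\<alpha> \<phi> = sat M \<beta> \<phi>"
    proof (rule sat_cong)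
      fix u assume "u \<in> fv \<phi>"
      then have "u \<in> V" using \<Gamma>(2)[OF that] by blast
      moreover from this have "g u = Some (\<beta> u)" using \<beta> g(1) unfolding ext_def by blast
      ultimately show "?\<alpha> u = \<beta> u" by simp
    qed
    then show ?thesis using \<beta> unfolding ext_def by blast
  qed
  moreover have "range ?\<alpha> \<subseteq> univ M"
    using ran[OF g(2)] g(1) a0 by (auto simp: ran_def)
  ultimately show ?thesis by blast
qed

section \<open>From the Ramsey property to the modelling property\<close>

text \<open>The unknown sequence is a single assignment to variables from
  \<open>univ N \<times> I\<close>. The type to realise has two kinds of formulas: implications
  forcing indiscernibility, and the formulas that \<open>a\<close> satisfies at all index tuples of
  a given quantifier-free type. The second kind already forces the result to be based on
  \<open>a\<close>.\<close>

lemma finitary_ERP_imp_modelling: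
  fixes N :: "('f, 'r, 'n) struct" and M :: "('g, 's, 'm) struct" and \<kappa> :: "'k rel"
    and I :: "'x set" and a :: "'n \<Rightarrow> 'x \<Rightarrow> 'm"
  assumes N: "is_structure L' N" and erp: "finitary_ERP L' N"
    and inf: "infinite (UNIV :: 'x set)"
    and ne: "univ M \<noteq> {}" and sat: "saturated L \<kappa> M" and small: "|univ N \<times> I| <o \<kappa>"
    and a: "tuple_sequence N M I a"
  shows "\<exists>b. tuple_sequence N M I b \<and> indiscernible L' N L M I b \<and> based_on L' N L M I b a"
proof -
  have inf': "infinite (UNIV :: ('n \<times> 'x) set)" using inf by (simp add: finite_prod)
  obtain m0 where m0: "m0 \<in> univ M" using ne by blast
  \<comment> \<open>Position \<open>k\<close> of an index tuple is replaced by the index standing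
    there, so \<open>S (\<phi>, is)\<close> states \<phi> of the entries at \<open>is\<close> of the
    unknown sequence.\<close>
  define s :: "'n list \<Rightarrow> nat \<times> 'x \<Rightarrow> 'n \<times> 'x" where "s is = (\<lambda>(k, \<xi>). (is ! k, \<xi>))" for "is"
  define Q where "Q p \<phi> \<longleftrightarrow> (\<forall>L. wf_fm L \<phi> = wf_fm L (fst p)) \<and>
    fv \<phi> = s (snd p) ` fv (fst p) \<and>
    (\<forall>(M :: ('g, 's, 'm) struct) \<alpha>. sat M \<alpha> \<phi> = sat M (\<lambda>v. \<alpha> (s (snd p) v)) (fst p))"
    for p :: "('g, 's, nat \<times> 'x) fm \<times> 'n list" and \<phi>
  have "\<exists>S. \<forall>p. Q p (S p)"
    by (rule choice, rule allI, unfold Q_def, rule ex_subst[OF inf'])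
  then obtain S where Q: "\<forall>p. Q p (S p)" by (rule exE)
  have S: "wf_fm L (S p) = wf_fm L (fst p)" "fv (S p) = s (snd p) ` fv (fst p)"
    "sat M \<alpha> (S p) = sat M (\<lambda>v. \<alpha> (s (snd p) v)) (fst p)" for p \<alpha>
    using spec[OF Q, of p] unfolding Q_def by simp_all
  have sat_S: "sat M \<alpha> (S (\<phi>, is)) = sat M (concat_tuple (\<lambda>i \<xi>. \<alpha> (i, \<xi>)) is) \<phi>" for \<alpha> \<phi> "is"
    unfolding S(3) fst_conv snd_conv by (rule sat_cong) (auto simp: concat_tuple_def s_def)
  define ok where "ok \<phi> is \<longleftrightarrow> wf_fm L \<phi> \<and> fv \<phi> \<subseteq> {..<length is} \<times> I \<and> is \<in> lists (univ N)"
    for \<phi> :: "('g, 's, nat \<times> 'x) fm" and "is"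
  define sim where "sim is js \<longleftrightarrow> length is = length js \<and> js \<in> lists (univ N) \<and> qftp L' N is = qftp L' N js"
    for "is" js
  define ind where "ind = {(\<phi>, is, js). ok \<phi> is \<and> sim is js}"
  \<comment> \<open>The Ehrenfeucht-Mostowski type of \<open>a\<close>: the truth of \<phi> depends
    here on the quantifier-free type of the indices alone.\<close>
  define em where "em = {(\<phi>, is). ok \<phi> is \<and> (\<forall>js. sim is js \<longrightarrow> sat M (concat_tuple a js) \<phi>)}"
  \<comment> \<open>The implication from \<open>\<phi>(is)\<close> to \<open>\<phi>(js)\<close>; the
    converse arises by exchanging \<open>is\<close> and \<open>js\<close>.\<close>
  define F where "F = (\<lambda>(\<phi>, is, js). Neg (Conj (S (\<phi>, is)) (Neg (S (\<phi>, js)))))"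
  define \<Gamma> where "\<Gamma> = F ` ind \<union> S ` em"
  have ok_S: "wf_fm L (S (\<phi>, is))" "fv (S (\<phi>, is)) \<subseteq> univ N \<times> I" if "ok \<phi> is" for \<phi> "is"
  proof -
    show "wf_fm L (S (\<phi>, is))" using that S(1) unfolding ok_def by simp
    have "s is v \<in> univ N \<times> I" if "v \<in> fv \<phi>" for v
      using \<open>ok \<phi> is\<close> that unfolding ok_def s_def by (cases v) auto
    then show "fv (S (\<phi>, is)) \<subseteq> univ N \<times> I"
      unfolding S(2) fst_conv snd_conv by (rule image_subsetI)
  qed
  have sim_ok: "ok \<phi> js" if "ok \<phi> is" "sim is js" for \<phi> "is" js using that unfolding ok_def sim_def by simp
  have cong: "sat M (concat_tuple a' is) \<phi> = sat M (concat_tuple b' js) \<phi>"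
    if "fv \<phi> \<subseteq> {..<n} \<times> I" "\<And>k \<xi>. k < n \<Longrightarrow> \<xi> \<in> I \<Longrightarrow> a' (is ! k) \<xi> = b' (js ! k) \<xi>" for \<phi> a' b' "is" js n
    by (rule sat_cong) (use that in \<open>auto simp: concat_tuple_def\<close>)
  have "\<exists>\<alpha>. range \<alpha> \<subseteq> univ M \<and> (\<forall>\<phi>\<in>\<Gamma>. sat M \<alpha> \<phi>)"
  proof (rule realise_many_variables[OF sat small ne])
    fix \<phi> assume "\<phi> \<in> \<Gamma>"
    then show "wf_fm L \<phi>" "fv \<phi> \<subseteq> univ N \<times> I"
      using ok_S sim_ok unfolding \<Gamma>_def F_def ind_def em_def by fastforce+
  next
    fix \<Gamma>\<^sub>0 assume "finite \<Gamma>\<^sub>0" "\<Gamma>\<^sub>0 \<subseteq> \<Gamma>"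
    then have "finite (\<Gamma>\<^sub>0 \<inter> F ` ind)" "finite (\<Gamma>\<^sub>0 \<inter> S ` em)" "\<Gamma>\<^sub>0 \<subseteq> (\<Gamma>\<^sub>0 \<inter> F ` ind) \<union> (\<Gamma>\<^sub>0 \<inter> S ` em)"
      unfolding \<Gamma>_def by auto
    then obtain ind0 em0 where fin: "finite ind0" "finite em0" and sub: "ind0 \<subseteq> ind" "em0 \<subseteq> em"
      and \<Gamma>\<^sub>0: "\<Gamma>\<^sub>0 \<subseteq> F ` ind0 \<union> S ` em0"
      using finite_subset_image[of "\<Gamma>\<^sub>0 \<inter> F ` ind" F ind] finite_subset_image[of "\<Gamma>\<^sub>0 \<inter> S ` em" S em]
      by (metis inf_le2)
    define B where "B = (\<Union>(\<phi>, is, js)\<in>ind0. set is \<union> set js) \<union> (\<Union>(\<phi>, is)\<in>em0. set is)"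
    have B: "finite B" "B \<subseteq> univ N"
      using fin sub unfolding B_def ind_def em_def ok_def sim_def by fastforce+
    obtain indl where indl: "set indl = ind0" using finite_list[OF fin(1)] by blast
    \<comment> \<open>A copy \<open>f\<close> of \<open>set is\<close> is coloured by the truth
      value of \<phi> at the tuple of \<open>a\<close> indexed by \<open>f(is)\<close>.\<close>
    define col where "col = (\<lambda>(\<phi>, is :: 'n list, js :: 'n list). (set is, \<lambda>f :: 'n \<Rightarrow> 'n. sat M (concat_tuple a (map f is)) \<phi>))"
    obtain e where e: "e \<in> copies L' N B N (univ N)"
      and hom: "\<forall>(A, \<chi>)\<in>set (map col indl). \<forall>f\<in>copies L' N A N (e ` B). \<forall>g\<in>copies L' N A N (e ` B). \<chi> f = \<chi> g"
    proof -
      have "finite A \<and> A \<subseteq> univ N" if "(A, \<chi>) \<in> set (map col indl)" for A \<chi>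
        using that sub indl unfolding col_def ind_def ok_def by auto
      moreover have "\<exists>C. finite C \<and> C \<subseteq> univ N \<and> ramsey_arrow L' N C N B A"
        if "finite A" "A \<subseteq> univ N" "finite B" "B \<subseteq> univ N" for A B
        using that erp unfolding finitary_ERP_iff[OF N] by simp
      ultimately have "\<exists>e\<in>copies L' N B N (univ N). \<forall>(A, \<chi>)\<in>set (map col indl).
          \<forall>f\<in>copies L' N A N (e ` B). \<forall>g\<in>copies L' N A N (e ` B). \<chi> f = \<chi> g"
        by (intro ramsey_simultaneous B)
      then show thesis by (elim bexE) (rule that)
    qed
    have eqf: "qf_embedding L' N B N e" and eB: "\<And>x. x \<in> B \<Longrightarrow> e x \<in> univ N"
      using e by (auto simp: copies_iff[OF B(1)])
    \<comment> \<open>The finite part is satisfied by \<open>a\<close> reindexed along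
      \<open>e\<close>; \<open>m0\<close> only fills the variables that do not occur in it.\<close>
    define \<alpha> where "\<alpha> = (\<lambda>(i, \<xi>). if i \<in> B \<and> \<xi> \<in> I then a (e i) \<xi> else m0)"
    have \<alpha>: "range \<alpha> \<subseteq> univ M" using a eB m0 unfolding \<alpha>_def tuple_sequence_def by auto
    have sat_\<alpha>: "sat M \<alpha> (S (\<phi>, is)) = sat M (concat_tuple a (map e is)) \<phi>"
      if "fv \<phi> \<subseteq> {..<length is} \<times> I" "set is \<subseteq> B" for \<phi> "is"
      unfolding sat_S by (rule cong[OF that(1)]) (use that(2) in \<open>auto simp: \<alpha>_def subset_iff\<close>)
    have lB: "is \<in> lists B" if "set is \<subseteq> B" for "is" using that by auto
    have "sat M \<alpha> (S (\<phi>, is))" if "(\<phi>, is) \<in> em0" for \<phi> "is"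
    proof -
      have em: "ok \<phi> is" "\<And>js. sim is js \<Longrightarrow> sat M (concat_tuple a js) \<phi>" using that sub unfolding em_def by auto
      have isB: "set is \<subseteq> B" using that unfolding B_def by blast
      have "sim is (map e is)"
        using eqf lB[OF isB] isB eB unfolding sim_def qf_embedding_def by auto
      then show ?thesis using sat_\<alpha>[of \<phi> "is"] em isB unfolding ok_def by auto
    qed
    moreover have "sat M \<alpha> (F (\<phi>, is, js))" if "(\<phi>, is, js) \<in> ind0" for \<phi> "is" js
    proof -
      have ok: "ok \<phi> is" and sim: "sim is js" using that sub unfolding ind_def by auto
      have isB: "set is \<subseteq> B" and jsB: "set js \<subseteq> B" using that unfolding B_def by blast+
      have len: "length is = length js" using sim unfolding sim_def by simp
      define \<tau> where "\<tau> x = js ! (SOME k. k < length is \<and> is ! k = x)" for x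
      have \<tau>: "map \<tau> is = js"
      proof (rule nth_equalityI)
        fix k assume "k < length (map \<tau> is)"
        then have k: "k < length is" by simp
        let ?l = "SOME l. l < length is \<and> is ! l = is ! k"
        have "?l < length is \<and> is ! ?l = is ! k" by (rule someI[of _ k]) (use k in simp)
        then have "js ! ?l = js ! k"
          using qftp_eq_nth[OF len, of L' N N ?l k] sim k unfolding sim_def by blast
        then show "map \<tau> is ! k = js ! k" using k unfolding \<tau>_def by simp
      qed (simp add: len)
      have q\<tau>: "qf_embedding L' N (set is) N \<tau>"
        by (rule qf_embeddingI_enum[of _ _ _ "is"]) (use sim \<tau> in \<open>auto simp: sim_def\<close>)
      have \<tau>B: "\<tau> ` set is \<subseteq> B" using \<tau> jsB by (metis list.set_map)
      \<comment> \<open>Both \<open>e\<close> and \<open>e \<circ> \<tau>\<close> restrict to copies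
        of \<open>set is\<close> inside \<open>e(B)\<close>, so they receive the same colour, and
        this is the required equivalence between \<open>is\<close> and \<open>js\<close>.\<close>
      let ?f = "restrict e (set is)" and ?g = "restrict (\<lambda>x. e (\<tau> x)) (set is)"
      have "qf_embedding L' N (set is) N ?f"
        using qf_embedding_subset[OF eqf isB] by (subst qf_embedding_cong[of _ _ e]) auto
      then have f: "?f \<in> copies L' N (set is) N (e ` B)" using isB by (auto simp: copies_iff)
      have "qf_embedding L' N (set is) N ?g"
        using qf_embedding_comp[OF q\<tau> qf_embedding_subset[OF eqf \<tau>B]]
        by (subst qf_embedding_cong[of _ _ "\<lambda>x. e (\<tau> x)"]) auto
      then have g: "?g \<in> copies L' N (set is) N (e ` B)" using \<tau>B by (auto simp: copies_iff)
      have "col (\<phi>, is, js) \<in> set (map col indl)" using that indl by auto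
      from bspec[OF hom this]
      have "\<forall>f\<in>copies L' N (set is) N (e ` B). \<forall>g\<in>copies L' N (set is) N (e ` B).
          sat M (concat_tuple a (map f is)) \<phi> = sat M (concat_tuple a (map g is)) \<phi>"
        unfolding col_def prod.case .
      from bspec[OF bspec[OF this f] g] have "sat M (concat_tuple a (map ?f is)) \<phi> = sat M (concat_tuple a (map ?g is)) \<phi>"
        .
      moreover have "map ?f is = map e is" by simp
      moreover have "map ?g is = map e js" by (simp add: \<tau>[symmetric])
      ultimately have "sat M (concat_tuple a (map e is)) \<phi> = sat M (concat_tuple a (map e js)) \<phi>" by metis
      then show ?thesis unfolding F_def using sat_\<alpha>[of \<phi> "is"] sat_\<alpha>[of \<phi> js] isB jsB ok len
        unfolding ok_def by simp
    qed
    ultimately have "\<forall>\<phi>\<in>\<Gamma>\<^sub>0. sat M \<alpha> \<phi>" using \<Gamma>\<^sub>0 by fast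
    then show "\<exists>\<alpha>. range \<alpha> \<subseteq> univ M \<and> (\<forall>\<phi>\<in>\<Gamma>\<^sub>0. sat M \<alpha> \<phi>)" using \<alpha> by blast
  qed
  then obtain \<beta> where \<beta>: "range \<beta> \<subseteq> univ M" "\<And>\<phi>. \<phi> \<in> \<Gamma> \<Longrightarrow> sat M \<beta> \<phi>" by blast
  define b where "b i \<xi> = \<beta> (i, \<xi>)" for i \<xi>
  have sat_b: "sat M \<beta> (S (\<phi>, is)) = sat M (concat_tuple b is) \<phi>" for \<phi> "is"
    unfolding sat_S b_def ..
  have b_ind: "sat M (concat_tuple b is) \<phi> \<Longrightarrow> sat M (concat_tuple b js) \<phi>" if "ok \<phi> is" "sim is js" for \<phi> "is" js
  proof -
    have "F (\<phi>, is, js) \<in> \<Gamma>" unfolding \<Gamma>_def ind_def using that by blast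
    from \<beta>(2)[OF this] show "sat M (concat_tuple b is) \<phi> \<Longrightarrow> sat M (concat_tuple b js) \<phi>"
      unfolding F_def by (simp add: sat_b)
  qed
  have b_em: "sat M (concat_tuple b is) \<phi>" if "ok \<phi> is" "\<And>js. sim is js \<Longrightarrow> sat M (concat_tuple a js) \<phi>" for \<phi> "is"
  proof -
    have "S (\<phi>, is) \<in> \<Gamma>" unfolding \<Gamma>_def em_def using that by blast
    from \<beta>(2)[OF this] show ?thesis by (simp add: sat_b)
  qed
  have "tuple_sequence N M I b" using \<beta>(1) unfolding tuple_sequence_def b_def by blast
  moreover have "indiscernible L' N L M I b"
    unfolding indiscernible_def
  proof (intro allI ballI impI)
    fix n "is" js assume l: "is \<in> lists (univ N)" "js \<in> lists (univ N)"
      and n: "length is = n \<and> length js = n \<and> qftp L' N is = qftp L' N js"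
    have "sim is js" "sim js is" using l n unfolding sim_def by auto
    moreover have "ok \<phi> is" "ok \<phi> js" if "wf_fm L \<phi>" "fv \<phi> \<subseteq> {..<n} \<times> I" for \<phi>
      using that l n unfolding ok_def by auto
    ultimately show "tp L M ({..<n} \<times> I) (concat_tuple b is) = tp L M ({..<n} \<times> I) (concat_tuple b js)"
      unfolding tp_def using b_ind by blast
  qed
  moreover have "based_on L' N L M I b a"
    unfolding based_on_def
  proof (intro allI ballI impI, rule ccontr)
    fix \<Delta> :: "('g, 's, nat \<times> 'x) fm set" and n "is"
    assume \<Delta>: "finite \<Delta> \<and> (\<forall>\<phi>\<in>\<Delta>. wf_fm L \<phi>)" and l: "is \<in> lists (univ N)" and n: "length is = n"
      and no: "\<not> (\<exists>js\<in>lists (univ N). length js = n \<and> qftp L' N is = qftp L' N js \<and>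
        tp_restr \<Delta> L M ({..<n} \<times> I) (concat_tuple b is) = tp_restr \<Delta> L M ({..<n} \<times> I) (concat_tuple a js))"
    let ?\<Delta> = "{\<phi>\<in>\<Delta>. fv \<phi> \<subseteq> {..<n} \<times> I}"
    \<comment> \<open>The conjunction \<psi> of these literals describes the \<Delta>-type of
      \<open>b\<close> at \<open>is\<close>. If no similar \<open>js\<close> had this \<Delta>-type
      in \<open>a\<close>, then \<open>Neg \<psi>\<close> would belong to \<open>em\<close> and
      hence hold of \<open>b\<close>.\<close>
    let ?lit = "\<lambda>\<phi>. if sat M (concat_tuple b is) \<phi> then \<phi> else Neg \<phi>"
    have "finite (?lit ` ?\<Delta>)" using \<Delta> by simp
    moreover have "\<forall>\<phi>\<in>?lit ` ?\<Delta>. wf_fm L \<phi>" using \<Delta> by auto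
    ultimately obtain \<psi> where \<psi>': "wf_fm L \<psi> \<and> fv \<psi> = \<Union> (fv ` ?lit ` ?\<Delta>) \<and>
        (\<forall>\<alpha>. sat M \<alpha> \<psi> \<longleftrightarrow> (\<forall>\<phi>\<in>?lit ` ?\<Delta>. sat M \<alpha> \<phi>))"
      by (rule exE[OF ex_conj[OF _ _ ne]])
    then have \<psi>: "wf_fm L \<psi>" "fv \<psi> = \<Union> (fv ` ?lit ` ?\<Delta>)"
      and sat_\<psi>: "\<And>\<alpha>. sat M \<alpha> \<psi> \<longleftrightarrow> (\<forall>\<phi>\<in>?lit ` ?\<Delta>. sat M \<alpha> \<phi>)"
      by (rule conjunct1, rule conjunct1[OF conjunct2], iprover)
    have "ok (Neg \<psi>) is" unfolding ok_def using \<psi>(1,2) l n by (auto split: if_splits)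
    moreover have "sat M (concat_tuple a js) (Neg \<psi>)" if "sim is js" for js
    proof (rule ccontr)
      assume "\<not> sat M (concat_tuple a js) (Neg \<psi>)"
      then have "\<forall>\<phi>\<in>?\<Delta>. sat M (concat_tuple a js) (?lit \<phi>)" using sat_\<psi> by simp
      then have eq: "\<forall>\<phi>\<in>?\<Delta>. sat M (concat_tuple a js) \<phi> = sat M (concat_tuple b is) \<phi>"
        by (auto split: if_splits)
      have "tp_restr \<Delta> L M ({..<n} \<times> I) (concat_tuple b is) = tp_restr \<Delta> L M ({..<n} \<times> I) (concat_tuple a js)"
        unfolding tp_restr_def tp_def using eq by auto
      then show False using no that n unfolding sim_def by metis
    qed
    ultimately have "sat M (concat_tuple b is) (Neg \<psi>)" by (rule b_em)
    then show False unfolding sat.simps sat_\<psi> by auto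
  qed
  ultimately show ?thesis by blast
qed

section \<open>Generic relational structures\<close>

definition rel_lang :: "'r \<Rightarrow> nat \<Rightarrow> ('f, 'r) language" where
  "rel_lang r m = \<lparr>fsyms = {}, rsyms = {r}, farity = (\<lambda>_. 0), rarity = (\<lambda>_. m)\<rparr>"

definition rel_struct :: "'a set \<Rightarrow> ('a list \<Rightarrow> bool) \<Rightarrow> ('f, 'r, 'a) struct" where
  "rel_struct D R = \<lparr>univ = D, fint = (\<lambda>_ _. undefined), rint = (\<lambda>_. R)\<rparr>"

lemma rel_simps [simp]:
  "fsyms (rel_lang r m) = {}" "rsyms (rel_lang r m) = {r}" "rarity (rel_lang r m) r' = m"
  "univ (rel_struct D R) = D" "rint (rel_struct D R) r' = R"
  by (simp_all add: rel_lang_def rel_struct_def)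

lemma wf_tm_rel_lang: "wf_tm (rel_lang r m) t \<longleftrightarrow> (\<exists>v. t = Var v)"
  by (cases t) auto

text \<open>In a pattern \<open>ys\<close> below, \<open>None\<close> stands for the new element: over every small set of
  parameters, each behaviour of \<open>R\<close> on the lists that contain the new element is attained.\<close>

definition generic :: "'a set \<Rightarrow> ('a list \<Rightarrow> bool) \<Rightarrow> nat \<Rightarrow> 'k rel \<Rightarrow> bool" where
  "generic D R m \<kappa> \<longleftrightarrow> Card_order \<kappa> \<and> infinite (Field \<kappa>) \<and>
    (\<forall>A P. A \<subseteq> D \<and> |A| <o \<kappa> \<longrightarrow> (\<exists>x\<in>D - A. \<forall>ys. length ys = m \<and> set ys \<subseteq> insert None (Some ` A) \<and>
      None \<in> set ys \<longrightarrow> R (map (case_option x id) ys) = P ys))"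

lemma genericE:
  assumes "generic D R m \<kappa>" and "A \<subseteq> D" and "|A| <o \<kappa>"
  obtains x where "x \<in> D" "x \<notin> A" "\<And>ys. length ys = m \<Longrightarrow> set ys \<subseteq> insert None (Some ` A) \<Longrightarrow>
    None \<in> set ys \<Longrightarrow> R (map (case_option x id) ys) = P ys"
  using assms unfolding generic_def by (metis (no_types, lifting) DiffE)

lemma generic_finite:
  assumes "generic D R m \<kappa>" and "finite A"
  shows "|A| <o \<kappa>"
  by (rule finite_ordLess_infinite)
    (use assms in \<open>auto simp: generic_def card_order_on_well_order_on card_of_well_order_on Field_card_of\<close>)

text \<open>A finite \<open>D\<close> could itself serve as parameter set, but the new element lies
  outside the parameters.\<close>

lemma generic_infinite:
  assumes "generic D R m \<kappa>"
  shows "infinite D"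
proof
  assume "finite D"
  from genericE[OF assms subset_refl generic_finite[OF assms this]] show False by metis
qed

text \<open>Equality of quantifier-free types in the language of \<open>R\<close>, stated
  semantically so that the index set \<open>F\<close> may be infinite.\<close>

definition same_pattern ::
  "('a list \<Rightarrow> bool) \<Rightarrow> nat \<Rightarrow> 'v set \<Rightarrow> ('v \<Rightarrow> 'a) \<Rightarrow> ('v \<Rightarrow> 'a) \<Rightarrow> bool" where
  "same_pattern R m F \<alpha> \<beta> \<longleftrightarrow> (\<forall>u\<in>F. \<forall>v\<in>F. \<alpha> u = \<alpha> v \<longleftrightarrow> \<beta> u = \<beta> v) \<and>
    (\<forall>us. length us = m \<and> set us \<subseteq> F \<longrightarrow> R (map \<alpha> us) = R (map \<beta> us))"

lemma same_pattern_sym: "same_pattern R m F \<alpha> \<beta> \<Longrightarrow> same_pattern R m F \<beta> \<alpha>"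
  unfolding same_pattern_def by simp

lemma same_pattern_mono: "same_pattern R m F \<alpha> \<beta> \<Longrightarrow> G \<subseteq> F \<Longrightarrow> same_pattern R m G \<alpha> \<beta>"
  unfolding same_pattern_def by (elim conjE, intro conjI) (blast, metis subset_trans)

lemma same_pattern_comp:
  assumes "same_pattern R m F \<alpha> \<beta>" and "s ` G \<subseteq> F"
  shows "same_pattern R m G (\<lambda>v. \<alpha> (s v)) (\<lambda>v. \<beta> (s v))"
  unfolding same_pattern_def
proof (intro conjI ballI allI impI)
  fix u v assume "u \<in> G" "v \<in> G"
  then show "\<alpha> (s u) = \<alpha> (s v) \<longleftrightarrow> \<beta> (s u) = \<beta> (s v)"
    using assms unfolding same_pattern_def by blast
next
  fix us assume "length us = m \<and> set us \<subseteq> G"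
  then have "length (map s us) = m \<and> set (map s us) \<subseteq> F" using assms(2) by auto
  then have "R (map \<alpha> (map s us)) = R (map \<beta> (map s us))"
    using assms(1) unfolding same_pattern_def by blast
  then show "R (map (\<lambda>v. \<alpha> (s v)) us) = R (map (\<lambda>v. \<beta> (s v)) us)"
    by (simp add: comp_def)
qed

lemma same_pattern_cong:
  assumes "\<And>v. v \<in> F \<Longrightarrow> \<alpha> v = \<alpha>' v" and "\<And>v. v \<in> F \<Longrightarrow> \<beta> v = \<beta>' v" and "same_pattern R m F \<alpha> \<beta>"
  shows "same_pattern R m F \<alpha>' \<beta>'"
  unfolding same_pattern_def
proof (intro conjI ballI allI impI)
  fix u v assume "u \<in> F" "v \<in> F"
  then show "\<alpha>' u = \<alpha>' v \<longleftrightarrow> \<beta>' u = \<beta>' v"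
    using assms unfolding same_pattern_def by metis
next
  fix us assume us: "length us = m \<and> set us \<subseteq> F"
  then have "map \<alpha>' us = map \<alpha> us" "map \<beta>' us = map \<beta> us" using assms(1,2) by auto
  then show "R (map \<alpha>' us) = R (map \<beta>' us)"
    using assms(3) us unfolding same_pattern_def by metis
qed

lemma same_pattern_fresh:
  assumes old: "same_pattern R m F \<alpha> \<beta>" and v: "v \<notin> F"
    and a: "a \<notin> \<alpha> ` F" and x: "x \<notin> \<beta> ` F"
    and new: "\<And>us. length us = m \<Longrightarrow> set us \<subseteq> insert v F \<Longrightarrow> v \<in> set us \<Longrightarrow>
      R (map (\<alpha>(v := a)) us) = R (map (\<beta>(v := x)) us)"
  shows "same_pattern R m (insert v F) (\<alpha>(v := a)) (\<beta>(v := x))"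
  unfolding same_pattern_def
proof (intro conjI ballI allI impI)
  fix u w assume "u \<in> insert v F" "w \<in> insert v F"
  then show "(\<alpha>(v := a)) u = (\<alpha>(v := a)) w \<longleftrightarrow> (\<beta>(v := x)) u = (\<beta>(v := x)) w"
    using old a x v unfolding same_pattern_def by (cases "u = v"; cases "w = v") auto
next
  fix us assume us: "length us = m \<and> set us \<subseteq> insert v F"
  show "R (map (\<alpha>(v := a)) us) = R (map (\<beta>(v := x)) us)"
  proof (cases "v \<in> set us")
    case False
    then have "map (\<alpha>(v := a)) us = map \<alpha> us" "map (\<beta>(v := x)) us = map \<beta> us" by auto
    moreover have "R (map \<alpha> us) = R (map \<beta> us)"
      using old us False unfolding same_pattern_def by blast
    ultimately show ?thesis by metis
  qed (use new us in blast)
qed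

lemma same_pattern_extend:
  assumes gen: "generic D R m \<kappa>" and old: "same_pattern R m F \<alpha> \<beta>" and v: "v \<notin> F"
    and \<beta>: "\<beta> ` F \<subseteq> D" and small: "|\<beta> ` F| <o \<kappa>"
  shows "\<exists>b\<in>D. same_pattern R m (insert v F) (\<alpha>(v := a)) (\<beta>(v := b))"
proof (cases "a \<in> \<alpha> ` F")
  case True
  then obtain u where u: "u \<in> F" "a = \<alpha> u" by blast
  have "same_pattern R m (insert v F) (\<lambda>w. \<alpha> (if w = v then u else w)) (\<lambda>w. \<beta> (if w = v then u else w))"
    by (rule same_pattern_comp[OF old]) (use u in auto)
  then have "same_pattern R m (insert v F) (\<alpha>(v := a)) (\<beta>(v := \<beta> u))"
    by (rule same_pattern_cong[rotated 2]) (use u in auto)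
  then show ?thesis using u \<beta> by blast
next
  case False
  define h where "h u = (if u = v then None else Some (\<beta> u))" for u
  \<comment> \<open>\<beta> may repeat values, so a pattern can come from several lists
    \<open>us\<close>; by \<open>inj\<close> below these all have the same image under \<alpha>
    extended by \<open>a\<close>, hence agree about \<open>R\<close>.\<close>
  define P where "P ys \<longleftrightarrow> (\<exists>us. set us \<subseteq> insert v F \<and> ys = map h us \<and> R (map (\<alpha>(v := a)) us))" for ys
  obtain x where x: "x \<in> D" "x \<notin> \<beta> ` F" and R: "\<And>ys. length ys = m \<Longrightarrow>
      set ys \<subseteq> insert None (Some ` \<beta> ` F) \<Longrightarrow> None \<in> set ys \<Longrightarrow> R (map (case_option x id) ys) = P ys"
    by (rule genericE[OF gen \<beta> small, where P = P]) (rule that)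
  have inj: "(\<alpha>(v := a)) u = (\<alpha>(v := a)) w" if "h u = h w" "u \<in> insert v F" "w \<in> insert v F" for u w
    using that old unfolding same_pattern_def h_def by (auto split: if_splits)
  have "R (map (\<alpha>(v := a)) us) = R (map (\<beta>(v := x)) us)"
    if us: "length us = m" "set us \<subseteq> insert v F" "v \<in> set us" for us
  proof -
    have "map (\<beta>(v := x)) us = map (case_option x id) (map h us)" by (auto simp: h_def)
    then have "R (map (\<beta>(v := x)) us) = R (map (case_option x id) (map h us))" by (rule arg_cong)
    also have "\<dots> = P (map h us)"
      by (rule R) (use us in \<open>force simp: h_def\<close>)+
    also have "\<dots> = R (map (\<alpha>(v := a)) us)"
    proof
      assume "P (map h us)"
      then obtain us' where us': "set us' \<subseteq> insert v F" "map h us = map h us'" "R (map (\<alpha>(v := a)) us')"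
        unfolding P_def by blast
      have len: "length us = length us'" using us'(2) map_eq_imp_length_eq by blast
      have "map (\<alpha>(v := a)) us = map (\<alpha>(v := a)) us'"
      proof (rule nth_equalityI)
        fix k assume "k < length (map (\<alpha>(v := a)) us)"
        then have k: "k < length us" by simp
        have "h (us ! k) = h (us' ! k)" using us'(2) k len by (metis nth_map)
        then have "(\<alpha>(v := a)) (us ! k) = (\<alpha>(v := a)) (us' ! k)"
          by (rule inj) (use k len us(2) us'(1) in \<open>auto simp: subset_iff\<close>)
        then show "map (\<alpha>(v := a)) us ! k = map (\<alpha>(v := a)) us' ! k" using k len by simp
      qed (simp add: len)
      then show "R (map (\<alpha>(v := a)) us)" using us'(3) by metis
    next
      assume "R (map (\<alpha>(v := a)) us)"
      then show "P (map h us)" unfolding P_def using us(2) by blast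
    qed
    finally show ?thesis by simp
  qed
  then show ?thesis using same_pattern_fresh[OF old v False x(2)] x(1) by blast
qed

text \<open>Quantifier elimination in semantic form. The quantifier case is one forth step over the
  finitely many free variables, and the symmetry of \<open>same_pattern\<close> supplies the back
  direction.\<close>

lemma generic_sat_cong:
  assumes gen: "generic D R m \<kappa>"
  shows "wf_fm (rel_lang r m) \<phi> \<Longrightarrow> same_pattern R m (fv \<phi>) \<alpha> \<beta> \<Longrightarrow> \<alpha> ` fv \<phi> \<subseteq> D \<Longrightarrow> \<beta> ` fv \<phi> \<subseteq> D \<Longrightarrow>
    sat (rel_struct D R) \<alpha> \<phi> = sat (rel_struct D R) \<beta> \<phi>"
proof (induction \<phi> arbitrary: \<alpha> \<beta>)
  case (Eq s t)
  then obtain u v where "s = Var u" "t = Var v" by (auto simp: wf_tm_rel_lang)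
  then show ?case using Eq.prems(2) unfolding same_pattern_def by simp
next
  case (Rel r' ts)
  then have "\<forall>t\<in>set ts. \<exists>v. t = Var v" and len: "length ts = m" by (auto simp: wf_tm_rel_lang list_all_iff)
  then obtain v where v: "\<And>t. t \<in> set ts \<Longrightarrow> t = Var (v t)" by metis
  have ev: "map (eval (rel_struct D R) \<gamma>) ts = map \<gamma> (map v ts)" for \<gamma>
    using v by (auto intro!: map_cong) (metis eval.simps(1))
  have "fv_tm t = {v t}" if "t \<in> set ts" for t using v[OF that] by (metis fv_tm.simps(1))
  then have "set (map v ts) \<subseteq> fv (Rel r' ts)" by auto
  moreover have "length (map v ts) = m" using len by simp
  ultimately have "R (map \<alpha> (map v ts)) = R (map \<beta> (map v ts))"
    using Rel.prems(2) unfolding same_pattern_def by blast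
  then show ?case unfolding sat.simps ev rel_simps .
next
  case (Neg \<phi>)
  then show ?case by simp
next
  case (Conj \<phi> \<psi>)
  have "sat (rel_struct D R) \<alpha> \<phi> = sat (rel_struct D R) \<beta> \<phi>"
    by (rule Conj.IH(1)) (use Conj.prems same_pattern_mono[OF Conj.prems(2)] in auto)
  moreover have "sat (rel_struct D R) \<alpha> \<psi> = sat (rel_struct D R) \<beta> \<psi>"
    by (rule Conj.IH(2)) (use Conj.prems same_pattern_mono[OF Conj.prems(2)] in auto)
  ultimately show ?case by simp
next
  case (Ex v \<phi>)
  have one: "sat (rel_struct D R) \<beta> (Ex v \<phi>)"
    if sat: "sat (rel_struct D R) \<alpha> (Ex v \<phi>)" and pat: "same_pattern R m (fv (Ex v \<phi>)) \<alpha> \<beta>"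
      and D: "\<alpha> ` fv (Ex v \<phi>) \<subseteq> D" "\<beta> ` fv (Ex v \<phi>) \<subseteq> D" for \<alpha> \<beta>
  proof -
    obtain a where a: "a \<in> D" "sat (rel_struct D R) (\<alpha>(v := a)) \<phi>" using sat by auto
    have "|\<beta> ` fv (Ex v \<phi>)| <o \<kappa>" by (rule generic_finite[OF gen]) simp
    then obtain b where b: "b \<in> D" "same_pattern R m (insert v (fv (Ex v \<phi>))) (\<alpha>(v := a)) (\<beta>(v := b))"
      using same_pattern_extend[OF gen pat _ D(2), of v a] by auto
    have "sat (rel_struct D R) (\<alpha>(v := a)) \<phi> = sat (rel_struct D R) (\<beta>(v := b)) \<phi>"
    proof (rule Ex.IH)
      show "wf_fm (rel_lang r m) \<phi>" using Ex.prems by simp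
      show "same_pattern R m (fv \<phi>) (\<alpha>(v := a)) (\<beta>(v := b))"
        by (rule same_pattern_mono[OF b(2)]) auto
      show "(\<alpha>(v := a)) ` fv \<phi> \<subseteq> D" "(\<beta>(v := b)) ` fv \<phi> \<subseteq> D" using D a(1) b(1) by auto
    qed
    then show ?thesis using a(2) b(1) by auto
  qed
  show ?case
    using one[OF _ Ex.prems(2-4)] one[OF _ same_pattern_sym[OF Ex.prems(2)] Ex.prems(4,3)] by blast
qed

text \<open>The finite parts of \<open>p\<close> have realisations; a limit of their quantifier-free
  behaviours over \<open>A\<close> is attained by an element of \<open>D\<close>, and quantifier
  elimination shows that this element realises \<open>p\<close>.\<close>

lemma generic_saturated:
  fixes D :: "'a set"
  assumes gen: "generic D R m \<kappa>"
  shows "saturated (rel_lang r m :: ('f, 'r) language) \<kappa> (rel_struct D R)"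
  unfolding saturated_def rel_simps
proof (intro allI impI, elim conjE)
  let ?M = "rel_struct D R :: ('f, 'r, 'a) struct"
  fix A p
  assume A: "A \<subseteq> D" "|A| <o \<kappa>" and p: "p \<subseteq> fms_over (rel_lang r m) A"
    and fin: "\<forall>q. finite q \<and> q \<subseteq> p \<longrightarrow> (\<exists>c\<in>D. realises ?M c q)"
  obtain c where c: "\<And>q. finite q \<Longrightarrow> q \<subseteq> p \<Longrightarrow> c q \<in> D \<and> realises ?M (c q) q"
    using fin by metis
  \<comment> \<open>The quantifier-free behaviour of \<open>c q\<close>: which element it equals,
    and how \<open>R\<close> acts on patterns whose holes it fills.\<close>
  define h where "h q y = (case y of Inl a \<Rightarrow> c q = a | Inr ys \<Rightarrow> R (map (case_option (c q) id) ys))" for q y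
  obtain g where g: "\<And>Y q. finite Y \<Longrightarrow> finite q \<Longrightarrow> q \<subseteq> p \<Longrightarrow>
      \<exists>q'. finite q' \<and> q \<subseteq> q' \<and> q' \<subseteq> p \<and> (\<forall>y\<in>Y. h q' y = g y)"
    by (rule finite_subsets_limit[of p h]) (rule that)
  show "\<exists>c\<in>D. realises ?M c p"
  \<comment> \<open>If the limit is equal to a parameter, then that parameter realises
    \<open>p\<close>; otherwise a new element with the limit pattern is taken.\<close>
  proof (cases "\<exists>a\<in>A. g (Inl a)")
    case True
    then obtain a where a: "a \<in> A" "g (Inl a)" by blast
    have "sat ?M (\<rho>(0 := a)) \<phi>" if \<phi>: "(\<phi>, \<rho>) \<in> p" for \<phi> \<rho>
    proof -
      obtain q where q: "finite q" "{(\<phi>, \<rho>)} \<subseteq> q" "q \<subseteq> p" "\<forall>y\<in>{Inl a}. h q y = g y"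
        using g[of "{Inl a}" "{(\<phi>, \<rho>)}"] \<phi> by auto
      have "c q = a" using q(4) a(2) unfolding h_def by simp
      then show ?thesis using c[OF q(1,3)] q(2) unfolding realises_def by auto
    qed
    then show ?thesis using a(1) A(1) unfolding realises_def by blast
  next
    case False
    obtain x where x: "x \<in> D" "x \<notin> A" and R: "\<And>ys. length ys = m \<Longrightarrow> set ys \<subseteq> insert None (Some ` A) \<Longrightarrow>
        None \<in> set ys \<Longrightarrow> R (map (case_option x id) ys) = g (Inr ys)"
      by (rule genericE[OF gen A, where P = "\<lambda>ys. g (Inr ys)"]) (rule that)
    have "sat ?M (\<rho>(0 := x)) \<phi>" if \<phi>: "(\<phi>, \<rho>) \<in> p" for \<phi> \<rho>
    proof -
      let ?F = "fv \<phi> - {0}"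
      have wf: "wf_fm (rel_lang r m) \<phi>" and \<rho>: "\<rho> ` ?F \<subseteq> A" using p \<phi> unfolding fms_over_def by auto
      \<comment> \<open>Over its parameters \<phi> can distinguish only finitely many equalities and
        patterns, so some finite \<open>q\<close> containing the formula agrees with
        \<open>g\<close> on all of them.\<close>
      let ?Z = "{ys. set ys \<subseteq> insert None (Some ` \<rho> ` ?F) \<and> length ys = m}"
      have "finite ?Z" by (rule finite_lists_length_eq) simp
      then have "finite (Inl ` \<rho> ` ?F \<union> Inr ` ?Z)" by simp
      then obtain q where q: "finite q" "{(\<phi>, \<rho>)} \<subseteq> q" "q \<subseteq> p"
        and hg: "\<forall>y\<in>Inl ` \<rho> ` ?F \<union> Inr ` ?Z. h q y = g y"
        using g[OF \<open>finite (Inl ` \<rho> ` ?F \<union> Inr ` ?Z)\<close>, of "{(\<phi>, \<rho>)}"] \<phi> by auto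
      have cq: "c q \<in> D" "sat ?M (\<rho>(0 := c q)) \<phi>" using c[OF q(1,3)] q(2) unfolding realises_def by auto
      have cF: "c q \<notin> \<rho> ` ?F"
      proof
        assume "c q \<in> \<rho> ` ?F"
        then have "h q (Inl (c q)) = g (Inl (c q))" "c q \<in> A" using hg \<rho> by blast+
        then show False using False unfolding h_def by simp
      qed
      have "same_pattern R m (insert 0 ?F) (\<rho>(0 := c q)) (\<rho>(0 := x))"
      proof (rule same_pattern_fresh)
        show "same_pattern R m ?F \<rho> \<rho>" unfolding same_pattern_def by simp
        show "x \<notin> \<rho> ` ?F" using x(2) \<rho> by blast
        fix us assume us: "length us = m" "set us \<subseteq> insert 0 ?F" "0 \<in> set us"
        let ?ys = "map (\<lambda>u. if u = 0 then None else Some (\<rho> u)) us"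
        have eq: "map (\<rho>(0 := y)) us = map (case_option y id) ?ys" for y by auto
        have ys: "set ?ys \<subseteq> insert None (Some ` \<rho> ` ?F)" "length ?ys = m" "None \<in> set ?ys"
          using us by force+
        have "R (map (case_option x id) ?ys) = g (Inr ?ys)"
          by (rule R) (use ys \<rho> in blast)+
        moreover have "h q (Inr ?ys) = g (Inr ?ys)" using hg ys by blast
        ultimately have "R (map (case_option (c q) id) ?ys) = R (map (case_option x id) ?ys)"
          unfolding h_def by simp
        then show "R (map (\<rho>(0 := c q)) us) = R (map (\<rho>(0 := x)) us)" unfolding eq .
      qed (use cF in auto)
      then have "same_pattern R m (fv \<phi>) (\<rho>(0 := c q)) (\<rho>(0 := x))"
        by (rule same_pattern_mono) auto
      then have "sat ?M (\<rho>(0 := c q)) \<phi> = sat ?M (\<rho>(0 := x)) \<phi>"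
        by (rule generic_sat_cong[OF gen wf]) (use cq x A \<rho> in auto)
      then show ?thesis using cq(2) by blast
    qed
    then show ?thesis using x(1) unfolding realises_def by blast
  qed
qed

text \<open>Atomic formulas turn an elementary map into an equality of patterns, one forth step adds
  \<open>a\<close>, and quantifier elimination makes the extended map elementary again.\<close>

lemma generic_homogeneous:
  fixes D :: "'a set"
  assumes gen: "generic D R m \<kappa>"
  shows "homogeneous (rel_lang r m :: ('f, 'r) language) \<kappa> (rel_struct D R)"
  unfolding homogeneous_def
proof (intro allI impI ballI, elim conjE)
  let ?L = "rel_lang r m :: ('f, 'r) language" and ?M = "rel_struct D R :: ('f, 'r, 'a) struct"
  fix A g a
  assume small: "|A| <o \<kappa>" and pe: "partial_elementary ?L ?M A g" and a: "a \<in> univ ?M"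
  have A: "A \<subseteq> D" "g ` A \<subseteq> D" using pe unfolding partial_elementary_def by auto
  have sat_g: "sat ?M \<rho> \<phi> = sat ?M (g \<circ> \<rho>) \<phi>" if "wf_fm ?L \<phi>" "\<rho> ` fv \<phi> \<subseteq> A" for \<rho> and \<phi> :: "('f, 'r, nat) fm"
    using pe that unfolding partial_elementary_def by blast
  have pat: "same_pattern R m A (\<lambda>x. x) g"
    unfolding same_pattern_def
  proof (intro conjI ballI allI impI)
    fix u v assume "u \<in> A" "v \<in> A"
    then show "u = v \<longleftrightarrow> g u = g v"
      using sat_g[of "Eq (Var 0) (Var 1)" "\<lambda>k. if k = 0 then u else v"] by auto
  next
    fix us assume us: "length us = m \<and> set us \<subseteq> A"
    let ?\<phi> = "Rel r (map Var [0..<m])"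
    have "sat ?M (\<lambda>k. us ! k) ?\<phi> = sat ?M (g \<circ> (\<lambda>k. us ! k)) ?\<phi>"
      by (rule sat_g) (use us in \<open>auto simp: list_all_iff subset_iff\<close>)
    moreover have "sat ?M \<gamma> ?\<phi> = R (map \<gamma> [0..<m])" for \<gamma> by (simp add: comp_def)
    moreover have enum: "map (\<lambda>k. us ! k) [0..<m] = us" using us map_nth by blast
    moreover have "map (g \<circ> (\<lambda>k. us ! k)) [0..<m] = map g us" by (simp only: map_map[symmetric] enum)
    ultimately show "R (map (\<lambda>x. x) us) = R (map g us)" by simp
  qed
  have "\<exists>h. (\<forall>x\<in>A. h x = g x) \<and> h a \<in> D \<and> same_pattern R m (insert a A) (\<lambda>x. x) h"
  proof (cases "a \<in> A")
    case True
    then show ?thesis using pat A by (intro exI[of _ g]) (auto simp: insert_absorb)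
  next
    case False
    have "|g ` A| <o \<kappa>" using card_of_image small ordLeq_ordLess_trans by blast
    from same_pattern_extend[OF gen pat False A(2) this, of a]
    obtain b where "b \<in> D" "same_pattern R m (insert a A) ((\<lambda>x. x)(a := a)) (g(a := b))" by blast
    then show ?thesis using False by (intro exI[of _ "g(a := b)"]) (auto simp: fun_upd_idem)
  qed
  then obtain h where h: "\<forall>x\<in>A. h x = g x" "h a \<in> D" "same_pattern R m (insert a A) (\<lambda>x. x) h" by blast
  have hD: "h ` insert a A \<subseteq> D" using h(1,2) A(2) by auto
  have "sat ?M \<rho> \<phi> = sat ?M (h \<circ> \<rho>) \<phi>" if "wf_fm ?L \<phi>" "\<rho> ` fv \<phi> \<subseteq> insert a A" for \<rho> and \<phi> :: "('f, 'r, nat) fm"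
  proof (rule generic_sat_cong[OF gen that(1)])
    show "same_pattern R m (fv \<phi>) \<rho> (h \<circ> \<rho>)"
      using same_pattern_comp[OF h(3) that(2)] by (simp add: comp_def)
    show "\<rho> ` fv \<phi> \<subseteq> D" using that(2) A(1) a by auto
    show "(h \<circ> \<rho>) ` fv \<phi> \<subseteq> D" using that(2) hD by fastforce
  qed
  then have "partial_elementary ?L ?M (insert a A) h"
    using A(1) a hD unfolding partial_elementary_def by auto
  then show "\<exists>h. partial_elementary ?L ?M (insert a A) h \<and> (\<forall>x\<in>A. h x = g x)" using h(1) by blast
qed

text \<open>Points of \<open>X\<close> are added one at a time, each to a generic element with the
  prescribed relation to the earlier ones. Positive arity is essential: \<open>R\<close> has a fixed
  value at the empty list.\<close>

lemma generic_embedding: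
  fixes P :: "'i list \<Rightarrow> bool"
  assumes gen: "generic D R m \<kappa>" and "m > 0" and small: "|X| <o \<kappa>"
  shows "\<exists>a. a ` X \<subseteq> D \<and> (\<forall>ns. length ns = m \<and> set ns \<subseteq> X \<longrightarrow> R (map a ns) = P ns)"
proof -
  define Q where "Q g \<longleftrightarrow> (\<forall>u\<in>dom g. the (g u) \<in> D) \<and> (\<forall>u\<in>dom g. \<forall>v\<in>dom g. g u = g v \<longrightarrow> u = v) \<and>
    (\<forall>ns. length ns = m \<and> set ns \<subseteq> dom g \<longrightarrow> R (map (\<lambda>n. the (g n)) ns) = P ns)" for g :: "'i \<rightharpoonup> 'a"
  have "\<exists>g. dom g = X \<and> Q g"
  proof (rule finite_character_total)
    fix g assume fin: "\<And>Y. finite Y \<Longrightarrow> Q (g |` Y)"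
    show "Q g" unfolding Q_def
    proof (intro conjI ballI allI impI)
      fix u assume "u \<in> dom g"
      then show "the (g u) \<in> D" using fin[of "{u}"] unfolding Q_def by auto
    next
      fix u v assume uv: "u \<in> dom g" "v \<in> dom g" "g u = g v"
      have "u \<in> dom (g |` {u, v})" "v \<in> dom (g |` {u, v})" using uv by auto
      moreover have "(g |` {u, v}) u = (g |` {u, v}) v" using uv(3) by simp
      moreover have "Q (g |` {u, v})" by (rule fin) simp
      ultimately show "u = v" unfolding Q_def by blast
    next
      fix ns assume ns: "length ns = m \<and> set ns \<subseteq> dom g"
      then have "R (map (\<lambda>n. the ((g |` set ns) n)) ns) = P ns"
        using fin[of "set ns"] unfolding Q_def by auto
      moreover have "map (\<lambda>n. the ((g |` set ns) n)) ns = map (\<lambda>n. the (g n)) ns" by simp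
      ultimately show "R (map (\<lambda>n. the (g n)) ns) = P ns" by metis
    qed
  next
    fix g Y assume Q: "Q g"
    show "Q (g |` Y)" unfolding Q_def
    proof (intro conjI ballI allI impI)
      fix ns assume ns: "length ns = m \<and> set ns \<subseteq> dom (g |` Y)"
      then have "R (map (\<lambda>n. the (g n)) ns) = P ns" using Q unfolding Q_def by auto
      moreover have "map (\<lambda>n. the ((g |` Y) n)) ns = map (\<lambda>n. the (g n)) ns" using ns by auto
      ultimately show "R (map (\<lambda>n. the ((g |` Y) n)) ns) = P ns" by metis
    qed (use Q in \<open>auto simp: Q_def\<close>)
  next
    show "Q Map.empty" using assms(2) unfolding Q_def by auto
  next
    fix g x assume Q: "Q g" and X: "dom g \<subseteq> X" "x \<in> X" "x \<notin> dom g"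
    define A where "A = (\<lambda>u. the (g u)) ` dom g"
    have "A \<subseteq> D" using Q unfolding A_def Q_def by auto
    moreover have "|A| <o \<kappa>"
      using ordLeq_ordLess_trans[OF ordLeq_transitive[OF card_of_image card_of_mono1[OF X(1)]] small]
      unfolding A_def .
    \<comment> \<open>Decoding of patterns: a hole stands for the point \<open>x\<close> being
      added, any other entry for its preimage. Injectivity, built into \<open>Q\<close>, makes the
      preimage unique.\<close>
    define unpat where "unpat = (\<lambda>y. case y of None \<Rightarrow> x | Some d \<Rightarrow> inv_into (dom g) (\<lambda>u. the (g u)) d)"
    have inj: "inj_on (\<lambda>u. the (g u)) (dom g)"
      using Q unfolding Q_def inj_on_def by (metis domD option.sel)
    obtain y where y: "y \<in> D" "y \<notin> A" and R: "\<And>ys. length ys = m \<Longrightarrow> set ys \<subseteq> insert None (Some ` A) \<Longrightarrow>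
        None \<in> set ys \<Longrightarrow> R (map (case_option y id) ys) = P (map unpat ys)"
      by (rule genericE[OF gen \<open>A \<subseteq> D\<close> \<open>|A| <o \<kappa>\<close>, where P = "\<lambda>ys. P (map unpat ys)"]) (rule that)
    have "Q (g(x \<mapsto> y))" unfolding Q_def
    proof (intro conjI ballI allI impI)
      fix u assume "u \<in> dom (g(x \<mapsto> y))"
      then show "the ((g(x \<mapsto> y)) u) \<in> D" using Q y(1) unfolding Q_def by auto
    next
      fix u v assume uv: "u \<in> dom (g(x \<mapsto> y))" "v \<in> dom (g(x \<mapsto> y))" "(g(x \<mapsto> y)) u = (g(x \<mapsto> y)) v"
      have "g w \<noteq> Some y" for w using y(2) unfolding A_def by (force simp: dom_def)
      then show "u = v" using uv Q unfolding Q_def by (auto split: if_splits)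
    next
      fix ns assume ns: "length ns = m \<and> set ns \<subseteq> dom (g(x \<mapsto> y))"
      show "R (map (\<lambda>n. the ((g(x \<mapsto> y)) n)) ns) = P ns"
      proof (cases "x \<in> set ns")
        case False
        then have "map (\<lambda>n. the ((g(x \<mapsto> y)) n)) ns = map (\<lambda>n. the (g n)) ns" by auto
        moreover have "set ns \<subseteq> dom g" using ns False by auto
        ultimately show ?thesis using Q ns unfolding Q_def by metis
      next
        case True
        let ?ys = "map (\<lambda>n. if n = x then None else g n) ns"
        have 1: "set ?ys \<subseteq> insert None (Some ` A)" using ns unfolding A_def by (force simp: dom_def)
        have 2: "None \<in> set ?ys" using True by force
        have 3: "map (\<lambda>n. the ((g(x \<mapsto> y)) n)) ns = map (case_option y id) ?ys"
          using ns by (auto split: option.splits)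
        have 4: "map unpat ?ys = ns"
        proof (rule trans[OF _ map_idI], unfold map_map)
          show "map (unpat \<circ> (\<lambda>n. if n = x then None else g n)) ns = map (\<lambda>n. n) ns"
          proof (rule map_cong[OF refl])
            fix n assume "n \<in> set ns"
            then have "n = x \<or> n \<in> dom g" using ns by auto
            then show "(unpat \<circ> (\<lambda>n. if n = x then None else g n)) n = n"
              using inv_into_f_f[OF inj] unfolding unpat_def by fastforce
          qed
        qed simp
        show ?thesis using R[OF _ 1 2] ns unfolding 3 4 by simp
      qed
    qed
    then show "\<exists>y. Q (g(x \<mapsto> y))" by blast
  qed
  then obtain g where g: "dom g = X" "Q g" by blast
  then show ?thesis unfolding Q_def by (intro exI[of _ "\<lambda>n. the (g n)"]) auto
qed

section \<open>Existence of generic structures\<close>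

lemma card_of_lists_length_le:
  assumes inf: "infinite B" and A: "|A| \<le>o |B|"
  shows "|{xs. length xs = n \<and> set xs \<subseteq> A}| \<le>o |B|"
proof (induction n)
  case 0
  have "{xs. length xs = 0 \<and> set xs \<subseteq> A} = {[]}" by auto
  then show ?case using inf by (metis card_of_singl_ordLeq finite.emptyI)
next
  case (Suc n)
  have "{xs. length xs = Suc n \<and> set xs \<subseteq> A} \<subseteq> (\<lambda>(x, xs). x # xs) ` (A \<times> {xs. length xs = n \<and> set xs \<subseteq> A})"
    (is "?l \<subseteq> ?f ` ?r")
  proof
    fix xs assume "xs \<in> ?l"
    then show "xs \<in> ?f ` ?r" by (cases xs) auto
  qed
  then have "|?l| \<le>o |?r|" by (rule surj_imp_ordLeq)
  moreover have "|?r| \<le>o |B|" by (rule card_of_Sigma_ordLeq_infinite[OF inf A]) (use Suc.IH in blast)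
  ultimately show ?case by (rule ordLeq_transitive)
qed

lemma card_of_insert_None_le:
  fixes A :: "'a set"
  assumes inf: "infinite B" and A: "|A| \<le>o |B|"
  shows "|insert None (Some ` A)| \<le>o |B|"
proof -
  have "|{None :: 'a option} \<union> Some ` A| \<le>o |B|"
    using inf A card_of_singl_ordLeq[of B None] ordLeq_transitive[OF card_of_image A]
    by (intro card_of_Un_ordLeq_infinite_Field) (auto simp: Field_card_of card_of_card_order_on)
  then show ?thesis by simp
qed

text \<open>For infinite \<Lambda>, the power 2^|\<Lambda>| raised to |\<Lambda>| has exponent
  |\<Lambda>| times |\<Lambda>|, which is |\<Lambda>| again.\<close>

lemma card_of_Func_le_Pow:
  assumes inf: "infinite \<Lambda>" and Y: "|Y| \<le>o |Pow \<Lambda>|"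
  shows "|Func \<Lambda> Y| \<le>o |Pow \<Lambda>|"
proof -
  have pow: "|Pow \<Lambda>| =o ctwo ^c |\<Lambda>|"
    unfolding ctwo_def cexp_def Field_card_of by (rule card_of_Pow_Func)
  have \<Lambda>: "Cinfinite |\<Lambda>|" using inf by (simp add: cinfinite_def Field_card_of card_of_card_order_on)
  have "|Func \<Lambda> Y| =o |Y| ^c |\<Lambda>|" unfolding cexp_def Field_card_of by (rule card_of_refl)
  also have "|Y| ^c |\<Lambda>| \<le>o (ctwo ^c |\<Lambda>| ) ^c |\<Lambda>|"
    by (rule cexp_mono1[OF ordLeq_ordIso_trans[OF Y pow] card_of_Card_order])
  also have "(ctwo ^c |\<Lambda>| ) ^c |\<Lambda>| =o ctwo ^c ( |\<Lambda>| *c |\<Lambda>| )"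
    by (rule cexp_cprod) (rule Card_order_ctwo)
  also have "ctwo ^c ( |\<Lambda>| *c |\<Lambda>| ) =o ctwo ^c |\<Lambda>|"
    by (rule cexp_cong2[OF cprod_infinite[OF \<Lambda>] Card_order_ctwo Card_order_cprod])
  also have "ctwo ^c |\<Lambda>| =o |Pow \<Lambda>|" using pow by (rule ordIso_symmetric)
  finally show ?thesis .
qed

lemma regular_bounded:
  assumes reg: "regularCard \<kappa>" and \<kappa>: "Card_order \<kappa>" "infinite (Field \<kappa>)"
    and K: "K \<subseteq> Field \<kappa>" "|K| <o \<kappa>"
  shows "\<exists>w\<in>Field \<kappa>. \<forall>k\<in>K. (k, w) \<in> \<kappa> \<and> k \<noteq> w"
proof -
  have wo: "Well_order \<kappa>" using \<kappa>(1) by (rule card_order_on_well_order_on)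
  have "\<not> cofinal K \<kappa>"
    using reg K not_ordLess_ordIso unfolding regularCard_def by blast
  then obtain v where v: "v \<in> Field \<kappa>" "\<And>k. k \<in> K \<Longrightarrow> v = k \<or> (v, k) \<notin> \<kappa>"
    unfolding cofinal_def by blast
  \<comment> \<open>\<open>v\<close> bounds \<open>K\<close> only weakly; an infinite cardinal has
    no last element, and going beyond \<open>v\<close> makes the bound strict.\<close>
  obtain w where w: "w \<in> Field \<kappa>" "v \<noteq> w" "(v, w) \<in> \<kappa>"
    using infinite_Card_order_limit[OF \<kappa> v(1)] by blast
  have "(k, w) \<in> \<kappa> \<and> k \<noteq> w" if k: "k \<in> K" for k
  proof -
    have "k = v \<or> (k, v) \<in> \<kappa>"
      using v(1) v(2)[OF k] k K(1) wo
      unfolding well_order_on_def linear_order_on_def total_on_def by blast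
    then show "(k, w) \<in> \<kappa> \<and> k \<noteq> w"
    proof -
      have tr: "trans \<kappa>" and an: "antisym \<kappa>" using wo
        unfolding well_order_on_def linear_order_on_def partial_order_on_def preorder_on_def by blast+
      assume "k = v \<or> (k, v) \<in> \<kappa>"
      then show "(k, w) \<in> \<kappa> \<and> k \<noteq> w" using w(2,3) transD[OF tr] antisymD[OF an] by blast
    qed
  qed
  then show ?thesis using w(1) by blast
qed

text \<open>An element \<open>x\<close> carries a rank below \<open>\<kappa> = |\<Lambda>|\<^sup>+\<close> and a code \<open>E x\<close>, a set of at most \<open>|\<Lambda>|\<close>
  patterns; \<open>R\<close> holds of a list when the code of its element of largest rank says so. There are
  only \<open>2\<^bsup>|\<Lambda>|\<^esup>\<close> codes, and the rank of a new element can exceed those of all its parameters since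
  \<open>\<kappa>\<close> is regular.\<close>

lemma ex_generic:
  assumes inf: "infinite (\<Lambda> :: 'l set)" and large: "|Pow \<Lambda>| \<le>o |UNIV :: 'u set|"
  shows "\<exists>(D :: 'u set) R (\<kappa> :: 'u rel). generic D R m \<kappa> \<and> |\<Lambda>| <o \<kappa>"
proof -
  obtain D :: "'u set" where D: "|Pow \<Lambda>| =o |D|"
    using iffD1[OF internalize_card_of_ordLeq2 large] by blast
  have Pow_D: "|X| \<le>o |Pow \<Lambda>| \<Longrightarrow> |X| \<le>o |D|" for X :: "'x set"
    using D ordLeq_ordIso_trans by blast
  have infPow: "infinite (Pow \<Lambda>)" using inf by simp
  \<comment> \<open>The successor of |\<Lambda>| is at most 2^|\<Lambda>|, so it is represented by a
    relation on \<open>'u\<close>, as the statement requires; successors of infinite cardinals are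
    regular.\<close>
  have suc: "cardSuc |\<Lambda>| \<le>o |Pow \<Lambda>|"
    by (rule cardSuc_least) (simp_all add: card_of_Pow card_of_Card_order)
  then obtain \<kappa> :: "'u rel" where \<kappa>: "cardSuc |\<Lambda>| =o \<kappa>" "\<kappa> \<le>o |D|"
    using internalize_ordLeq[of "cardSuc |\<Lambda>|" "|D|"] ordLeq_ordIso_trans[OF _ D] by blast
  have \<Lambda>: "Cinfinite |\<Lambda>|" using inf by (simp add: cinfinite_def Field_card_of card_of_card_order_on)
  have CO: "Card_order \<kappa>"
    using Card_order_ordIso2[OF cardSuc_Card_order[OF card_of_Card_order] \<kappa>(1)] .
  have less: "|\<Lambda>| <o \<kappa>"
    using ordLess_ordIso_trans[OF cardSuc_greater[OF card_of_Card_order] \<kappa>(1)] .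
  have infK: "infinite (Field \<kappa>)"
    using Cinfinite_cong[OF \<kappa>(1) Cinfinite_cardSuc[OF \<Lambda>]] by (simp add: cinfinite_def)
  have reg: "regularCard \<kappa>"
    by (rule regularCard_ordIso[OF \<kappa>(1) Cinfinite_cardSuc[OF \<Lambda>] regularCard_cardSuc[OF \<Lambda>]])
  have small: "|A| \<le>o |\<Lambda>|" if "|A| <o \<kappa>" for A :: "'u set"
    using ordLess_ordIso_trans[OF that ordIso_symmetric[OF \<kappa>(1)]] cardSuc_ordLeq_ordLess[of "|\<Lambda>|" "|A|"]
    by (simp add: card_of_Card_order)
  define lst where "lst A = {ys. length ys = m \<and> set ys \<subseteq> insert None (Some ` A)}" for A :: "'u set"
  define Y where "Y = insert [] (lst D)"
  have DP: "|D| \<le>o |Pow \<Lambda>|" using D ordIso_iff_ordLeq by blast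
  have "|lst D| \<le>o |Pow \<Lambda>|"
    unfolding lst_def by (intro card_of_lists_length_le card_of_insert_None_le infPow DP)
  then have "|{[]} \<union> lst D| \<le>o |Pow \<Lambda>|"
    using infPow card_of_singl_ordLeq[of "Pow \<Lambda>" "[]"]
    by (intro card_of_Un_ordLeq_infinite_Field) (auto simp: Field_card_of card_of_card_order_on)
  then have Y: "|Y| \<le>o |Pow \<Lambda>|" unfolding Y_def by simp
  \<comment> \<open>Nonempty sets of size at most |\<Lambda>| are images of functions on \<Lambda>,
    which bounds the number of codes.\<close>
  define codes where "codes = {E. E \<subseteq> Y \<and> E \<noteq> {} \<and> |E| \<le>o |\<Lambda>|}"
  have "codes \<subseteq> (\<lambda>f. f ` \<Lambda>) ` Func \<Lambda> Y"
  proof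
    fix E assume "E \<in> codes"
    then have E: "E \<subseteq> Y" "E \<noteq> {}" "|E| \<le>o |\<Lambda>|" unfolding codes_def by auto
    obtain f where f: "f ` \<Lambda> = E" using E(2,3) card_of_ordLeq2[of E \<Lambda>] by blast
    let ?g = "\<lambda>x. if x \<in> \<Lambda> then f x else undefined"
    have "?g \<in> Func \<Lambda> Y" using f E(1) unfolding Func_def by auto
    moreover have "E = ?g ` \<Lambda>" using f by auto
    ultimately show "E \<in> (\<lambda>f. f ` \<Lambda>) ` Func \<Lambda> Y" by blast
  qed
  then have "|codes| \<le>o |Func \<Lambda> Y|" by (rule surj_imp_ordLeq)
  then have "|codes| \<le>o |Pow \<Lambda>|" using card_of_Func_le_Pow[OF inf Y] ordLeq_transitive by blast
  moreover have "|Field \<kappa>| \<le>o |Pow \<Lambda>|"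
    using ordIso_ordLeq_trans[OF card_of_Field_ordIso[OF CO] ordLeq_transitive[OF \<kappa>(2) DP]] .
  ultimately have "|codes \<times> Field \<kappa>| \<le>o |Pow \<Lambda>|"
    by (intro card_of_Sigma_ordLeq_infinite[OF infPow]) auto
  then have le: "|codes \<times> Field \<kappa>| \<le>o |D|" by (rule Pow_D)
  obtain l0 where l0: "l0 \<in> \<Lambda>" using inf by (metis finite.emptyI ex_in_conv)
  have "\<Lambda> \<noteq> {}" using l0 by blast
  then have "{[]} \<in> codes" unfolding codes_def Y_def using card_of_singl_ordLeq[of \<Lambda> "[]"] by auto
  moreover have "Field \<kappa> \<noteq> {}" using infK by auto
  ultimately have "codes \<times> Field \<kappa> \<noteq> {}" by blast
  \<comment> \<open>Surjectivity is the point: every combination of a code and a rank belongs to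
    some element of \<open>D\<close>.\<close>
  then obtain F where F: "F ` D = codes \<times> Field \<kappa>" using le card_of_ordLeq2 by metis
  define E where "E x = fst (F x)" for x
  define rk where "rk x = snd (F x)" for x
  define lt where "lt x y \<longleftrightarrow> (rk x, rk y) \<in> \<kappa> \<and> rk x \<noteq> rk y" for x y
  have "antisym \<kappa>" using card_order_on_well_order_on[OF CO]
    unfolding well_order_on_def linear_order_on_def partial_order_on_def by blast
  then have lt_asym: "lt x y \<Longrightarrow> \<not> lt y x" for x y unfolding lt_def by (metis antisymD)
  define hole where "hole y z = (if z = y then None else Some z)" for y z :: 'u
  define R where "R xs \<longleftrightarrow> (\<exists>y\<in>set xs. (\<forall>z\<in>set xs. z \<noteq> y \<longrightarrow> lt z y) \<and> map (hole y) xs \<in> E y)" for xs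
  have "\<exists>x\<in>D - A. \<forall>ys. length ys = m \<and> set ys \<subseteq> insert None (Some ` A) \<and> None \<in> set ys \<longrightarrow>
      R (map (case_option x id) ys) = P ys" if A: "A \<subseteq> D" "|A| <o \<kappa>" for A P
  proof -
    have "rk ` A \<subseteq> Field \<kappa>"
    proof
      fix w assume "w \<in> rk ` A"
      then obtain a where "a \<in> A" "w = rk a" by blast
      moreover from this have "F a \<in> codes \<times> Field \<kappa>" using F A(1) by blast
      ultimately show "w \<in> Field \<kappa>" unfolding rk_def by (simp add: mem_Times_iff)
    qed
    moreover have "|rk ` A| <o \<kappa>" using card_of_image A(2) ordLeq_ordLess_trans by blast
    ultimately obtain w where w: "w \<in> Field \<kappa>" "\<And>a. a \<in> A \<Longrightarrow> (rk a, w) \<in> \<kappa> \<and> rk a \<noteq> w"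
      using regular_bounded[OF reg CO infK] by (metis imageI)
    \<comment> \<open>The code requested for the new element. The additional \<open>[]\<close> keeps
      it nonempty and is never consulted, because a pattern containing \<open>None\<close> is not
      empty.\<close>
    define E0 where "E0 = insert [] {ys \<in> lst A. P ys}"
    have "|lst A| \<le>o |\<Lambda>|"
      unfolding lst_def by (intro card_of_lists_length_le card_of_insert_None_le inf small A(2))
    then have "|{ys \<in> lst A. P ys}| \<le>o |\<Lambda>|"
      by (rule ordLeq_transitive[OF card_of_mono1, rotated]) auto
    then have "|{[]} \<union> {ys \<in> lst A. P ys}| \<le>o |\<Lambda>|"
      using inf card_of_singl_ordLeq[OF \<open>\<Lambda> \<noteq> {}\<close>, of "[]"]
      by (intro card_of_Un_ordLeq_infinite_Field) (auto simp: Field_card_of card_of_card_order_on)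
    then have "|E0| \<le>o |\<Lambda>|" unfolding E0_def by simp
    moreover have "E0 \<subseteq> Y" unfolding E0_def Y_def lst_def using A(1) by blast
    ultimately have "(E0, w) \<in> codes \<times> Field \<kappa>" using w(1) unfolding codes_def E0_def by auto
    then obtain x where x: "x \<in> D" "F x = (E0, w)" using F by (metis imageE)
    have Ex: "E x = E0" "rk x = w" using x(2) unfolding E_def rk_def by auto
    have xA: "x \<notin> A" using w(2) Ex(2) by blast
    have lt: "lt a x" if "a \<in> A" for a using w(2)[OF that] unfolding lt_def Ex(2) by simp
    have "R (map (case_option x id) ys) = P ys"
      if ys: "length ys = m" "set ys \<subseteq> insert None (Some ` A)" "None \<in> set ys" for ys
    proof -
      let ?xs = "map (case_option x id) ys"
      have mem: "z = x \<or> z \<in> A" if "z \<in> set ?xs" for z using that ys(2) by auto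
      have xin: "x \<in> set ?xs" using ys(3) by force
      have hole: "map (hole x) ?xs = ys"
      proof -
        have "hole x (case_option x id y) = y" if "y \<in> set ys" for y
          using that ys(2) xA unfolding hole_def by (cases y) auto
        then show ?thesis by (auto intro: map_idI)
      qed
      have "R ?xs \<longleftrightarrow> map (hole x) ?xs \<in> E x"
      proof
        assume "R ?xs"
        then obtain y where y: "y \<in> set ?xs" "\<forall>z\<in>set ?xs. z \<noteq> y \<longrightarrow> lt z y" "map (hole y) ?xs \<in> E y"
          unfolding R_def by blast
        \<comment> \<open>Any other entry of the list is a parameter, whose rank lies below that of
          \<open>x\<close>; so only the code of \<open>x\<close> decides.\<close>
        have "y = x"
        proof (rule ccontr)
          assume "y \<noteq> x"
          then have "lt x y" using y(2) xin by metis
          moreover have "lt y x" using mem[OF y(1)] \<open>y \<noteq> x\<close> lt by blast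
          ultimately show False using lt_asym by blast
        qed
        then show "map (hole x) ?xs \<in> E x" using y(3) by simp
      next
        assume *: "map (hole x) ?xs \<in> E x"
        have "\<forall>z\<in>set ?xs. z \<noteq> x \<longrightarrow> lt z x" using mem lt by blast
        then show "R ?xs" unfolding R_def by (intro bexI[OF _ xin] conjI *)
      qed
      also have "\<dots> \<longleftrightarrow> P ys"
        unfolding hole Ex(1) E0_def using ys by (auto simp: lst_def)
      finally show ?thesis .
    qed
    then show ?thesis using x(1) xA by blast
  qed
  then have "generic D R m \<kappa>" unfolding generic_def using CO infK by blast
  then show ?thesis using less by blast
qed

section \<open>From the modelling property to the Ramsey property\<close>

text \<open>Compactness: a copy of \<open>B\<close> contains only finitely many copies of
  \<open>A\<close>, so on these the limit agrees with a bad colouring of some finite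
  \<open>C\<close> that contains the copy of \<open>B\<close>.\<close>

lemma limit_colouring:
  assumes bad: "\<And>C. finite C \<Longrightarrow> C \<subseteq> univ N \<Longrightarrow> \<not> ramsey_arrow L N C N B A"
    and A: "finite A" and B: "finite B"
  shows "\<exists>\<chi> :: ('a \<Rightarrow> 'a) \<Rightarrow> bool. \<forall>e\<in>copies L N B N (univ N).
    \<exists>f\<in>copies L N A N (e ` B). \<exists>g\<in>copies L N A N (e ` B). \<chi> f \<noteq> \<chi> g"
proof -
  have "\<exists>\<chi>. \<forall>e\<in>copies L N B N C. \<forall>c. \<exists>f\<in>copies L N A N C. f ` A \<subseteq> e ` B \<and> (\<chi> f = (1 :: nat)) \<noteq> c"
    if C: "finite C" "C \<subseteq> univ N" for C
  proof -
    have "\<exists>\<chi>\<in>copies L N A N C \<rightarrow> {0, 1 :: nat}. \<not> (\<exists>e\<in>copies L N B N C. \<exists>c.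
        \<forall>f\<in>copies L N A N C. f ` A \<subseteq> e ` B \<longrightarrow> \<chi> f = c)"
      using bad[OF C] unfolding ramsey_arrow_def by (simp only: ball_simps(10))
    then obtain \<chi> where \<chi>: "\<chi> \<in> copies L N A N C \<rightarrow> {0, 1 :: nat}"
      and no': "\<not> (\<exists>e\<in>copies L N B N C. \<exists>c. \<forall>f\<in>copies L N A N C. f ` A \<subseteq> e ` B \<longrightarrow> \<chi> f = c)"
      by (rule bexE)
    have no: "\<exists>f\<in>copies L N A N C. f ` A \<subseteq> e ` B \<and> \<chi> f \<noteq> c" if "e \<in> copies L N B N C" for e c
      using no' that by blast
    have "\<exists>f\<in>copies L N A N C. f ` A \<subseteq> e ` B \<and> (\<chi> f = 1) \<noteq> c" if e: "e \<in> copies L N B N C" for e c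
    proof -
      obtain f where f: "f \<in> copies L N A N C" "f ` A \<subseteq> e ` B" "\<chi> f \<noteq> (if c then 1 else 0)"
        using no[OF e] by blast
      then have "\<chi> f = 0 \<or> \<chi> f = 1" using \<chi> by auto
      then show ?thesis using f by (intro bexI[of _ f]) (auto split: if_splits)
    qed
    then show ?thesis by blast
  qed
  then obtain X where X: "\<And>C e c. finite C \<Longrightarrow> C \<subseteq> univ N \<Longrightarrow> e \<in> copies L N B N C \<Longrightarrow>
      \<exists>f\<in>copies L N A N C. f ` A \<subseteq> e ` B \<and> (X C f = (1 :: nat)) \<noteq> c" by metis
  obtain \<chi> where \<chi>: "\<And>Y q. finite Y \<Longrightarrow> finite q \<Longrightarrow> q \<subseteq> univ N \<Longrightarrow>
      \<exists>C. finite C \<and> q \<subseteq> C \<and> C \<subseteq> univ N \<and> (\<forall>f\<in>Y. (X C f = 1) = \<chi> f)"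
    by (rule finite_subsets_limit[of "univ N" "\<lambda>C f. X C f = 1"]) (rule that)
  have "\<exists>f\<in>copies L N A N (e ` B). \<exists>g\<in>copies L N A N (e ` B). \<chi> f \<noteq> \<chi> g"
    if e: "e \<in> copies L N B N (univ N)" for e
  proof -
    let ?Y = "copies L N A N (e ` B)"
    have "?Y \<subseteq> A \<rightarrow>\<^sub>E e ` B" unfolding copies_def by blast
    moreover have "finite (A \<rightarrow>\<^sub>E e ` B)" using A B by (intro finite_PiE) auto
    ultimately have Y: "finite ?Y" by (rule finite_subset)
    have "e ` B \<subseteq> univ N" using e unfolding copies_def by auto
    then obtain C where C: "finite C" "e ` B \<subseteq> C" "C \<subseteq> univ N" "\<forall>f\<in>?Y. (X C f = 1) = \<chi> f"
      using \<chi>[OF Y finite_imageI[OF B] \<open>e ` B \<subseteq> univ N\<close>] by blast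
    have eC: "e \<in> copies L N B N C" using e C(2) unfolding copies_def by (auto simp: PiE_iff)
    have ex: "\<exists>f\<in>?Y. \<chi> f \<noteq> c" for c
    proof -
      obtain f where f: "f \<in> copies L N A N C" "f ` A \<subseteq> e ` B" "(X C f = 1) \<noteq> c"
        using X[OF C(1,3) eC, of c] by blast
      then have "f \<in> ?Y" unfolding copies_def by (auto simp: PiE_iff)
      then show ?thesis using f(3) C(4) by blast
    qed
    \<comment> \<open>The colouring is constant with neither value on the copy, so both colours
      occur.\<close>
    obtain f where f: "f \<in> ?Y" "\<chi> f \<noteq> True" using ex by (rule bexE)
    obtain g where g: "g \<in> ?Y" "\<chi> g \<noteq> False" using ex by (rule bexE)
    show ?thesis by (rule bexI[OF bexI[OF _ g(1)] f(1)]) (use f(2) g(2) in simp)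
  qed
  then show ?thesis by (intro exI[of _ \<chi>] ballI)
qed

text \<open>The monochromatic copy is a tuple \<open>js\<close> at which the embedding
  \<open>a0\<close> imitates \<open>b\<close> on \<open>B\<close>: copies of \<open>A\<close> inside
  it pull back to copies inside \<open>B\<close>, where indiscernibility gives all of them the same
  value of \<open>R\<close> on \<open>b\<close>.\<close>

lemma modelling_imp_finitary_ERP:
  fixes L' :: "('f, 'r) language" and N :: "('f, 'r, 'n) struct"
  assumes N: "is_structure L' N" and large: "large_universe TYPE('u) N"
    and mod_prop: "modelling_property TYPE('u) L' N"
  shows "finitary_ERP L' N"
  unfolding finitary_ERP_iff[OF N]
proof (intro allI impI, elim conjE, rule ccontr)
  fix A B
  assume A: "finite A" "A \<subseteq> univ N" and B: "finite B" "B \<subseteq> univ N"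
    and no: "\<not> (\<exists>C. finite C \<and> C \<subseteq> univ N \<and> ramsey_arrow L' N C N B A)"
  then have bad: "\<not> ramsey_arrow L' N C N B A" if "finite C" "C \<subseteq> univ N" for C using that by blast
  obtain \<chi> :: "('n \<Rightarrow> 'n) \<Rightarrow> bool" where \<chi>: "\<And>e. e \<in> copies L' N B N (univ N) \<Longrightarrow>
      \<exists>f\<in>copies L' N A N (e ` B). \<exists>g\<in>copies L' N A N (e ` B). \<chi> f \<noteq> \<chi> g"
    using limit_colouring[OF bad A(1) B(1)] by blast
  obtain as where as: "set as = A" "distinct as" using finite_distinct_list[OF A(1)] by blast
  obtain bs where bs: "set bs = B" "distinct bs" using finite_distinct_list[OF B(1)] by blast
  define m where "m = length as"
  \<comment> \<open>The empty set has just one copy, so its colourings are constant on the copy of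
    \<open>B\<close> given by the identity; this secures positive arity.\<close>
  have "A \<noteq> {}"
  proof
    assume "A = {}"
    have "restrict (\<lambda>x. x) B \<in> copies L' N B N (univ N)"
      unfolding copies_iff[OF B(1)] qf_embedding_def using B(2) by (auto simp: map_idI[of _ "restrict (\<lambda>x. x) B"] in_listsD)
    from \<chi>[OF this] show False using \<open>A = {}\<close> unfolding copies_def by auto
  qed
  then have "m > 0" using as unfolding m_def by auto
  let ?\<Lambda> = "univ N <+> (UNIV :: nat set)"
  obtain D :: "'u set" and R and \<kappa> :: "'u rel" where gen: "generic D R m \<kappa>" and \<kappa>: "|?\<Lambda>| <o \<kappa>"
  proof -
    have "infinite ?\<Lambda>" by simp
    from ex_generic[OF this large[unfolded large_universe_def], of m] show thesis using that by blast
  qed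
  have N\<kappa>: "|univ N| <o \<kappa>" using ordLeq_ordLess_trans[OF card_of_Plus1 \<kappa>] .
  have nat\<kappa>: "natLeq <o \<kappa>"
    using ordIso_ordLess_trans[OF ordIso_symmetric[OF card_of_nat] ordLeq_ordLess_trans[OF card_of_Plus2 \<kappa>]] .
  \<comment> \<open>The colouring as a relation on \<open>N\<close>: a list is the image of the
    enumeration \<open>as\<close> under at most one copy, so \<open>P\<close> loses no information
    about \<chi>.\<close>
  define P where "P ns \<longleftrightarrow> (\<exists>f\<in>copies L' N A N (univ N). ns = map f as \<and> \<chi> f)" for ns
  obtain a0 where a0: "a0 ` univ N \<subseteq> D"
    and R: "\<And>ns. length ns = m \<Longrightarrow> set ns \<subseteq> univ N \<Longrightarrow> R (map a0 ns) = P ns"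
    using generic_embedding[OF gen \<open>m > 0\<close> N\<kappa>, of P] by blast
  \<comment> \<open>One relation symbol and tuples of length one; \<open>undefined\<close> merely
    names the symbol and the single coordinate.\<close>
  define L :: "('u, 'u) language" where "L = rel_lang undefined m"
  define M :: "('u, 'u, 'u) struct" where "M = rel_struct D R"
  define T where "T = {\<phi> \<in> sentences L. \<forall>\<alpha>. range \<alpha> \<subseteq> univ M \<longrightarrow> sat M \<alpha> \<phi>}"
  let ?I = "{undefined :: 'u}"
  have D: "infinite D" by (rule generic_infinite[OF gen])
  then obtain d where d: "d \<in> D" by (metis ex_in_conv finite.emptyI)
  have "is_structure L M" using d unfolding is_structure_def L_def M_def by auto
  then have mod: "is_model L T M" unfolding is_model_def T_def by blast
  have "complete_theory L T"
    unfolding complete_theory_def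
  proof (intro conjI ballI)
    show "T \<subseteq> sentences L" unfolding T_def by blast
    fix \<phi> assume \<phi>: "\<phi> \<in> sentences L"
    then have "sat M \<alpha> \<phi> = sat M \<beta> \<phi>" for \<alpha> \<beta> by (intro sat_cong) (auto simp: sentences_def)
    then show "\<phi> \<in> T \<or> Neg \<phi> \<in> T" using \<phi> unfolding T_def sentences_def by auto
  qed
  moreover have "\<exists>M\<^sub>0 :: ('u, 'u, 'u) struct. is_model L T M\<^sub>0 \<and> infinite (univ M\<^sub>0)"
    using mod D by (intro exI[of _ M]) (simp add: M_def)
  moreover have "Card_order \<kappa>" using gen unfolding generic_def by blast
  moreover have "|fsyms L <+> rsyms L| <o \<kappa>" "|?I| <o \<kappa>"
    by (rule generic_finite[OF gen], simp add: L_def)+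
  moreover have "saturated L \<kappa> M" "homogeneous L \<kappa> M"
    unfolding L_def M_def by (rule generic_saturated[OF gen] generic_homogeneous[OF gen])+
  moreover have "tuple_sequence N M ?I (\<lambda>n _. a0 n)"
    using a0 unfolding tuple_sequence_def M_def by auto
  ultimately obtain b where ind: "indiscernible L' N L M ?I b"
    and based: "based_on L' N L M ?I b (\<lambda>n _. a0 n)"
    using mod_prop[unfolded modelling_property_def, THEN spec, THEN spec, THEN spec, THEN spec, THEN spec, THEN spec,
        of L T M \<kappa> ?I "\<lambda>n _. a0 n"] mod N\<kappa> nat\<kappa> by blast
  define \<phi> where "\<phi> ks = (Rel undefined (map (\<lambda>k. Var (k, undefined)) ks) :: ('u, 'u, nat \<times> 'u) fm)" for ks
  have \<phi>: "wf_fm L (\<phi> ks)" "fv (\<phi> ks) \<subseteq> {..<n} \<times> ?I" if "length ks = m" "set ks \<subseteq> {..<n}" for ks n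
    using that unfolding \<phi>_def L_def by (auto simp: list_all_iff)
  have sat_\<phi>: "sat M (concat_tuple c ns) (\<phi> ks) = R (map (\<lambda>k. c (ns ! k) undefined) ks)" for c ns ks
    unfolding \<phi>_def M_def by (simp add: concat_tuple_def comp_def)
  let ?n = "length bs"
  \<comment> \<open>All instances of \<open>R\<close> at entries of a tuple enumerating
    \<open>B\<close>. They are finitely many, so one \<open>js\<close> matches \<open>b\<close> on
    all of them at once.\<close>
  let ?\<Delta> = "\<phi> ` {ks. set ks \<subseteq> {..<?n} \<and> length ks = m}"
  have "finite ?\<Delta>" by (intro finite_imageI finite_lists_length_eq) simp
  moreover have "\<forall>\<psi>\<in>?\<Delta>. wf_fm L \<psi>" using \<phi>(1) by blast
  moreover have "bs \<in> lists (univ N)" using bs B by auto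
  ultimately obtain js where js: "js \<in> lists (univ N)" "length js = ?n" "qftp L' N bs = qftp L' N js"
    and tp: "tp_restr ?\<Delta> L M ({..<?n} \<times> ?I) (concat_tuple b bs) =
      tp_restr ?\<Delta> L M ({..<?n} \<times> ?I) (concat_tuple (\<lambda>n _. a0 n) js)"
    using based[unfolded based_on_def, THEN spec, THEN spec, of ?\<Delta> ?n] by blast
  have R_eq: "R (map (\<lambda>k. b (bs ! k) undefined) ks) = R (map (\<lambda>k. a0 (js ! k)) ks)"
    if ks: "length ks = m" "set ks \<subseteq> {..<?n}" for ks
  proof -
    have "\<phi> ks \<in> ?\<Delta>" using ks by blast
    then have "sat M (concat_tuple b bs) (\<phi> ks) = sat M (concat_tuple (\<lambda>n _. a0 n) js) (\<phi> ks)"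
      using tp \<phi>[OF ks] unfolding tp_restr_def tp_def by blast
    then show ?thesis unfolding sat_\<phi> .
  qed
  define pos where "pos x = (SOME k. k < ?n \<and> bs ! k = x)" for x
  have pos: "pos x < ?n \<and> bs ! pos x = x" if "x \<in> B" for x
    unfolding pos_def by (rule someI_ex) (use that bs(1) in \<open>auto simp: in_set_conv_nth\<close>)
  define e where "e = restrict (\<lambda>x. js ! pos x) B"
  have "e (bs ! k) = js ! k" if k: "k < ?n" for k
  proof -
    have "bs ! k \<in> B" using k bs(1) by auto
    from pos[OF this] have "pos (bs ! k) = k" using nth_eq_iff_index_eq[OF bs(2)] k by blast
    then show ?thesis using k bs(1) unfolding e_def by auto
  qed
  then have "map e bs = js" using js(2) by (auto intro: nth_equalityI)
  then have eq: "qf_embedding L' N B N e" using qf_embeddingI_enum[of L' N e bs N B] js(3) bs(1) by simp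
  have eN: "e ` B \<subseteq> univ N" using \<open>map e bs = js\<close> js(1) bs(1) by auto
  have "e \<in> copies L' N B N (univ N)"
    unfolding copies_iff[OF B(1)] using eq eN by (auto simp: e_def)
  from \<chi>[OF this] obtain f g where f: "f \<in> copies L' N A N (e ` B)" and g: "g \<in> copies L' N A N (e ` B)"
    and fg: "\<chi> f \<noteq> \<chi> g" by blast
  \<comment> \<open>\<open>ns\<close> is the preimage of \<open>f(as)\<close> under
    \<open>e\<close>. The colour of \<open>f\<close> is the value of \<open>R\<close> at the
    \<open>a0\<close>-image of \<open>f(as)\<close>, which by the choice of \<open>js\<close> is its
    value at \<open>b\<close> along \<open>ns\<close>.\<close>
  have key: "\<exists>ns. ns \<in> lists (univ N) \<and> length ns = m \<and> qftp L' N ns = qftp L' N as \<and>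
      \<chi> f = R (map (\<lambda>i. b i undefined) ns)" if f: "f \<in> copies L' N A N (e ` B)" for f
  proof -
    have fe: "f \<in> A \<rightarrow>\<^sub>E e ` B" and qf: "qf_embedding L' N A N f" using f by (auto simp: copies_iff[OF A(1)])
    define ks where "ks = map (\<lambda>x. pos (inv_into B e (f x))) as"
    have inB: "inv_into B e (f x) \<in> B" "e (inv_into B e (f x)) = f x" if "x \<in> A" for x
      using PiE_mem[OF fe that] by (auto intro: inv_into_into f_inv_into_f)
    have ks: "length ks = m" "set ks \<subseteq> {..<?n}"
      using inB pos as(1) unfolding ks_def m_def by auto
    define ns where "ns = map (\<lambda>x. inv_into B e (f x)) as"
    have bsk: "map (\<lambda>k. b (bs ! k) undefined) ks = map (\<lambda>i. b i undefined) ns"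
      unfolding ks_def ns_def using pos inB as(1) by auto
    have jsk: "map (\<lambda>k. a0 (js ! k)) ks = map a0 (map f as)"
    proof -
      have "js ! pos (inv_into B e (f x)) = f x" if "x \<in> A" for x
        using inB[OF that] unfolding e_def by simp
      then show ?thesis unfolding ks_def using as(1) by auto
    qed
    have fN: "f \<in> copies L' N A N (univ N)" using f eN unfolding copies_def by (auto simp: PiE_iff)
    have "R (map a0 (map f as)) = P (map f as)"
      by (rule R) (use fe eN as(1) in \<open>auto simp: m_def\<close>)
    also have "\<dots> = \<chi> f"
    proof -
      have "f' = f" if "f' \<in> copies L' N A N (univ N)" "map f as = map f' as" for f'
      proof (rule PiE_ext)
        show "f' \<in> A \<rightarrow>\<^sub>E univ N" "f \<in> A \<rightarrow>\<^sub>E univ N" using that(1) fN unfolding copies_def by auto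
      qed (use that(2) as(1) in auto)
      then show ?thesis unfolding P_def using fN by blast
    qed
    finally have "\<chi> f = R (map (\<lambda>i. b i undefined) ns)" using R_eq[OF ks] unfolding bsk jsk by simp
    moreover have "ns \<in> lists (univ N)"
      unfolding ns_def using subsetD[OF B(2) inB(1)] as(1) by auto
    moreover have "qftp L' N ns = qftp L' N as"
    proof -
      have "ns \<in> lists B" "as \<in> lists A" unfolding ns_def using inB(1) as(1) by auto
      then have "qftp L' N (map e ns) = qftp L' N ns" "qftp L' N (map f as) = qftp L' N as"
        using eq qf unfolding qf_embedding_def by auto
      moreover have "map e ns = map f as" unfolding ns_def using inB(2) as(1) by auto
      ultimately show ?thesis by simp
    qed
    ultimately show ?thesis by (intro exI[of _ ns]) (simp add: ns_def m_def)
  qed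
  obtain ns1 ns2 where ns1: "ns1 \<in> lists (univ N)" "length ns1 = m" "qftp L' N ns1 = qftp L' N as"
      "\<chi> f = R (map (\<lambda>i. b i undefined) ns1)"
    and ns2: "ns2 \<in> lists (univ N)" "length ns2 = m" "qftp L' N ns2 = qftp L' N as"
      "\<chi> g = R (map (\<lambda>i. b i undefined) ns2)"
    using key[OF f] key[OF g] by blast
  have "tp L M ({..<m} \<times> ?I) (concat_tuple b ns1) = tp L M ({..<m} \<times> ?I) (concat_tuple b ns2)"
    by (rule mp[OF ind[unfolded indiscernible_def, THEN spec, THEN bspec[OF _ ns1(1)], THEN bspec[OF _ ns2(1)]]])
      (simp add: ns1(2,3) ns2(2,3))
  then have "sat M (concat_tuple b ns1) (\<phi> [0..<m]) = sat M (concat_tuple b ns2) (\<phi> [0..<m])"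
  proof -
    assume "tp L M ({..<m} \<times> ?I) (concat_tuple b ns1) = tp L M ({..<m} \<times> ?I) (concat_tuple b ns2)"
    moreover have "wf_fm L (\<phi> [0..<m])" "fv (\<phi> [0..<m]) \<subseteq> {..<m} \<times> ?I" by (rule \<phi>; auto)+
    ultimately show ?thesis unfolding tp_def by blast
  qed
  moreover have "map (\<lambda>k. b (ns ! k) undefined) [0..<m] = map (\<lambda>i. b i undefined) ns" if "length ns = m" for ns
    using that by (auto intro: nth_equalityI)
  ultimately have "\<chi> f = \<chi> g" unfolding sat_\<phi> using ns1 ns2 by simp
  then show False using fg by blast
qed

lemma card_of_Times_ordLess:
  assumes \<kappa>: "Card_order \<kappa>" and nat: "natLeq <o \<kappa>" and A: "|A| <o \<kappa>" and B: "|B| <o \<kappa>"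
  shows "|A \<times> B| <o \<kappa>"
proof -
  \<comment> \<open>The summand of natural numbers makes \<open>?C\<close> infinite, so that it
    bounds the product, while its size stays below \<kappa>.\<close>
  let ?C = "A <+> (B <+> (UNIV :: nat set))"
  have inf: "infinite (Field \<kappa>)"
    using nat natLeq_ordLeq_cinfinite by (meson \<kappa> cinfinite_def cinfinite_mono natLeq_cinfinite ordLess_imp_ordLeq)
  have "|UNIV :: nat set| <o \<kappa>" using ordIso_ordLess_trans[OF card_of_nat nat] .
  then have "|?C| <o \<kappa>" by (intro card_of_Plus_ordLess_infinite_Field[OF inf \<kappa>] A B)
  moreover have "infinite ?C" by simp
  moreover have "|A| \<le>o |?C|" by (rule card_of_Plus1)
  moreover have "|B| \<le>o |?C|" by (rule ordLeq_transitive[OF card_of_Plus1 card_of_Plus2])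
  ultimately show ?thesis
    using ordLeq_ordLess_trans[OF card_of_Sigma_ordLeq_infinite[of ?C A "\<lambda>_. B"]] by blast
qed

theorem theorem7p9:
  fixes L' :: "('f, 'r) language" and N :: "('f, 'r, 'n) struct"
  assumes "is_structure L' N"
    and "large_universe TYPE('u) N"
  shows "finitary_ERP L' N \<longleftrightarrow> modelling_property TYPE('u) L' N"
proof
  assume erp: "finitary_ERP L' N"
  \<comment> \<open>\<open>'u\<close> must be infinite so that the variables indexed by
    \<open>'n \<times> 'u\<close> include fresh ones for substitution.\<close>
  have "|UNIV :: nat set| \<le>o |univ N <+> (UNIV :: nat set)|" by (rule card_of_Plus2)
  also have "|univ N <+> (UNIV :: nat set)| \<le>o |Pow (univ N <+> (UNIV :: nat set))|"
    by (rule ordLess_imp_ordLeq[OF card_of_Pow])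
  also have "|Pow (univ N <+> (UNIV :: nat set))| \<le>o |UNIV :: 'u set|"
    using assms(2) unfolding large_universe_def .
  finally have inf: "infinite (UNIV :: 'u set)" using infinite_iff_card_of_nat by blast
  show "modelling_property TYPE('u) L' N"
    unfolding modelling_property_def
  proof (intro allI impI, elim conjE)
    fix L :: "('u, 'u) language" and T and M :: "('u, 'u, 'u) struct" and \<kappa> :: "'u rel"
      and I :: "'u set" and a
    assume "is_model L T M" and sat: "saturated L \<kappa> M" and a: "tuple_sequence N M I a"
      and \<kappa>: "Card_order \<kappa>" "natLeq <o \<kappa>" "|univ N| <o \<kappa>" "|I| <o \<kappa>"
    then have ne: "univ M \<noteq> {}" unfolding is_model_def is_structure_def by blast
    show "\<exists>b. tuple_sequence N M I b \<and> indiscernible L' N L M I b \<and> based_on L' N L M I b a"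
      by (rule finitary_ERP_imp_modelling[OF assms(1) erp inf ne sat card_of_Times_ordLess[OF \<kappa>] a])
  qed
next
  assume "modelling_property TYPE('u) L' N"
  then show "finitary_ERP L' N" by (rule modelling_imp_finitary_ERP[OF assms])
qed

end
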